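(* For $(m,p)=(3,3)$ and Schubert data $\alpha^\bullet=((1,3,5),(1,3,5),J_1,J_1,J_1)$ for $\mathrm{Grass}(3,6)$, where $J_1=(1,2,4)$, one has $d(3,3;\alpha^\bullet)=6$ and property $\mathrm{SG}(3,3;\alpha^\bullet)$ holds.
   Context: Let $n=m+p$. $\mathrm{Grass}(p,n)$ is the Grassmannian of complex $p$-planes in $\mathbb C^n$; a complete flag $K_\bullet$ is a chain $K_1\subset\cdots\subset K_n=\mathbb C^n$, $\dim K_i=i$. A Schubert condition is $\alpha=(1\le\alpha_1<\cdots<\alpha_p\le n)$, $|\alpha|=\sum_i(\alpha_i-i)$, and $\Omega_\alpha K_\bullet=\{X\in\mathrm{Grass}(p,n):\dim(X\cap K_{n+1-\alpha_i})\ge p+1-i\ \forall i\}$. Schubert data: a sequence $(\alpha^1,\dots,\alpha^k)$ with $\sum_j|\alpha^j|=mp$; $d(m,p;\alpha^\bullet)$ is the number of points in $\bigcap_j\Omega_{\alpha^j}F^j_\bullet$ for flags in general position. $K_\bullet(s)$ ($s\in\mathbb C$) is the flag with $K_i(s)$ the row span of the first $i$ rows of the $n\times n$ matrix with $(i,j)$ entry $\binom{j-1}{i-1}s^{j-i}$. Property $\mathrm{SG}(m,p;\alpha^\bullet)$: there is a nonzero real polynomial $f$ in $k$ variables such that for all distinct reals $s_1,\dots,s_k$ with $f(s_1,\dots,s_k)\ne0$, $\bigcap_j\Omega_{\alpha^j}K_\bullet(s_j)$ consists of exactly $d(m,p;\alpha^\bullet)$ points, all real. The Pieri condition $J_a$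 is $(1,2,\dots,p-1,p+a)$. *)

theory Defs
  imports Complex_Main "HOL-Library.Function_Algebras"
begin

definition cscale :: "complex \<Rightarrow> (nat \<Rightarrow> complex) \<Rightarrow> (nat \<Rightarrow> complex)" where
  "cscale c v = (\<lambda>i. c * v i)"

definition Cn :: "nat \<Rightarrow> (nat \<Rightarrow> complex) set" where
  "Cn n = {v. \<forall>i\<ge>n. v i = 0}"

abbreviation cspan :: "(nat \<Rightarrow> complex) set \<Rightarrow> (nat \<Rightarrow> complex) set" where
  "cspan \<equiv> module.span cscale"

abbreviation csubspace :: "(nat \<Rightarrow> complex) set \<Rightarrow> bool" where
  "csubspace \<equiv> module.subspace cscale"

abbreviation cdim :: "(nat \<Rightarrow> complex) set \<Rightarrow> nat" where
  "cdim \<equiv> vector_space.dim cscale"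

definition Grass :: "nat \<Rightarrow> nat \<Rightarrow> (nat \<Rightarrow> complex) set set" where
  "Grass p n = {X. csubspace X \<and> X \<subseteq> Cn n \<and> cdim X = p}"

definition complete_flag :: "nat \<Rightarrow> (nat \<Rightarrow> (nat \<Rightarrow> complex) set) \<Rightarrow> bool" where
  "complete_flag n K \<longleftrightarrow>
     (\<forall>i\<in>{1..n}. csubspace (K i) \<and> K i \<subseteq> Cn n \<and> cdim (K i) = i) \<and>
     (\<forall>i\<in>{1..<n}. K i \<subseteq> K (Suc i)) \<and> K n = Cn n"

definition row_vec :: "nat \<Rightarrow> (nat \<Rightarrow> nat \<Rightarrow> complex) \<Rightarrow> nat \<Rightarrow> (nat \<Rightarrow> complex)" where
  "row_vec n M r = (\<lambda>c. if c < n then M r c else 0)"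

definition row_flag :: "nat \<Rightarrow> (nat \<Rightarrow> nat \<Rightarrow> complex) \<Rightarrow> nat \<Rightarrow> (nat \<Rightarrow> complex) set" where
  "row_flag n M i = cspan {row_vec n M r | r. r < i}"

definition invertible_mat :: "nat \<Rightarrow> (nat \<Rightarrow> nat \<Rightarrow> complex) \<Rightarrow> bool" where
  "invertible_mat n M \<longleftrightarrow> cdim (cspan {row_vec n M r | r. r < n}) = n"

text \<open>The osculating flag K(s): the (i,j) entry (1-indexed) of the matrix is
  binom(j-1,i-1) s^(j-i); in 0-indexed form entry (r,c) is binom(c,r) s^(c-r)
  (which is 0 when c < r).\<close>
definition osc_mat :: "real \<Rightarrow> nat \<Rightarrow> nat \<Rightarrow> complex" where
  "osc_mat s r c = complex_of_real (real (c choose r) * s ^ (c - r))"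

definition osc_flag :: "nat \<Rightarrow> real \<Rightarrow> nat \<Rightarrow> (nat \<Rightarrow> complex) set" where
  "osc_flag n s = row_flag n (osc_mat s)"

text \<open>Schubert conditions are lists [alpha_1,...,alpha_p] (alpha_i = alpha ! (i-1)).\<close>
definition schubert_cond :: "nat \<Rightarrow> nat \<Rightarrow> nat list \<Rightarrow> bool" where
  "schubert_cond n p \<alpha> \<longleftrightarrow> length \<alpha> = p \<and> sorted_wrt (<) \<alpha> \<and> (\<forall>a\<in>set \<alpha>. 1 \<le> a \<and> a \<le> n)"

definition cond_size :: "nat list \<Rightarrow> nat" where
  "cond_size \<alpha> = (\<Sum>i=1..length \<alpha>. \<alpha> ! (i - 1) - i)"

definition Omega :: "nat \<Rightarrow> nat \<Rightarrow> nat list \<Rightarrow> (nat \<Rightarrow> (nat \<Rightarrow> complex) set) \<Rightarrow> (nat \<Rightarrow> complex) set set" where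
  "Omega n p \<alpha> K = {X \<in> Grass p n. \<forall>i\<in>{1..p}. cdim (X \<inter> K (n + 1 - \<alpha> ! (i - 1))) \<ge> p + 1 - i}"

definition pieri :: "nat \<Rightarrow> nat \<Rightarrow> nat list" where
  "pieri p a = [1..<p] @ [p + a]"

definition schubert_inter ::
  "nat \<Rightarrow> nat \<Rightarrow> nat list list \<Rightarrow> (nat \<Rightarrow> nat \<Rightarrow> (nat \<Rightarrow> complex) set) \<Rightarrow> (nat \<Rightarrow> complex) set set" where
  "schubert_inter m p \<alpha>s Ks = {X \<in> Grass p (m + p). \<forall>j<length \<alpha>s. X \<in> Omega (m + p) p (\<alpha>s ! j) (Ks j)}"

inductive polyfun :: "'v set \<Rightarrow> (('v \<Rightarrow> 'a::comm_ring_1) \<Rightarrow> 'a) \<Rightarrow> bool" for V where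
  pf_const: "polyfun V (\<lambda>x. c)"
| pf_var: "v \<in> V \<Longrightarrow> polyfun V (\<lambda>x. x v)"
| pf_add: "polyfun V f \<Longrightarrow> polyfun V g \<Longrightarrow> polyfun V (\<lambda>x. f x + g x)"
| pf_mult: "polyfun V f \<Longrightarrow> polyfun V g \<Longrightarrow> polyfun V (\<lambda>x. f x * g x)"

text \<open>Flags in general position: a tuple of complete flags is given by a tuple
  of invertible matrices g_j (the flag K^j_i is the span of the first i rows of
  g_j, entries g(j,r,c)); general position means outside the zero set of a
  nonzero complex polynomial in the entries.  generic_count m p as d says that
  for flags in general position the intersection consists of exactly d points.\<close>
definition generic_count :: "nat \<Rightarrow> nat \<Rightarrow> nat list list \<Rightarrow> nat \<Rightarrow> bool" where
  "generic_count m p \<alpha>s d \<longleftrightarrow>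
     (\<exists>F. polyfun {(j, r, c). j < length \<alpha>s \<and> r < m + p \<and> c < m + p} F \<and>
          F \<noteq> (\<lambda>_. 0) \<and>
          (\<forall>g :: nat \<times> nat \<times> nat \<Rightarrow> complex.
             (\<forall>j<length \<alpha>s. invertible_mat (m + p) (\<lambda>r c. g (j, r, c))) \<and> F g \<noteq> 0 \<longrightarrow>
             (let S = schubert_inter m p \<alpha>s (\<lambda>j. row_flag (m + p) (\<lambda>r c. g (j, r, c)))
              in finite S \<and> card S = d)))"

definition dnum :: "nat \<Rightarrow> nat \<Rightarrow> nat list list \<Rightarrow> nat" where
  "dnum m p \<alpha>s = (THE d. generic_count m p \<alpha>s d)"

text \<open>A point X of the Grassmannian is real iff it is stable under complex
  conjugation (equivalently, it is spanned by real vectors).\<close>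
definition real_point :: "(nat \<Rightarrow> complex) set \<Rightarrow> bool" where
  "real_point X \<longleftrightarrow> (\<forall>v\<in>X. (\<lambda>i. cnj (v i)) \<in> X)"

definition SG :: "nat \<Rightarrow> nat \<Rightarrow> nat list list \<Rightarrow> bool" where
  "SG m p \<alpha>s \<longleftrightarrow>
     (\<exists>f :: (nat \<Rightarrow> real) \<Rightarrow> real.
        polyfun {..<length \<alpha>s} f \<and> f \<noteq> (\<lambda>_. 0) \<and>
        (\<forall>s :: nat \<Rightarrow> real. inj_on s {..<length \<alpha>s} \<and> f s \<noteq> 0 \<longrightarrow>
           (let S = schubert_inter m p \<alpha>s (\<lambda>j. osc_flag (m + p) (s j))
            in finite S \<and> card S = dnum m p \<alpha>s \<and> (\<forall>X\<in>S. real_point X))))"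

end

theory Submission
  imports Defs "Subresultants.Subresultant_Gcd" "Jordan_Normal_Form.Char_Poly"
    "HOL-Computational_Algebra.Field_as_Ring"
begin

text \<open>The two conditions (1,3,5) force \<open>X\<close> to be \<open>\<langle>u\<rangle> \<oplus> \<langle>v\<rangle> \<oplus> \<langle>w\<rangle>\<close> with \<open>u\<close>, \<open>v\<close>, \<open>w\<close> in the
  three summands \<open>K 2\<close>, \<open>K 4 \<inter> K' 4\<close>, \<open>K' 2\<close> of the space (\<open>K\<close>, \<open>K'\<close> being the first two flags), so the
  intersection of the first two Schubert varieties is a product of three projective lines.
  Each condition \<open>J_1\<close> is one trilinear equation there.
  For general flags, eliminating \<open>v\<close> and \<open>w\<close> from the three equations leaves a binary sextic in \<open>u\<close>;
  it has six simple roots off a hypersurface, as an explicit example shows.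

  For osculating flags at \<open>s_1, \<dots>, s_5\<close> the equations say that a fixed trilinear expression, read as
  a cubic polynomial in one variable, vanishes at the three points
  \<open>r_j = (s_j - s_1) / (s_2 - s_j)\<close>. With \<open>e_1\<close>, \<open>e_2\<close>, \<open>e_3\<close> the elementary symmetric functions of
  the \<open>r_j\<close> this becomes
  \<open>3x + 6y + 15z = 8 e_1\<close>, \<open>3xy + 6xz + 15yz = 8 e_2\<close>, \<open>xyz = e_3\<close>, and \<open>y\<close> is a root of a cubic,
  after which \<open>x\<close> is a root of a quadratic.
  The cubic has three distinct real roots by sign changes, and the discriminant of the quadratic is
  positive because, after clearing denominators, it is a sum of squares. So no points \<open>s_j\<close> have to
  be excluded, and the polynomial \<open>f\<close> of property SG can be taken to be 1.\<close>

subsection \<open>Linear algebra of sequences of vectors\<close>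

text \<open>General flags need a separate treatment because \<open>dnum\<close> is defined through
  them, and there every condition must be a polynomial in the matrix entries. Hence adjugates stand
  in for inverses, and the discriminant is a determinant of fixed format. Two nonzero polynomial
  functions are seen to be nonzero at a common point by restriction to a line.

  For osculating flags the middle ratio y is isolated, not u. In 3xy + 6xz + 15yz it multiplies 3x +
  15z, which the first equation fixes in terms of y. So xz, and then xyz, becomes a polynomial in y
  alone: this is the cubic. Given y, the sum and the product of x and 5z are known, so these two are
  the roots of one quadratic.

  The numbers 3, 6, 15, 8 are minors of a band matrix with rows 1, 3, 3, 1: three equal arguments of
  a symmetric multiaffine map are expanded between the parameters of the first two flags. In this
  basis the product of powers common to all terms splits off, and what remains depends on s_j only
  through r_j.\<close>

interpretation cv: vector_space cscale
  by unfold_locales (auto simp: cscale_def algebra_simps fun_eq_iff)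

lemma sum_fun_apply: "(\<Sum>x\<in>A. f x) l = (\<Sum>x\<in>A. f x l)" for f :: "'a \<Rightarrow> 'b \<Rightarrow> 'c::comm_monoid_add"
  by (induction A rule: infinite_finite_induct) auto

definition comb :: "nat \<Rightarrow> (nat \<Rightarrow> nat \<Rightarrow> complex) \<Rightarrow> (nat \<Rightarrow> complex) \<Rightarrow> nat \<Rightarrow> complex" where
  "comb n f k = (\<lambda>l. \<Sum>i<n. k i * f i l)"

text \<open>Independence of an indexed family: a repeated vector counts as a dependence, which the
  image set would not show.\<close>

definition indep_seq :: "nat \<Rightarrow> (nat \<Rightarrow> nat \<Rightarrow> complex) \<Rightarrow> bool" where
  "indep_seq n f \<longleftrightarrow> (\<forall>k. comb n f k = 0 \<longrightarrow> (\<forall>i<n. k i = 0))"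

lemma indep_seqD: "indep_seq n f \<Longrightarrow> comb n f k = 0 \<Longrightarrow> i < n \<Longrightarrow> k i = 0"
  by (simp add: indep_seq_def)

lemma comb_eq_sum: "comb n f k = (\<Sum>i<n. cscale (k i) (f i))"
  by (rule ext) (simp add: comb_def sum_fun_apply cscale_def)

lemma indep_seq_iff: "indep_seq n f \<longleftrightarrow> inj_on f {..<n} \<and> \<not> cv.dependent (f ` {..<n})"
proof
  assume L: "indep_seq n f"
  have inj: "inj_on f {..<n}"
  proof (rule inj_onI, rule ccontr)
    fix i j assume ij: "i \<in> {..<n}" "j \<in> {..<n}" "f i = f j" "i \<noteq> j"
    define k where "k = (\<lambda>m. if m = i then 1 else if m = j then - 1 else (0::complex))"
    have "comb n f k l = 0" for l
    proof -
      have "(\<Sum>m<n. k m * f m l) = (\<Sum>m\<in>{i,j}. k m * f m l)"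
        by (rule sum.mono_neutral_right) (use ij in \<open>auto simp: k_def\<close>)
      also have "\<dots> = 0" using ij by (simp add: k_def)
      finally show ?thesis by (simp add: comb_def)
    qed
    then have "comb n f k = 0" by auto
    then have "k i = 0" using L ij by (auto simp: indep_seq_def)
    then show False by (simp add: k_def)
  qed
  moreover have "\<not> cv.dependent (f ` {..<n})"
  proof (rule cv.independent_if_scalars_zero)
    fix u x assume s: "(\<Sum>x\<in>f ` {..<n}. cscale (u x) x) = 0" and x: "x \<in> f ` {..<n}"
    have "comb n f (\<lambda>i. u (f i)) = 0"
      using s by (simp add: comb_eq_sum sum.reindex[OF inj])
    then show "u x = 0" using L x unfolding indep_seq_def by blast
  qed simp
  ultimately show "inj_on f {..<n} \<and> \<not> cv.dependent (f ` {..<n})" ..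
next
  assume R: "inj_on f {..<n} \<and> \<not> cv.dependent (f ` {..<n})"
  show "indep_seq n f" unfolding indep_seq_def
  proof (intro allI impI)
    fix k i assume k: "comb n f k = 0" and i: "i < n"
    let ?u = "\<lambda>x. k (the_inv_into {..<n} f x)"
    have "(\<Sum>x\<in>f ` {..<n}. cscale (?u x) x) = (\<Sum>i<n. cscale (k i) (f i))"
      using R by (subst sum.reindex) (auto simp: the_inv_into_f_f intro!: sum.cong)
    then have "(\<Sum>x\<in>f ` {..<n}. cscale (?u x) x) = 0" using k by (simp add: comb_eq_sum)
    from cv.independentD[OF conjunct2[OF R] _ order_refl this, of "f i"] i R
    show "k i = 0" by (auto simp: the_inv_into_f_f)
  qed
qed

lemma subspace_range_comb: "csubspace (range (comb n f))"
proof (rule cv.subspaceI)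
  have "comb n f (\<lambda>_. 0) = 0" by (auto simp: comb_def)
  then show "0 \<in> range (comb n f)" by (metis rangeI)
next
  fix x y assume "x \<in> range (comb n f)" "y \<in> range (comb n f)"
  then obtain k k' where "x = comb n f k" "y = comb n f k'" by auto
  then have "x + y = comb n f (\<lambda>i. k i + k' i)"
    by (auto simp: comb_def distrib_right sum.distrib)
  then show "x + y \<in> range (comb n f)" by blast
next
  fix c x assume "x \<in> range (comb n f)"
  then obtain k where "x = comb n f k" by auto
  then have "cscale c x = comb n f (\<lambda>i. c * k i)"
    by (auto simp: comb_def cscale_def sum_distrib_left mult.assoc)
  then show "cscale c x \<in> range (comb n f)" by blast
qed

lemma comb_in_subspace:
  assumes "csubspace S" "\<And>i. i < n \<Longrightarrow> f i \<in> S"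
  shows "comb n f k \<in> S"
  unfolding comb_eq_sum
proof (rule cv.subspace_sum[OF assms(1)])
  fix i assume "i \<in> {..<n}"
  then show "cscale (k i) (f i) \<in> S" by (intro cv.subspace_scale assms) simp
qed

lemma comb_single:
  assumes "i < n" shows "comb n f (\<lambda>j. if j = i then 1 else 0) = f i"
proof
  fix l
  have "(\<Sum>j<n. (if j = i then 1 else 0) * f j l) = (\<Sum>j<n. if j = i then f j l else 0)"
    by (rule sum.cong) auto
  then show "comb n f (\<lambda>j. if j = i then 1 else 0) l = f i l"
    using assms by (simp add: comb_def)
qed

lemma span_image_lessThan: "cspan (f ` {..<n}) = range (comb n f)"
proof
  have "f ` {..<n} \<subseteq> range (comb n f)"
  proof
    fix x assume "x \<in> f ` {..<n}"
    then obtain i where "i < n" "x = f i" by auto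
    then have "x = comb n f (\<lambda>j. if j = i then 1 else 0)" by (simp add: comb_single)
    then show "x \<in> range (comb n f)" by blast
  qed
  then show "cspan (f ` {..<n}) \<subseteq> range (comb n f)"
    by (rule cv.span_minimal[OF _ subspace_range_comb])
  show "range (comb n f) \<subseteq> cspan (f ` {..<n})"
  proof
    fix x assume "x \<in> range (comb n f)"
    then obtain k where x: "x = comb n f k" by auto
    show "x \<in> cspan (f ` {..<n})"
      unfolding x by (rule comb_in_subspace[OF cv.subspace_span], rule cv.span_base) simp
  qed
qed

text \<open>The ambient space of all sequences is infinite-dimensional, and \<open>cdim\<close> of a
  set without finite basis is 0. The finite spanning set \<open>W\<close> excludes that default
  value.\<close>

lemma indep_seq_le_dim:
  assumes "indep_seq n f" "\<And>i. i < n \<Longrightarrow> f i \<in> S" "S \<subseteq> cspan W" "finite W"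
  shows "n \<le> cdim S"
proof -
  have ind: "inj_on f {..<n}" "\<not> cv.dependent (f ` {..<n})" using assms(1) by (auto simp: indep_seq_iff)
  have "f ` {..<n} \<subseteq> S" using assms(2) by auto
  from cv.maximal_independent_subset_extend[OF this ind(2)] obtain B where
    B: "f ` {..<n} \<subseteq> B" "B \<subseteq> S" "\<not> cv.dependent B" "S \<subseteq> cspan B" .
  have "B \<subseteq> cspan W" using B(2) assms(3) by (rule subset_trans)
  then have "finite B" using cv.independent_span_bound[OF assms(4) B(3)] by simp
  have "n = card (f ` {..<n})" using ind(1) by (simp add: card_image)
  also have "\<dots> \<le> card B" by (rule card_mono[OF \<open>finite B\<close> B(1)])
  also have "\<dots> = cdim S" using cv.basis_card_eq_dim[OF B(2,4,3)] .
  finally show ?thesis .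
qed

lemma le_dim_ex_indep_seq:
  assumes "n \<le> cdim S"
  shows "\<exists>f. indep_seq n f \<and> (\<forall>i<n. f i \<in> S)"
proof (cases "n = 0")
  case True
  then show ?thesis by (simp add: indep_seq_def)
next
  case False
  from cv.basis_exists[of S] obtain B where
    B: "B \<subseteq> S" "\<not> cv.dependent B" "S \<subseteq> cspan B" "card B = cdim S" .
  obtain T where T: "T \<subseteq> B" "card T = n" "finite T"
    using obtain_subset_with_card_n[of n B] assms B(4) by metis
  obtain f where f: "bij_betw f {0..<n} T"
    using ex_bij_betw_nat_finite[OF T(3)] T(2) by auto
  have "\<not> cv.dependent T" using cv.independent_mono[OF B(2) T(1)] .
  then have "indep_seq n f" unfolding indep_seq_iff
    using f by (simp add: bij_betw_def atLeast0LessThan)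
  moreover have "f i \<in> S" if "i < n" for i
    using bij_betwE[OF f] T(1) B(1) that by (auto simp: subset_iff)
  ultimately show ?thesis by auto
qed

text \<open>A vector outside the span would give n + 1 independent vectors inside the span of at
  most n.\<close>

lemma indep_seq_spans:
  assumes "indep_seq n f" "\<And>i. i < n \<Longrightarrow> f i \<in> S" "x \<in> S" "S \<subseteq> cspan W" "finite W" "card W \<le> n"
  shows "x \<in> range (comb n f)"
proof (rule ccontr)
  assume "x \<notin> range (comb n f)"
  then have x: "x \<notin> cspan (f ` {..<n})" by (simp add: span_image_lessThan)
  have ind: "inj_on f {..<n}" "\<not> cv.dependent (f ` {..<n})" using assms(1) by (auto simp: indep_seq_iff)
  have "\<not> cv.dependent (insert x (f ` {..<n}))" by (rule cv.independent_insertI[OF x ind(2)])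
  moreover have "insert x (f ` {..<n}) \<subseteq> cspan W" using assms(2,3,4) by blast
  ultimately have "card (insert x (f ` {..<n})) \<le> card W"
    using cv.independent_span_bound[OF assms(5)] by blast
  moreover have "x \<notin> f ` {..<n}" using x cv.span_base[of x "f ` {..<n}"] by blast
  then have "card (insert x (f ` {..<n})) = Suc n"
    using ind(1) by (simp add: card_image)
  ultimately show False using assms(6) by simp
qed

lemma subspace_dim_span:
  assumes "cdim S = n" "n > 0"
  obtains W where "finite W" "card W = n" "S \<subseteq> cspan W"
proof -
  from cv.basis_exists[of S] obtain B where
    "B \<subseteq> S" "\<not> cv.dependent B" "S \<subseteq> cspan B" "card B = cdim S" .
  \<comment> \<open>An infinite basis would have cardinality 0, against
    \<open>n > 0\<close>.\<close>
  moreover from this have "finite B" by (intro card_ge_0_finite) (simp add: assms)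
  ultimately show ?thesis using that[of B] assms(1) by simp
qed

text \<open>A dimension count turns containment of generators into equality of spans; it identifies
  flag steps with spans of adapted basis vectors.\<close>

lemma range_comb_eq:
  assumes "indep_seq n e" "\<And>i. i < n \<Longrightarrow> e i \<in> range (comb n f)"
  shows "range (comb n f) = range (comb n e)"
proof
  show "range (comb n e) \<subseteq> range (comb n f)"
    by (intro image_subsetI comb_in_subspace[OF subspace_range_comb assms(2)])
  have "card (f ` {..<n}) \<le> n" using card_image_le[of "{..<n}" f] by simp
  then show "range (comb n f) \<subseteq> range (comb n e)"
    by (intro subsetI indep_seq_spans[OF assms, of _ "f ` {..<n}"])
       (simp_all add: span_image_lessThan)
qed

lemma dim_range_comb: "indep_seq n e \<Longrightarrow> cdim (range (comb n e)) = n"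
  unfolding span_image_lessThan[symmetric]
  by (subst cv.dim_span_eq_card_independent) (auto simp: indep_seq_iff card_image)

lemma indep_seq_mono:
  assumes "indep_seq n f" "m \<le> n" shows "indep_seq m f"
proof -
  have "{..<m} \<subseteq> {..<n}" using assms(2) by simp
  then have "f ` {..<m} \<subseteq> f ` {..<n}" by (rule image_mono)
  then show ?thesis using assms(1) unfolding indep_seq_iff
    by (metis \<open>{..<m} \<subseteq> {..<n}\<close> cv.independent_mono inj_on_subset)
qed

lemma row_flag_eq: "row_flag n M i = range (comb i (row_vec n M))"
proof -
  have "{row_vec n M r |r. r < i} = row_vec n M ` {..<i}" by auto
  then show ?thesis by (simp add: row_flag_def span_image_lessThan)
qed

lemma comb_in_Cn: "(\<And>i. i < m \<Longrightarrow> f i \<in> Cn n) \<Longrightarrow> comb m f k \<in> Cn n"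
  by (auto simp: comb_def Cn_def)

lemma row_vec_in_Cn: "row_vec n M r \<in> Cn n"
  by (simp add: row_vec_def Cn_def)

lemma Cn_span: "Cn n = range (comb n (\<lambda>i l. if l = i then 1 else 0))"
proof (intro equalityI subsetI)
  fix x :: "nat \<Rightarrow> complex" assume "x \<in> Cn n"
  have "x l = comb n (\<lambda>i l. if l = i then 1 else 0) x l" for l
  proof -
    have "(\<Sum>i<n. x i * (if l = i then 1 else 0)) = (\<Sum>i<n. if l = i then x i else 0)"
      by (rule sum.cong) auto
    then show ?thesis using \<open>x \<in> Cn n\<close> by (simp add: comb_def Cn_def)
  qed
  then have "x = comb n (\<lambda>i l. if l = i then 1 else 0) x" by (rule ext)
  then show "x \<in> range (comb n (\<lambda>i l. if l = i then 1 else 0))" by blast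
qed (auto simp: Cn_def comb_def intro!: sum.neutral)

lemma Cn_eq_range_comb:
  assumes "indep_seq n e" "\<And>i. i < n \<Longrightarrow> e i \<in> Cn n"
  shows "Cn n = range (comb n e)"
  using range_comb_eq[OF assms(1)] assms(2) unfolding Cn_span by blast

lemma sum_lessThan_6: "sum f {..<6::nat} = f 0 + f 1 + f 2 + f 3 + f 4 + f 5"
  and sum_lessThan_5: "sum f {..<5::nat} = f 0 + f 1 + f 2 + f 3 + f 4"
  and sum_lessThan_4: "sum f {..<4::nat} = f 0 + f 1 + f 2 + f 3"
  and sum_lessThan_3: "sum f {..<3::nat} = f 0 + f 1 + f 2"
  and sum_lessThan_2: "sum f {..<2::nat} = f 0 + f 1"
  for f :: "nat \<Rightarrow> 'a::comm_monoid_add"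
  by (simp_all add: eval_nat_numeral)

lemmas sum_lessThan_small = sum_lessThan_2 sum_lessThan_3 sum_lessThan_4 sum_lessThan_5 sum_lessThan_6

lemma all_less_6: "(\<forall>i<6::nat. P i) \<longleftrightarrow> P 0 \<and> P 1 \<and> P 2 \<and> P 3 \<and> P 4 \<and> P 5"
proof -
  have "i < 6 \<longleftrightarrow> i = 0 \<or> i = 1 \<or> i = 2 \<or> i = 3 \<or> i = 4 \<or> i = 5" for i :: nat by linarith
  then show ?thesis by auto
qed

lemma all_less_4: "(\<forall>i<4::nat. P i) \<longleftrightarrow> P 0 \<and> P 1 \<and> P 2 \<and> P 3"
proof -
  have "i < 4 \<longleftrightarrow> i = 0 \<or> i = 1 \<or> i = 2 \<or> i = 3" for i :: nat by linarith
  then show ?thesis by auto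
qed

lemma all_less_3: "(\<forall>i<3::nat. P i) \<longleftrightarrow> P 0 \<and> P 1 \<and> P 2"
proof -
  have "i < 3 \<longleftrightarrow> i = 0 \<or> i = 1 \<or> i = 2" for i :: nat by linarith
  then show ?thesis by auto
qed

lemma all_less_2: "(\<forall>i<2::nat. P i) \<longleftrightarrow> P 0 \<and> P 1"
proof -
  have "i < 2 \<longleftrightarrow> i = 0 \<or> i = 1" for i :: nat by linarith
  then show ?thesis by auto
qed

lemma comb_comb: "comb m (\<lambda>r. comb n E (c r)) k = comb n E (\<lambda>i. \<Sum>r<m. k r * c r i)"
proof
  fix l
  have "(\<Sum>r<m. k r * (\<Sum>i<n. c r i * E i l)) = (\<Sum>r<m. \<Sum>i<n. k r * c r i * E i l)"
    by (simp add: sum_distrib_left mult.assoc)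
  also have "\<dots> = (\<Sum>i<n. \<Sum>r<m. k r * c r i * E i l)" by (rule sum.swap[of "\<lambda>r i. k r * c r i * E i l"])
  also have "\<dots> = (\<Sum>i<n. (\<Sum>r<m. k r * c r i) * E i l)" by (simp add: sum_distrib_right)
  finally show "comb m (\<lambda>r. comb n E (c r)) k l = comb n E (\<lambda>i. \<Sum>r<m. k r * c r i) l"
    by (simp add: comb_def)
qed

lemma comb_unique:
  assumes "indep_seq n f" "comb n f k = comb n f k'" "i < n"
  shows "k i = k' i"
proof -
  have "comb n f (\<lambda>i. k i - k' i) l = 0" for l
    using fun_cong[OF assms(2), of l] by (simp add: comb_def left_diff_distrib sum_subtractf)
  then have "comb n f (\<lambda>i. k i - k' i) = 0" by auto
  then show ?thesis using assms(1,3) unfolding indep_seq_def by auto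
qed

lemma indep_seq_reindex:
  assumes "indep_seq n f" "inj_on h {..<m}" "h ` {..<m} \<subseteq> {..<n}"
  shows "indep_seq m (\<lambda>i. f (h i))"
proof -
  have f: "inj_on f {..<n}" "\<not> cv.dependent (f ` {..<n})" using assms(1) by (auto simp: indep_seq_iff)
  have "inj_on (f \<circ> h) {..<m}"
    using comp_inj_on[OF assms(2) inj_on_subset[OF f(1) assms(3)]] .
  moreover have "(f \<circ> h) ` {..<m} \<subseteq> f ` {..<n}" using image_mono[OF assms(3)] by (simp only: image_comp[symmetric])
  then have "\<not> cv.dependent ((f \<circ> h) ` {..<m})" by (rule cv.independent_mono[OF f(2)])
  ultimately show ?thesis by (simp add: indep_seq_iff comp_def)
qed

lemma spanning_imp_indep_seq:
  assumes "indep_seq n e" "range (comb n f) = range (comb n e)"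
  shows "indep_seq n f"
proof -
  have d: "cdim (f ` {..<n}) = n"
    using dim_range_comb[OF assms(1)] assms(2) cv.dim_span[of "f ` {..<n}"]
    by (simp add: span_image_lessThan)
  from cv.maximal_independent_subset[of "f ` {..<n}"] obtain B where
    B: "B \<subseteq> f ` {..<n}" "\<not> cv.dependent B" "f ` {..<n} \<subseteq> cspan B" .
  have "card B = n" using cv.basis_card_eq_dim[OF B(1,3,2)] d by simp
  moreover have le: "card (f ` {..<n}) \<le> n" using card_image_le[of "{..<n}" f] by simp
  ultimately have Bf: "B = f ` {..<n}" using card_seteq[OF _ B(1)] by simp
  then have "inj_on f {..<n}" using \<open>card B = n\<close> by (intro eq_card_imp_inj_on) simp_all
  then show ?thesis using B(2) Bf by (simp add: indep_seq_iff)
qed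

lemma dim_ge_1_obtain:
  assumes "1 \<le> cdim S"
  obtains x where "x \<in> S" "x \<noteq> 0"
proof -
  obtain f where f: "indep_seq 1 f" "\<And>i. i < 1 \<Longrightarrow> f i \<in> S"
    using le_dim_ex_indep_seq[OF assms] by auto
  have "f 0 \<noteq> 0"
  proof
    assume "f 0 = 0"
    then have "comb 1 f (\<lambda>_. 1) = 0" by (auto simp: comb_def)
    from indep_seqD[OF f(1) this, of 0] show False by simp
  qed
  then show ?thesis using that f(2)[of 0] by simp
qed

lemma nonzero_imp_dim_ge_1:
  assumes "x \<in> S" "x \<noteq> 0" "S \<subseteq> cspan W" "finite W"
  shows "1 \<le> cdim S"
proof (rule indep_seq_le_dim[OF _ _ assms(3,4)])
  show "indep_seq 1 (\<lambda>_. x)" unfolding indep_seq_def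
  proof (intro allI impI)
    fix k i assume k: "comb 1 (\<lambda>_. x) k = 0" and "i < (1::nat)"
    from assms(2) obtain l where "x l \<noteq> 0" by (auto simp: fun_eq_iff)
    then show "k i = 0" using fun_cong[OF k, of l] \<open>i < 1\<close> by (simp add: comb_def)
  qed
qed (use assms in auto)

text \<open>Dimension count: \<open>2 + 2 > 3\<close>.\<close>

lemma two_planes_meet_in_3space:
  assumes X: "csubspace X" "cdim X = 3" and S: "csubspace S" "csubspace T"
    and d: "2 \<le> cdim (X \<inter> S)" "2 \<le> cdim (X \<inter> T)"
  obtains v where "v \<in> X" "v \<in> S" "v \<in> T" "v \<noteq> 0"
proof -
  obtain p where p: "indep_seq 2 p" "\<And>i. i < 2 \<Longrightarrow> p i \<in> X \<inter> S"
    using le_dim_ex_indep_seq[OF d(1)] by auto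
  obtain q where q: "indep_seq 2 q" "\<And>i. i < 2 \<Longrightarrow> q i \<in> X \<inter> T"
    using le_dim_ex_indep_seq[OF d(2)] by auto
  define f where "f = (\<lambda>i. if i < 2 then p i else q (i - 2))"
  obtain W where W: "finite W" "card W = 3" "X \<subseteq> cspan W" 
    by (rule subspace_dim_span[OF X(2)]) simp_all
  have "f i \<in> X" if "i < 4" for i using p(2)[of i] q(2)[of "i - 2"] that by (auto simp: f_def)
  then have "\<not> indep_seq 4 f" using indep_seq_le_dim[OF _ _ W(3,1), of 4 f] X(2) by auto
  then obtain k where k: "comb 4 f k = 0" "\<exists>i<4. k i \<noteq> 0" unfolding indep_seq_def by auto
  \<comment> \<open>The \<open>q\<close> part of the relation, moved to the other side: the same
    vector is then seen in \<open>S\<close> and in \<open>T\<close>.\<close>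
  define k' where "k' = (\<lambda>i. - k (i + 2))"
  have eq: "comb 2 p k = comb 2 q k'"
  proof
    fix l
    have "k 0 * p 0 l + k 1 * p 1 l + k 2 * q 0 l + k 3 * q 1 l = 0"
      using fun_cong[OF k(1), of l] by (simp add: comb_def sum_lessThan_4 f_def)
    then have "k 0 * p 0 l + k 1 * p 1 l = - k 2 * q 0 l + - k 3 * q 1 l"
      by Groebner_Basis.algebra
    moreover have "k' 0 = - k 2" "k' 1 = - k 3" by (simp_all add: k'_def numeral_2_eq_2 numeral_3_eq_3)
    ultimately show "comb 2 p k l = comb 2 q k' l" by (simp add: comb_def sum_lessThan_2)
  qed
  have ps: "p i \<in> X" "p i \<in> S" if "i < 2" for i using p(2)[OF that] by auto
  have qs: "q i \<in> T" if "i < 2" for i using q(2)[OF that] by auto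
  have 1: "comb 2 p k \<in> X" "comb 2 p k \<in> S"
    by (rule comb_in_subspace[OF X(1) ps(1)], assumption) (rule comb_in_subspace[OF S(1) ps(2)])
  have 2: "comb 2 p k \<in> T"
    unfolding eq by (rule comb_in_subspace[OF S(2) qs])
  have "comb 2 p k \<noteq> 0"
  proof
    assume z: "comb 2 p k = 0"
    have "\<forall>i<2. k i = 0" using indep_seqD[OF p(1) z] by simp
    moreover have "\<forall>i<2. k' i = 0" using indep_seqD[OF q(1) z[unfolded eq]] by simp
    ultimately have z: "k 0 = 0" "k 1 = 0" "k 2 = 0" "k 3 = 0"
      by (auto simp: all_less_2 k'_def numeral_2_eq_2 numeral_3_eq_3)
    then have "\<forall>i<4. k i = 0" by (simp add: all_less_4)
    then show False using k(2) by auto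
  qed
  then show ?thesis using that 1 2 by blast
qed

text \<open>The last \<open>R\<close>-coordinate is a single linear form on the three-space, so its
  kernel has dimension at least two. This is why the condition of \<open>J_1\<close> on the fifth
  flag step always holds.\<close>

lemma dim_3space_inter_hyperplane:
  assumes g: "indep_seq 3 g" and R: "indep_seq 6 R"
    and gR: "\<And>i. i < 3 \<Longrightarrow> g i \<in> range (comb 6 R)"
  shows "2 \<le> cdim (range (comb 3 g) \<inter> range (comb 5 R))"
proof -
  have "\<forall>i. \<exists>c. i < 3 \<longrightarrow> g i = comb 6 R c" using gR by blast
  from choice[OF this] obtain k where k: "\<And>i. i < 3 \<Longrightarrow> g i = comb 6 R (k i)" by auto
  have mem: "comb 3 g c \<in> range (comb 5 R)"
    if "c 0 * k 0 5 + c 1 * k 1 5 + c 2 * k 2 5 = 0" for c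
  proof -
    have "comb 3 g c = comb 3 (\<lambda>r. comb 6 R (k r)) c" by (simp add: comb_def[of 3] k)
    also have "\<dots> = comb 6 R (\<lambda>i. \<Sum>r<3. c r * k r i)" by (rule comb_comb)
    also have "\<dots> = comb 5 R (\<lambda>i. \<Sum>r<3. c r * k r i)"
    proof
      fix l show "comb 6 R (\<lambda>i. \<Sum>r<3. c r * k r i) l = comb 5 R (\<lambda>i. \<Sum>r<3. c r * k r i) l"
        using that unfolding comb_def by (simp add: sum_lessThan_small)
    qed
    finally show ?thesis by simp
  qed
  \<comment> \<open>Two independent solutions of one linear equation in three unknowns, chosen
    according to the first nonzero coefficient.\<close>
  have "\<exists>c c' :: nat \<Rightarrow> complex. (c 0 * k 0 5 + c 1 * k 1 5 + c 2 * k 2 5 = 0) \<and> (c' 0 * k 0 5 + c' 1 * k 1 5 + c' 2 * k 2 5 = 0)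
      \<and> (\<forall>a b. (\<forall>i<3. a * c i + b * c' i = 0) \<longrightarrow> a = 0 \<and> b = (0::complex))"
  proof (cases "k 0 5 = 0")
    case False
    show ?thesis
      by (rule exI[of _ "\<lambda>i. if i = 0 then - k 1 5 else if i = 1 then k 0 5 else 0"],
          rule exI[of _ "\<lambda>i. if i = 0 then - k 2 5 else if i = 1 then 0 else k 0 5"])
         (use False in \<open>simp add: all_less_3\<close>)
  next
    case True
    show ?thesis
    proof (cases "k 1 5 = 0 \<and> k 2 5 = 0")
      case T: True
      show ?thesis
        by (rule exI[of _ "\<lambda>i. if i = 0 then 1 else 0"],
            rule exI[of _ "\<lambda>i. if i = 1 then 1 else 0"])
           (use T True in \<open>simp add: all_less_3\<close>)
    next
      case F: False
      show ?thesis
        by (rule exI[of _ "\<lambda>i. if i = 0 then 1 else 0"],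
            rule exI[of _ "\<lambda>i. if i = 0 then 0 else if i = 1 then - k 2 5 else k 1 5"])
           (use F True in \<open>auto simp: all_less_3\<close>)
    qed
  qed
  then obtain c c' :: "nat \<Rightarrow> complex" where c: "c 0 * k 0 5 + c 1 * k 1 5 + c 2 * k 2 5 = 0"
      "c' 0 * k 0 5 + c' 1 * k 1 5 + c' 2 * k 2 5 = 0"
      and ind: "\<forall>a b. (\<forall>i<3. a * c i + b * c' i = 0) \<longrightarrow> a = 0 \<and> b = (0::complex)"
    by blast
  define h where "h = (\<lambda>r::nat. comb 3 g (if r = 0 then c else c'))"
  have "indep_seq 2 h" unfolding indep_seq_def
  proof (intro allI impI)
    fix a i assume a: "comb 2 h a = 0" and i: "i < (2::nat)"
    have "comb 3 g (\<lambda>i. \<Sum>r<2. a r * (if r = 0 then c else c') i) = 0"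
      using a unfolding h_def comb_comb .
    moreover have "(\<lambda>i. \<Sum>r<2. a r * (if r = 0 then c else c') i) = (\<lambda>i. a 0 * c i + a 1 * c' i)"
      by (simp add: sum_lessThan_2)
    ultimately have "comb 3 g (\<lambda>i. a 0 * c i + a 1 * c' i) = 0" by (simp only:)
    then have "\<forall>i<3. a 0 * c i + a 1 * c' i = 0"
      using indep_seqD[OF g, of "\<lambda>i. a 0 * c i + a 1 * c' i"] by blast
    with ind have "a 0 = 0 \<and> a 1 = 0" by blast
    moreover have "i = 0 \<or> i = 1" using i by linarith
    ultimately show "a i = 0" by blast
  qed
  then show ?thesis
  proof (rule indep_seq_le_dim)
    show "range (comb 3 g) \<inter> range (comb 5 R) \<subseteq> cspan (g ` {..<3})"
      by (simp add: span_image_lessThan)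
    show "h i \<in> range (comb 3 g) \<inter> range (comb 5 R)" for i
      using mem[of c] mem[of c'] c by (simp add: h_def)
  qed simp
qed

subsection \<open>Polynomial functions and determinants\<close>

lemma polyfun_uminus: "polyfun V f \<Longrightarrow> polyfun V (\<lambda>x. - f x)"
  using pf_mult[OF pf_const[of V "- 1"], of f] by simp

lemma polyfun_diff: "polyfun V f \<Longrightarrow> polyfun V g \<Longrightarrow> polyfun V (\<lambda>x. f x - g x)"
  using pf_add[of V f "\<lambda>x. - g x"] polyfun_uminus[of V g] by simp

lemma polyfun_sum: "(\<And>i. i \<in> A \<Longrightarrow> polyfun V (f i)) \<Longrightarrow> polyfun V (\<lambda>x. \<Sum>i\<in>A. f i x)"
  by (induction A rule: infinite_finite_induct) (auto intro: pf_const pf_add)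

lemma polyfun_prod: "(\<And>i. i \<in> A \<Longrightarrow> polyfun V (f i)) \<Longrightarrow> polyfun V (\<lambda>x. \<Prod>i\<in>A. f i x)"
  by (induction A rule: infinite_finite_induct) (auto intro: pf_const pf_mult)

lemma polyfun_det:
  assumes "\<And>i j. i < n \<Longrightarrow> j < n \<Longrightarrow> polyfun V (\<lambda>x. A x i j)"
  shows "polyfun V (\<lambda>x. det (mat n n (\<lambda>(i, j). A x i j)))"
proof -
  have "det (mat n n (\<lambda>(i, j). A x i j)) =
      (\<Sum>p | p permutes {0..<n}. signof p * (\<Prod>i = 0..<n. A x i (p i)))" for x
  proof -
    have "(\<Prod>i = 0..<n. mat n n (\<lambda>(i, j). A x i j) $$ (i, p i)) = (\<Prod>i = 0..<n. A x i (p i))"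
      if "p permutes {0..<n}" for p
      by (rule prod.cong) (use permutes_in_image[OF that] in auto)
    then show ?thesis by (subst det_def'[of _ n]) (auto intro!: sum.cong)
  qed
  moreover have "polyfun V (\<lambda>x. \<Sum>p | p permutes {0..<n}. signof p * (\<Prod>i = 0..<n. A x i (p i)))"
    by (intro polyfun_sum pf_mult pf_const polyfun_prod assms) (use permutes_in_image in fastforce)+
  ultimately show ?thesis by simp
qed

lemma polyfun_on_line:
  fixes F :: "('v \<Rightarrow> 'a::comm_ring_1) \<Rightarrow> 'a"
  assumes "polyfun V F"
  shows "\<exists>P. \<forall>t. F (\<lambda>v. a v + t * b v) = poly P t"
  using assms
proof induction
  case (pf_const c)
  show ?case by (rule exI[of _ "[:c:]"]) simp
next
  case (pf_var v)
  show ?case by (rule exI[of _ "[:a v, b v:]"]) simp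
next
  case (pf_add f g)
  then obtain P Q where "\<forall>t. f (\<lambda>v. a v + t * b v) = poly P t" "\<forall>t. g (\<lambda>v. a v + t * b v) = poly Q t" by blast
  then show ?case by (intro exI[of _ "P + Q"]) simp
next
  case (pf_mult f g)
  then obtain P Q where "\<forall>t. f (\<lambda>v. a v + t * b v) = poly P t" "\<forall>t. g (\<lambda>v. a v + t * b v) = poly Q t" by blast
  then show ?case by (intro exI[of _ "P * Q"]) simp
qed

text \<open>On the line through \<open>x\<close> and \<open>y\<close> both functions become nonzero
  univariate polynomials, and their product has a nonroot. This plays the part of the polynomial
  ring being an integral domain.\<close>

lemma polyfun_common_nonzero:
  fixes F G :: "('v \<Rightarrow> 'a::{idom, ring_char_0}) \<Rightarrow> 'a"
  assumes "polyfun V F" "polyfun V G" "F x \<noteq> 0" "G y \<noteq> 0"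
  shows "\<exists>z. F z * G z \<noteq> 0"
proof -
  obtain P where P: "\<And>t. F (\<lambda>v. x v + t * (y v - x v)) = poly P t"
    using polyfun_on_line[OF assms(1), of x "\<lambda>v. y v - x v"] by blast
  obtain Q where Q: "\<And>t. G (\<lambda>v. x v + t * (y v - x v)) = poly Q t"
    using polyfun_on_line[OF assms(2), of x "\<lambda>v. y v - x v"] by blast
  have "poly P 0 \<noteq> 0" "poly Q 1 \<noteq> 0" using P[of 0] Q[of 1] assms(3,4) by simp_all
  then have "P * Q \<noteq> 0" by auto
  then obtain t where "poly (P * Q) t \<noteq> 0" using poly_all_0_iff_0 by blast
  then show ?thesis using P Q by (intro exI[of _ "\<lambda>v. x v + t * (y v - x v)"]) simp
qed

section \<open>Cramer's rule for six by six matrices\<close>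

definition mat6 :: "(nat \<Rightarrow> nat \<Rightarrow> complex) \<Rightarrow> complex mat" where
  "mat6 R = mat 6 6 (\<lambda>(i, j). R i j)"

definition det6 :: "(nat \<Rightarrow> nat \<Rightarrow> complex) \<Rightarrow> complex" where
  "det6 R = det (mat6 R)"

text \<open>The adjugate replaces the inverse because its entries are polynomials in those of
  \<open>R\<close>; the price is a factor \<open>det6 R\<close>.\<close>

definition adj6 :: "(nat \<Rightarrow> nat \<Rightarrow> complex) \<Rightarrow> nat \<Rightarrow> nat \<Rightarrow> complex" where
  "adj6 R i j = adj_mat (mat6 R) $$ (i, j)"

lemma mat6_carrier: "mat6 R \<in> carrier_mat 6 6" by (simp add: mat6_def)

lemma adj6_left:
  assumes "i < 6" "l < 6"
  shows "(\<Sum>k<6. adj6 R i k * R k l) = (if i = l then det6 R else 0)"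
proof -
  have "(adj_mat (mat6 R) * mat6 R) $$ (i, l) = (\<Sum>k<6. adj6 R i k * R k l)"
    using adj_mat(1)[OF mat6_carrier[of R]] assms
    by (simp add: scalar_prod_def adj6_def mat6_def atLeast0LessThan)
  then show ?thesis unfolding adj_mat(3)[OF mat6_carrier] using assms
    by (cases "i = l") (simp_all add: det6_def)
qed

lemma adj6_right:
  assumes "i < 6" "l < 6"
  shows "(\<Sum>k<6. R i k * adj6 R k l) = (if i = l then det6 R else 0)"
proof -
  have "(mat6 R * adj_mat (mat6 R)) $$ (i, l) = (\<Sum>k<6. R i k * adj6 R k l)"
    using adj_mat(1)[OF mat6_carrier[of R]] assms
    by (simp add: scalar_prod_def adj6_def mat6_def atLeast0LessThan)
  then show ?thesis unfolding adj_mat(2)[OF mat6_carrier] using assms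
    by (cases "i = l") (simp_all add: det6_def)
qed

text \<open>Cramer's rule without division: the inner sums are \<open>det6 R\<close> times the
  coordinates of \<open>c\<close> with respect to the rows of \<open>R\<close>.\<close>

lemma adj6_coords:
  assumes "l < 6"
  shows "(\<Sum>i<6. (\<Sum>j<6. c j * adj6 R j i) * R i l) = det6 R * c l"
proof -
  have "(\<Sum>i<6. (\<Sum>j<6. c j * adj6 R j i) * R i l) = (\<Sum>i<6. \<Sum>j<6. c j * (adj6 R j i * R i l))"
    by (simp add: sum_distrib_right mult.assoc)
  also have "\<dots> = (\<Sum>j<6. \<Sum>i<6. c j * (adj6 R j i * R i l))" by (rule sum.swap[of "\<lambda>i j. c j * (adj6 R j i * R i l)"])
  also have "\<dots> = (\<Sum>j<6. c j * (\<Sum>i<6. adj6 R j i * R i l))" by (simp only: sum_distrib_left)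
  also have "\<dots> = (\<Sum>j<6. if j = l then c j * det6 R else 0)"
    by (rule sum.cong) (use assms in \<open>simp_all add: adj6_left\<close>)
  also have "\<dots> = det6 R * c l" using assms by simp
  finally show ?thesis .
qed

text \<open>Only the first six entries of each vector are compared, which suits
  \<open>row_vec\<close>. Multiplying a relation by the adjugate isolates each coefficient.\<close>

lemma det6_nonzero_indep:
  assumes "det6 R \<noteq> 0" "\<And>i l. i < 6 \<Longrightarrow> l < 6 \<Longrightarrow> f i l = R i l"
  shows "indep_seq 6 f"
  unfolding indep_seq_def
proof (intro allI impI)
  fix k m assume z: "comb 6 f k = 0" and m: "m < (6::nat)"
  have e: "(\<Sum>i<6. k i * R i l) = 0" if "l < 6" for l
    using fun_cong[OF z, of l] assms(2) that by (simp add: comb_def)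
  have "k m * det6 R = (\<Sum>i<6. if i = m then k i * det6 R else 0)" using m by simp
  also have "\<dots> = (\<Sum>i<6. k i * (\<Sum>l<6. R i l * adj6 R l m))"
    by (rule sum.cong) (use m in \<open>simp_all add: adj6_right\<close>)
  also have "\<dots> = (\<Sum>i<6. \<Sum>l<6. k i * R i l * adj6 R l m)" by (simp add: sum_distrib_left mult.assoc)
  also have "\<dots> = (\<Sum>l<6. \<Sum>i<6. k i * R i l * adj6 R l m)" by (rule sum.swap[of "\<lambda>i l. k i * R i l * adj6 R l m"])
  also have "\<dots> = (\<Sum>l<6. (\<Sum>i<6. k i * R i l) * adj6 R l m)" by (simp add: sum_distrib_right)
  also have "\<dots> = 0" by (rule sum.neutral) (simp add: e)
  finally show "k m = 0" using assms(1) by simp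
qed

lemma polyfun_det6:
  assumes "\<And>i j. i < 6 \<Longrightarrow> j < 6 \<Longrightarrow> polyfun V (\<lambda>x. R x i j)"
  shows "polyfun V (\<lambda>x. det6 (R x))"
  unfolding det6_def mat6_def by (rule polyfun_det) (rule assms)

lemma polyfun_adj6:
  assumes "\<And>i j. i < 6 \<Longrightarrow> j < 6 \<Longrightarrow> polyfun V (\<lambda>x. R x i j)" "i < 6" "j < 6"
  shows "polyfun V (\<lambda>x. adj6 (R x) i j)"
proof -
  have "adj6 (R x) i j = (-1) ^ (j + i) *
      det (mat 5 5 (\<lambda>(k, l). R x (if k < j then k else Suc k) (if l < i then l else Suc l)))" for x
  proof -
    have "mat_delete (mat6 (R x)) j i =
        mat 5 5 (\<lambda>(k, l). R x (if k < j then k else Suc k) (if l < i then l else Suc l))"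
      by (rule eq_matI) (use assms(2,3) in \<open>auto simp: mat_delete_def mat6_def\<close>)
    then show ?thesis using assms(2,3) by (simp add: adj6_def adj_mat_def mat6_carrier[THEN carrier_matD(1)]
        mat6_carrier[THEN carrier_matD(2)] cofactor_def)
  qed
  then show ?thesis
    by (simp only:) (intro pf_mult pf_const polyfun_det assms(1); simp)
qed

lemma det6_id: "det6 (\<lambda>i j. if i = j then 1 else 0) = 1"
proof -
  have "mat6 (\<lambda>i j. if i = j then 1 else 0) = 1\<^sub>m 6" by (auto simp: mat6_def)
  then show ?thesis by (simp add: det6_def)
qed

lemma adj6_id:
  assumes "i < 6" "j < 6"
  shows "adj6 (\<lambda>i j. if i = j then 1 else 0) i j = (if i = j then 1 else 0)"
proof -
  have "adj6 (\<lambda>i j. if i = j then 1 else 0) i j = (\<Sum>k<6. (if k = j then adj6 (\<lambda>i j. if i = j then 1 else 0) i k else 0))"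
    using assms by simp
  also have "\<dots> = (\<Sum>k<6. adj6 (\<lambda>i j. if i = j then 1 else 0) i k * (if k = j then 1 else 0))"
    by (rule sum.cong) auto
  also have "\<dots> = (if i = j then 1 else 0)" 
    using adj6_left[OF assms, of "\<lambda>i j. if i = j then 1 else 0"] by (simp only: det6_id)
  finally show ?thesis .
qed

subsection \<open>Planes in coordinates adapted to two flags\<close>

text \<open>Rows are listed one after another. The explicit formula makes sense over every
  commutative ring, so the same expression serves for numbers and for polynomials.\<close>

definition det3 :: "'a::comm_ring_1 \<Rightarrow> 'a \<Rightarrow> 'a \<Rightarrow> 'a \<Rightarrow> 'a \<Rightarrow> 'a \<Rightarrow> 'a \<Rightarrow> 'a \<Rightarrow> 'a \<Rightarrow> 'a" where
  "det3 a0 b0 c0 a1 b1 c1 a2 b2 c2 =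
     a0 * (b1 * c2 - b2 * c1) - b0 * (a1 * c2 - a2 * c1) + c0 * (a1 * b2 - a2 * b1)"

text \<open>A row vector killing all columns is the cross product of two independent columns. If
  there are none, the matrix has rank at most one, and it suffices to kill one nonzero
  column.\<close>

lemma det3_eq_0_iff:
  fixes a0 :: "'a::field"
  shows "det3 a0 b0 c0 a1 b1 c1 a2 b2 c2 = 0 \<longleftrightarrow>
    (\<exists>h0 h1 h2. (h0 \<noteq> 0 \<or> h1 \<noteq> 0 \<or> h2 \<noteq> 0) \<and> h0 * a0 + h1 * a1 + h2 * a2 = 0 \<and>
       h0 * b0 + h1 * b1 + h2 * b2 = 0 \<and> h0 * c0 + h1 * c1 + h2 * c2 = 0)" (is "?d = 0 \<longleftrightarrow> ?R")
proof
  assume ?R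
  then obtain h0 h1 h2 where h: "h0 \<noteq> 0 \<or> h1 \<noteq> 0 \<or> h2 \<noteq> 0"
    and e: "h0 * a0 + h1 * a1 + h2 * a2 = 0" "h0 * b0 + h1 * b1 + h2 * b2 = 0" "h0 * c0 + h1 * c1 + h2 * c2 = 0"
    by blast
  have "h0 * ?d = 0" "h1 * ?d = 0" "h2 * ?d = 0"
    unfolding det3_def using e by Groebner_Basis.algebra+
  then show "?d = 0" using h by auto
next
  assume d: "?d = 0"
  \<comment> \<open>The columns x, y, z are some ordering of a, b, c, and the witness is the cross
    product of x and y; its product with z is the determinant.\<close>
  have cross: ?R if "x1 * y2 - x2 * y1 \<noteq> 0 \<or> x2 * y0 - x0 * y2 \<noteq> 0 \<or> x0 * y1 - x1 * y0 \<noteq> 0"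
    "\<And>h0 h1 h2. h0 * x0 + h1 * x1 + h2 * x2 = 0 \<Longrightarrow> h0 * y0 + h1 * y1 + h2 * y2 = 0 \<Longrightarrow>
       h0 * z0 + h1 * z1 + h2 * z2 = 0 \<Longrightarrow> h0 * a0 + h1 * a1 + h2 * a2 = 0 \<and>
       h0 * b0 + h1 * b1 + h2 * b2 = 0 \<and> h0 * c0 + h1 * c1 + h2 * c2 = 0"
    "det3 x0 y0 z0 x1 y1 z1 x2 y2 z2 = 0" for x0 x1 x2 y0 y1 y2 z0 z1 z2
  proof (intro exI conjI)
    show "x1 * y2 - x2 * y1 \<noteq> 0 \<or> x2 * y0 - x0 * y2 \<noteq> 0 \<or> x0 * y1 - x1 * y0 \<noteq> 0" by (rule that(1))
    have "(x1 * y2 - x2 * y1) * x0 + (x2 * y0 - x0 * y2) * x1 + (x0 * y1 - x1 * y0) * x2 = 0"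
      "(x1 * y2 - x2 * y1) * y0 + (x2 * y0 - x0 * y2) * y1 + (x0 * y1 - x1 * y0) * y2 = 0"
      by (simp_all add: algebra_simps)
    moreover have "(x1 * y2 - x2 * y1) * z0 + (x2 * y0 - x0 * y2) * z1 + (x0 * y1 - x1 * y0) * z2 = 0"
      using that(3) by (simp add: det3_def algebra_simps)
    ultimately show "(x1 * y2 - x2 * y1) * a0 + (x2 * y0 - x0 * y2) * a1 + (x0 * y1 - x1 * y0) * a2 = 0"
      "(x1 * y2 - x2 * y1) * b0 + (x2 * y0 - x0 * y2) * b1 + (x0 * y1 - x1 * y0) * b2 = 0"
      "(x1 * y2 - x2 * y1) * c0 + (x2 * y0 - x0 * y2) * c1 + (x0 * y1 - x1 * y0) * c2 = 0"
      using that(2) by blast+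
  qed
  have ac: "det3 a0 c0 b0 a1 c1 b1 a2 c2 b2 = 0" and bc: "det3 b0 c0 a0 b1 c1 a1 b2 c2 a2 = 0"
    using d by (simp_all add: det3_def algebra_simps)
  consider (ab) "a1 * b2 - a2 * b1 \<noteq> 0 \<or> a2 * b0 - a0 * b2 \<noteq> 0 \<or> a0 * b1 - a1 * b0 \<noteq> 0"
    | (ac) "a1 * c2 - a2 * c1 \<noteq> 0 \<or> a2 * c0 - a0 * c2 \<noteq> 0 \<or> a0 * c1 - a1 * c0 \<noteq> 0"
    | (bc) "b1 * c2 - b2 * c1 \<noteq> 0 \<or> b2 * c0 - b0 * c2 \<noteq> 0 \<or> b0 * c1 - b1 * c0 \<noteq> 0"
    | (rank1) "a1 * b2 = a2 * b1" "a2 * b0 = a0 * b2" "a0 * b1 = a1 * b0"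
       "a1 * c2 = a2 * c1" "a2 * c0 = a0 * c2" "a0 * c1 = a1 * c0"
       "b1 * c2 = b2 * c1" "b2 * c0 = b0 * c2" "b0 * c1 = b1 * c0"
    by auto
  then show ?R
  proof cases
    case ab then show ?thesis by (rule cross[OF _ _ d]) simp
  next
    case ac then show ?thesis by (rule cross[OF _ _ \<open>det3 a0 c0 b0 a1 c1 b1 a2 c2 b2 = 0\<close>]) simp
  next
    case bc then show ?thesis by (rule cross[OF _ _ \<open>det3 b0 c0 a0 b1 c1 a1 b2 c2 a2 = 0\<close>]) simp
  next
    case rank1
    \<comment> \<open>A vector orthogonal to x is orthogonal to everything parallel to x.\<close>
    have line: "\<exists>h0 h1 h2. (h0 \<noteq> 0 \<or> h1 \<noteq> 0 \<or> h2 \<noteq> 0) \<and> h0 * x0 + h1 * x1 + h2 * x2 = 0 \<and>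
        (\<forall>y0 y1 y2. x1 * y2 = x2 * y1 \<longrightarrow> x2 * y0 = x0 * y2 \<longrightarrow> x0 * y1 = x1 * y0 \<longrightarrow> h0 * y0 + h1 * y1 + h2 * y2 = 0)"
      if "x0 \<noteq> 0 \<or> x1 \<noteq> 0 \<or> x2 \<noteq> 0" for x0 x1 x2 :: 'a
    proof (cases "x0 = 0 \<and> x1 = 0")
      case True
      then show ?thesis using that by (intro exI[of _ 1] exI[of _ 0]) auto
    next
      case False
      show ?thesis
        by (rule exI[of _ "x1"], rule exI[of _ "- x0"], rule exI[of _ "0"])
           (use False in \<open>auto simp: algebra_simps\<close>)
    qed
    consider "a0 \<noteq> 0 \<or> a1 \<noteq> 0 \<or> a2 \<noteq> 0" | "b0 \<noteq> 0 \<or> b1 \<noteq> 0 \<or> b2 \<noteq> 0"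
      | "a0 = 0" "a1 = 0" "a2 = 0" "b0 = 0" "b1 = 0" "b2 = 0" "c0 \<noteq> 0 \<or> c1 \<noteq> 0 \<or> c2 \<noteq> 0"
      | "a0 = 0" "a1 = 0" "a2 = 0" "b0 = 0" "b1 = 0" "b2 = 0" "c0 = 0" "c1 = 0" "c2 = 0" by blast
    then show ?thesis
    proof cases
      case 1 from line[OF this] show ?thesis using rank1(1-6) by blast
    next
      case 2 from line[OF this] show ?thesis using rank1(1-3,7-9) by (metis mult.commute)
    next
      case 3 from line[OF 3(7)] show ?thesis unfolding 3(1-6) by auto
    next
      case 4 show ?thesis unfolding 4 by (intro exI[of _ 1]) simp
    qed
  qed
qed

text \<open>The rows of \<open>g\<close> are three vectors in adapted coordinates. The columns
  evaluate on them the three linear forms that cut out the plane of u, v, w, so a vanishing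
  determinant means that a nontrivial combination of the rows lies in that plane.\<close>

definition tri :: "(nat \<Rightarrow> nat \<Rightarrow> 'a::comm_ring_1) \<Rightarrow> 'a \<Rightarrow> 'a \<Rightarrow> 'a \<Rightarrow> 'a \<Rightarrow> 'a \<Rightarrow> 'a \<Rightarrow> 'a" where
  "tri g u0 u1 v0 v1 w0 w1 = det3
     (g 0 0 * u1 - g 0 1 * u0) (g 0 2 * v1 - g 0 3 * v0) (g 0 4 * w1 - g 0 5 * w0)
     (g 1 0 * u1 - g 1 1 * u0) (g 1 2 * v1 - g 1 3 * v0) (g 1 4 * w1 - g 1 5 * w0)
     (g 2 0 * u1 - g 2 1 * u0) (g 2 2 * v1 - g 2 3 * v0) (g 2 4 * w1 - g 2 5 * w0)"

text \<open>Each pair stands for a point of a projective line. Equations instead of generators make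
  invariance under rescaling and membership tests immediate.\<close>

definition plane :: "(nat \<Rightarrow> nat \<Rightarrow> complex) \<Rightarrow> complex \<Rightarrow> complex \<Rightarrow> complex \<Rightarrow> complex \<Rightarrow> complex \<Rightarrow> complex
    \<Rightarrow> (nat \<Rightarrow> complex) set" where
  "plane E u0 u1 v0 v1 w0 w1 =
     {comb 6 E k | k. k 0 * u1 = k 1 * u0 \<and> k 2 * v1 = k 3 * v0 \<and> k 4 * w1 = k 5 * w0}"

definition gens :: "complex \<Rightarrow> complex \<Rightarrow> complex \<Rightarrow> complex \<Rightarrow> complex \<Rightarrow> complex \<Rightarrow> nat \<Rightarrow> nat \<Rightarrow> complex" where
  "gens u0 u1 v0 v1 w0 w1 r i =
     (if r = 0 then if i = 0 then u0 else if i = 1 then u1 else 0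
      else if r = 1 then if i = 2 then v0 else if i = 3 then v1 else 0
      else if i = 4 then w0 else if i = 5 then w1 else 0)"

lemma sum_gens:
  fixes c :: "nat \<Rightarrow> complex"
  shows "(\<Sum>r<3. c r * gens u0 u1 v0 v1 w0 w1 r 0) = c 0 * u0"
    "(\<Sum>r<3. c r * gens u0 u1 v0 v1 w0 w1 r 1) = c 0 * u1"
    "(\<Sum>r<3. c r * gens u0 u1 v0 v1 w0 w1 r 2) = c 1 * v0"
    "(\<Sum>r<3. c r * gens u0 u1 v0 v1 w0 w1 r 3) = c 1 * v1"
    "(\<Sum>r<3. c r * gens u0 u1 v0 v1 w0 w1 r 4) = c 2 * w0"
    "(\<Sum>r<3. c r * gens u0 u1 v0 v1 w0 w1 r 5) = c 2 * w1"
  by (simp_all add: gens_def sum_lessThan_3)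

lemma comb6_cong:
  assumes "k 0 = k' 0" "k 1 = k' 1" "k 2 = k' 2" "k 3 = k' 3" "k 4 = k' 4" "k 5 = k' 5"
  shows "comb 6 E k = comb 6 E k'"
  unfolding comb_def sum_lessThan_6 assms ..

lemma proportional_iff:
  fixes u0 u1 a b :: "'a::field"
  assumes "u0 \<noteq> 0 \<or> u1 \<noteq> 0"
  shows "a * u1 = b * u0 \<longleftrightarrow> (\<exists>c. a = c * u0 \<and> b = c * u1)"
proof
  assume e: "a * u1 = b * u0"
  show "\<exists>c. a = c * u0 \<and> b = c * u1"
  proof (cases "u0 = 0")
    case True then show ?thesis using assms e by (intro exI[of _ "b / u1"]) auto
  next
    case False then show ?thesis using e by (intro exI[of _ "a / u0"]) (auto simp: field_simps)
  qed
qed auto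

context
  fixes E :: "nat \<Rightarrow> nat \<Rightarrow> complex" and u0 u1 v0 v1 w0 w1 :: complex
  assumes E: "indep_seq 6 E"
    and uvw: "u0 \<noteq> 0 \<or> u1 \<noteq> 0" "v0 \<noteq> 0 \<or> v1 \<noteq> 0" "w0 \<noteq> 0 \<or> w1 \<noteq> 0"
begin

lemma indep_seq_gens: "indep_seq 3 (\<lambda>r. comb 6 E (gens u0 u1 v0 v1 w0 w1 r))"
  unfolding indep_seq_def comb_comb
proof (intro allI impI)
  fix c i assume "comb 6 E (\<lambda>i. \<Sum>r<3. c r * gens u0 u1 v0 v1 w0 w1 r i) = 0" and i: "i < (3::nat)"
  note z = indep_seqD[OF E this(1)]
  have "c 0 * u0 = 0" "c 0 * u1 = 0" "c 1 * v0 = 0" "c 1 * v1 = 0" "c 2 * w0 = 0" "c 2 * w1 = 0"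
    using z[of 0] z[of 1] z[of 2] z[of 3] z[of 4] z[of 5] unfolding sum_gens by simp_all
  then have "c 0 = 0" "c 1 = 0" "c 2 = 0" using uvw by auto
  then have "\<forall>i<3. c i = 0" unfolding all_less_3 by blast
  then show "c i = 0" using i by blast
qed

lemma plane_eq_range: "plane E u0 u1 v0 v1 w0 w1 = range (comb 3 (\<lambda>r. comb 6 E (gens u0 u1 v0 v1 w0 w1 r)))"
proof (intro equalityI subsetI)
  fix x assume "x \<in> plane E u0 u1 v0 v1 w0 w1"
  then obtain k where x: "x = comb 6 E k" and "k 0 * u1 = k 1 * u0" "k 2 * v1 = k 3 * v0" "k 4 * w1 = k 5 * w0"
    unfolding plane_def by blast
  then obtain a b c where abc: "k 0 = a * u0" "k 1 = a * u1" "k 2 = b * v0" "k 3 = b * v1"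
      "k 4 = c * w0" "k 5 = c * w1"
    unfolding proportional_iff[OF uvw(1)] proportional_iff[OF uvw(2)] proportional_iff[OF uvw(3)] by blast
  define d where "d = (\<lambda>r::nat. if r = 0 then a else if r = 1 then b else c)"
  have "x = comb 6 E (\<lambda>i. \<Sum>r<3. d r * gens u0 u1 v0 v1 w0 w1 r i)"
    unfolding x by (rule comb6_cong; unfold sum_gens abc; simp add: d_def)
  then have "x = comb 3 (\<lambda>r. comb 6 E (gens u0 u1 v0 v1 w0 w1 r)) d" unfolding comb_comb .
  then show "x \<in> range (comb 3 (\<lambda>r. comb 6 E (gens u0 u1 v0 v1 w0 w1 r)))" by simp
next
  fix x assume "x \<in> range (comb 3 (\<lambda>r. comb 6 E (gens u0 u1 v0 v1 w0 w1 r)))"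
  then obtain d where "x = comb 6 E (\<lambda>i. \<Sum>r<3. d r * gens u0 u1 v0 v1 w0 w1 r i)"
    unfolding comb_comb by (rule rangeE)
  moreover have "d 0 * u0 * u1 = d 0 * u1 * u0" "d 1 * v0 * v1 = d 1 * v1 * v0" "d 2 * w0 * w1 = d 2 * w1 * w0"
    by simp_all
  ultimately show "x \<in> plane E u0 u1 v0 v1 w0 w1" unfolding plane_def mem_Collect_eq
    by (intro exI[of _ "\<lambda>i. \<Sum>r<3. d r * gens u0 u1 v0 v1 w0 w1 r i"]) (unfold sum_gens, blast)
qed

end

lemma comb_in_plane_iff:
  assumes "indep_seq 6 E"
  shows "comb 6 E k \<in> plane E u0 u1 v0 v1 w0 w1 \<longleftrightarrow>
    k 0 * u1 = k 1 * u0 \<and> k 2 * v1 = k 3 * v0 \<and> k 4 * w1 = k 5 * w0"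
proof
  assume "comb 6 E k \<in> plane E u0 u1 v0 v1 w0 w1"
  then obtain k' where e: "comb 6 E k = comb 6 E k'"
    and "k' 0 * u1 = k' 1 * u0 \<and> k' 2 * v1 = k' 3 * v0 \<and> k' 4 * w1 = k' 5 * w0" unfolding plane_def by blast
  moreover have "k 0 = k' 0" "k 1 = k' 1" "k 2 = k' 2" "k 3 = k' 3" "k 4 = k' 4" "k 5 = k' 5"
    by (rule comb_unique[OF assms e]; simp)+
  ultimately show "k 0 * u1 = k 1 * u0 \<and> k 2 * v1 = k 3 * v0 \<and> k 4 * w1 = k 5 * w0" by simp
qed (unfold plane_def, blast)

text \<open>The parametrization by three projective lines is injective: the single vector u + v + w
  of the plane tests all three factors at once.\<close>

lemma plane_eqD:
  assumes "indep_seq 6 E" "plane E u0 u1 v0 v1 w0 w1 = plane E u0' u1' v0' v1' w0' w1'"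
  shows "u0 * u1' = u1 * u0'" "v0 * v1' = v1 * v0'" "w0 * w1' = w1 * w0'"
proof -
  define k where "k = (\<lambda>i::nat. if i = 0 then u0 else if i = 1 then u1 else if i = 2 then v0 else
     if i = 3 then v1 else if i = 4 then w0 else w1)"
  have k: "k 0 = u0" "k 1 = u1" "k 2 = v0" "k 3 = v1" "k 4 = w0" "k 5 = w1" by (simp_all add: k_def)
  have "comb 6 E k \<in> plane E u0 u1 v0 v1 w0 w1"
    unfolding comb_in_plane_iff[OF assms(1)] k by (simp add: mult.commute)
  then show "u0 * u1' = u1 * u0'" "v0 * v1' = v1 * v0'" "w0 * w1' = w1 * w0'"
    unfolding assms(2) comb_in_plane_iff[OF assms(1)] k by blast+
qed

lemma plane_cong_proportional:
  assumes "u0 \<noteq> 0 \<or> u1 \<noteq> 0" "u0' \<noteq> 0 \<or> u1' \<noteq> 0" "u0 * u1' = u1 * u0'"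
    "v0 \<noteq> 0 \<or> v1 \<noteq> 0" "v0' \<noteq> 0 \<or> v1' \<noteq> 0" "v0 * v1' = v1 * v0'"
    "w0 \<noteq> 0 \<or> w1 \<noteq> 0" "w0' \<noteq> 0 \<or> w1' \<noteq> 0" "w0 * w1' = w1 * w0'"
  shows "plane E u0 u1 v0 v1 w0 w1 = plane E u0' u1' v0' v1' w0' w1'"
proof -
  have *: "a * u1 = b * u0 \<longleftrightarrow> a * u1' = b * u0'"
    if asm: "u0 \<noteq> 0 \<or> u1 \<noteq> 0" "u0' \<noteq> 0 \<or> u1' \<noteq> 0" "u0 * u1' = u1 * u0'" for a b u0 u1 u0' u1' :: complex
  proof -
    obtain c where c: "u0 = c * u0'" "u1 = c * u1'" using asm(3) unfolding proportional_iff[OF asm(2)] by blast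
    then have "c \<noteq> 0" using asm(1) by auto
    then show ?thesis unfolding c by (simp add: mult.left_commute)
  qed
  show ?thesis unfolding plane_def using *[OF assms(1-3)] *[OF assms(4-6)] *[OF assms(7-9)] by simp
qed

lemma real_point_plane:
  assumes "\<And>i l. i < 6 \<Longrightarrow> E i l \<in> \<real>"
    "u0 \<in> \<real>" "u1 \<in> \<real>" "v0 \<in> \<real>" "v1 \<in> \<real>" "w0 \<in> \<real>" "w1 \<in> \<real>"
  shows "real_point (plane E u0 u1 v0 v1 w0 w1)"
  unfolding real_point_def
proof
  fix x assume "x \<in> plane E u0 u1 v0 v1 w0 w1"
  then obtain k where x: "x = comb 6 E k"
    and k: "k 0 * u1 = k 1 * u0" "k 2 * v1 = k 3 * v0" "k 4 * w1 = k 5 * w0" unfolding plane_def by blast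
  have "(\<lambda>i. cnj (x i)) = comb 6 E (\<lambda>i. cnj (k i))"
    unfolding x comb_def by (simp add: cnj_sum Reals_cnj_iff[THEN iffD1, OF assms(1)])
  moreover have "cnj (k 0) * u1 = cnj (k 1) * u0" "cnj (k 2) * v1 = cnj (k 3) * v0" "cnj (k 4) * w1 = cnj (k 5) * w0"
    using k[THEN arg_cong[where f = cnj]] assms(2-) by (simp_all add: Reals_cnj_iff)
  ultimately show "(\<lambda>i. cnj (x i)) \<in> plane E u0 u1 v0 v1 w0 w1"
    unfolding plane_def mem_Collect_eq by (intro exI[of _ "\<lambda>i. cnj (k i)"]) blast
qed

lemma Omega_135_iff: "X \<in> Omega 6 3 [1,3,5] K \<longleftrightarrow>
    X \<in> Grass 3 6 \<and> 3 \<le> cdim (X \<inter> K 6) \<and> 2 \<le> cdim (X \<inter> K 4) \<and> 1 \<le> cdim (X \<inter> K 2)"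
proof -
  have "{1..3::nat} = {1, 2, 3}" by auto
  then show ?thesis by (simp add: Omega_def)
qed

lemma Omega_pieri_iff: "X \<in> Omega 6 3 (pieri 3 1) K \<longleftrightarrow>
    X \<in> Grass 3 6 \<and> 3 \<le> cdim (X \<inter> K 6) \<and> 2 \<le> cdim (X \<inter> K 5) \<and> 1 \<le> cdim (X \<inter> K 3)"
proof -
  have "{1..3::nat} = {1, 2, 3}" by auto
  moreover have "pieri 3 1 = [1, 2, 4]" by (simp add: pieri_def upt_rec)
  ultimately show ?thesis by (simp add: Omega_def)
qed

abbreviation schubert_data :: "nat list list" where
  "schubert_data \<equiv> [[1,3,5], [1,3,5], pieri 3 1, pieri 3 1, pieri 3 1]"

lemma schubert_inter_iff: "X \<in> schubert_inter 3 3 schubert_data K \<longleftrightarrow>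
    X \<in> Grass 3 6 \<and> X \<in> Omega 6 3 [1,3,5] (K 0) \<and> X \<in> Omega 6 3 [1,3,5] (K 1) \<and>
    X \<in> Omega 6 3 (pieri 3 1) (K 2) \<and> X \<in> Omega 6 3 (pieri 3 1) (K 3) \<and> X \<in> Omega 6 3 (pieri 3 1) (K 4)"
proof -
  have "j < 5 \<longleftrightarrow> j = 0 \<or> j = 1 \<or> j = 2 \<or> j = 3 \<or> j = 4" for j :: nat by linarith
  then show ?thesis unfolding schubert_inter_def by (auto simp: numeral_eq_Suc)
qed

text \<open>The two flags of type (1,3,5) split the space as
  \<open>\<langle>E 0, E 1\<rangle> \<oplus> \<langle>E 2, E 3\<rangle> \<oplus> \<langle>E 4, E 5\<rangle>\<close>, and \<open>\<gamma> j\<close> holds the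
  coordinates of a basis of the third step of the \<open>j\<close>-th flag.\<close>

locale adapted_basis =
  fixes E :: "nat \<Rightarrow> nat \<Rightarrow> complex" and M :: "nat \<Rightarrow> nat \<Rightarrow> nat \<Rightarrow> complex"
    and \<gamma> :: "nat \<Rightarrow> nat \<Rightarrow> nat \<Rightarrow> complex"
  assumes E_indep: "indep_seq 6 E"
    and E_Cn: "\<And>i. i < 6 \<Longrightarrow> E i \<in> Cn 6"
    and M_indep: "\<And>j. j < 5 \<Longrightarrow> indep_seq 6 (row_vec 6 (M j))"
    and E_0_2: "\<And>i. i < 2 \<Longrightarrow> E i \<in> row_flag 6 (M 0) 2"
    and E_0_4: "\<And>i. i < 4 \<Longrightarrow> E i \<in> row_flag 6 (M 0) 4"
    and E_1_2: "\<And>i. i < 2 \<Longrightarrow> E (i + 4) \<in> row_flag 6 (M 1) 2"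
    and E_1_4: "\<And>i. i < 4 \<Longrightarrow> E (i + 2) \<in> row_flag 6 (M 1) 4"
    and K3: "\<And>j. j \<in> {2, 3, 4} \<Longrightarrow> row_flag 6 (M j) 3 = range (comb 3 (\<lambda>r. comb 6 E (\<gamma> j r)))"
begin

lemma shifted_indep: "n + m \<le> 6 \<Longrightarrow> indep_seq n (\<lambda>i. E (i + m))"
  by (rule indep_seq_reindex[OF E_indep]) auto

text \<open>Containment of the vectors of \<open>E\<close> suffices, since they are independent and
  as many as the rows.\<close>

lemma flag_0_2: "row_flag 6 (M 0) 2 = range (comb 2 E)"
  unfolding row_flag_eq
  by (rule range_comb_eq) (use shifted_indep[of 2 0] E_0_2 in \<open>simp_all add: row_flag_eq\<close>)

lemma flag_0_4: "row_flag 6 (M 0) 4 = range (comb 4 E)"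
  unfolding row_flag_eq
  by (rule range_comb_eq) (use shifted_indep[of 4 0] E_0_4 in \<open>simp_all add: row_flag_eq\<close>)

lemma flag_1_2: "row_flag 6 (M 1) 2 = range (comb 2 (\<lambda>i. E (i + 4)))"
  unfolding row_flag_eq
  by (rule range_comb_eq) (use shifted_indep[of 2 4] E_1_2 in \<open>simp_all add: row_flag_eq\<close>)

lemma flag_1_4: "row_flag 6 (M 1) 4 = range (comb 4 (\<lambda>i. E (i + 2)))"
  unfolding row_flag_eq
  by (rule range_comb_eq) (use shifted_indep[of 4 2] E_1_4 in \<open>simp_all add: row_flag_eq\<close>)

lemma comb_subflags:
  "comb 2 E k = comb 6 E (\<lambda>i. if i < 2 then k i else 0)"
  "comb 4 E k = comb 6 E (\<lambda>i. if i < 4 then k i else 0)"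
  "comb 2 (\<lambda>i. E (i + 4)) k = comb 6 E (\<lambda>i. if i < 4 then 0 else k (i - 4))"
  "comb 4 (\<lambda>i. E (i + 2)) k = comb 6 E (\<lambda>i. if i < 2 then 0 else k (i - 2))"
  by (simp_all add: comb_def sum_lessThan_small del: add_2_eq_Suc')

lemma flag_full: "j < 5 \<Longrightarrow> row_flag 6 (M j) 6 = Cn 6"
  unfolding row_flag_eq by (rule Cn_eq_range_comb[symmetric]) (simp_all add: M_indep row_vec_in_Cn)

lemma K3_indep:
  assumes "j \<in> {2, 3, 4}"
  shows "indep_seq 3 (\<lambda>r. comb 6 E (\<gamma> j r))"
proof (rule spanning_imp_indep_seq)
  show "indep_seq 3 (row_vec 6 (M j))" by (rule indep_seq_mono[OF M_indep]) (use assms in auto)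
  show "range (comb 3 (\<lambda>r. comb 6 E (\<gamma> j r))) = range (comb 3 (row_vec 6 (M j)))"
    using K3[OF assms] by (simp add: row_flag_eq)
qed

text \<open>For the first flag u and the pair u, v witness the two dimensions, for the second flag w
  and the pair v, w. For the other flags a kernel vector of the matrix behind \<open>tri\<close>
  supplies the common vector.\<close>

lemma plane_in_schubert_inter:
  assumes uvw: "u0 \<noteq> 0 \<or> u1 \<noteq> 0" "v0 \<noteq> 0 \<or> v1 \<noteq> 0" "w0 \<noteq> 0 \<or> w1 \<noteq> 0"
    and tri: "\<And>j. j \<in> {2, 3, 4} \<Longrightarrow> tri (\<gamma> j) u0 u1 v0 v1 w0 w1 = 0"
  shows "plane E u0 u1 v0 v1 w0 w1 \<in> schubert_inter 3 3 schubert_data (\<lambda>j. row_flag 6 (M j))"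
proof -
  define X where "X = plane E u0 u1 v0 v1 w0 w1"
  define g where "g = (\<lambda>r. comb 6 E (gens u0 u1 v0 v1 w0 w1 r))"
  have g: "indep_seq 3 g" unfolding g_def by (rule indep_seq_gens[OF E_indep uvw])
  have X: "X = range (comb 3 g)" unfolding X_def g_def by (rule plane_eq_range[OF E_indep uvw])
  have XW: "X \<inter> S \<subseteq> cspan (g ` {..<3})" for S unfolding X span_image_lessThan by blast
  have fin: "finite (g ` {..<3::nat})" by simp
  have gC: "g r \<in> Cn 6" for r unfolding g_def by (rule comb_in_Cn[OF E_Cn])
  have gX: "g r \<in> X" if "r < 3" for r unfolding X using comb_single[OF that, of g] by (metis rangeI)
  have XC: "X \<subseteq> Cn 6" unfolding X using comb_in_Cn[of 3 g 6] gC by blast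
  have Grass: "X \<in> Grass 3 6" unfolding Grass_def mem_Collect_eq
    using subspace_range_comb[of 3 g] dim_range_comb[OF g] XC unfolding X[symmetric] by blast
  have full: "3 \<le> cdim (X \<inter> row_flag 6 (M j) 6)" if "j < 5" for j
    by (rule indep_seq_le_dim[OF g _ XW fin]) (use gX gC flag_full[OF that] in auto)
  have hyp: "2 \<le> cdim (X \<inter> row_flag 6 (M j) 5)" if "j < 5" for j
    unfolding X row_flag_eq
  proof (rule dim_3space_inter_hyperplane[OF g M_indep[OF that]])
    fix i show "g i \<in> range (comb 6 (row_vec 6 (M j)))"
      using gC flag_full[OF that] by (simp add: row_flag_eq)
  qed
  \<comment> \<open>Each generator is rewritten in the coordinates of the flag steps that must
    contain it; the middle one belongs to both four-dimensional steps.\<close>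
  have gs: "g 0 = comb 2 E (\<lambda>i. if i = 0 then u0 else u1)"
    "g 0 = comb 4 E (\<lambda>i. if i = 0 then u0 else if i = 1 then u1 else 0)"
    "g 1 = comb 4 E (\<lambda>i. if i = 2 then v0 else if i = 3 then v1 else 0)"
    "g 1 = comb 4 (\<lambda>i. E (i + 2)) (\<lambda>i. if i = 0 then v0 else if i = 1 then v1 else 0)"
    "g 2 = comb 4 (\<lambda>i. E (i + 2)) (\<lambda>i. if i = 2 then w0 else if i = 3 then w1 else 0)"
    "g 2 = comb 2 (\<lambda>i. E (i + 4)) (\<lambda>i. if i = 0 then w0 else w1)"
    unfolding g_def comb_subflags by (rule comb6_cong; simp add: gens_def)+
  have m02: "g 0 \<in> row_flag 6 (M 0) 2" unfolding flag_0_2 gs(1) by (rule rangeI)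
  have m04: "g 0 \<in> row_flag 6 (M 0) 4" "g 1 \<in> row_flag 6 (M 0) 4"
    unfolding flag_0_4 gs(2,3) by (rule rangeI)+
  have m12: "g 2 \<in> row_flag 6 (M 1) 2" unfolding flag_1_2 gs(6) by (rule rangeI)
  have m14: "g 1 \<in> row_flag 6 (M 1) 4" "g 2 \<in> row_flag 6 (M 1) 4"
    unfolding flag_1_4 gs(4,5) by (rule rangeI)+
  have less2: "i = 0 \<or> i = 1" if "i < 2" for i :: nat using that by linarith
  have "indep_seq 1 (\<lambda>i. g (i + 0))" by (rule indep_seq_reindex[OF g]) (auto simp: inj_on_def)
  then have d02: "1 \<le> cdim (X \<inter> row_flag 6 (M 0) 2)"
    by (rule indep_seq_le_dim[OF _ _ XW fin]) (use gX m02 in simp)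
  have "indep_seq 2 (\<lambda>i. g (i + 0))" by (rule indep_seq_reindex[OF g]) (auto simp: inj_on_def)
  then have d04: "2 \<le> cdim (X \<inter> row_flag 6 (M 0) 4)"
    by (rule indep_seq_le_dim[OF _ _ XW fin]) (use gX m04 less2 in fastforce)
  have "indep_seq 1 (\<lambda>i. g (i + 2))" by (rule indep_seq_reindex[OF g]) (auto simp: inj_on_def)
  then have d12: "1 \<le> cdim (X \<inter> row_flag 6 (M 1) 2)"
    by (rule indep_seq_le_dim[OF _ _ XW fin]) (use gX m12 in \<open>simp del: add_2_eq_Suc'\<close>)
  have "indep_seq 2 (\<lambda>i. g (i + 1))" by (rule indep_seq_reindex[OF g]) (auto simp: inj_on_def)
  then have d14: "2 \<le> cdim (X \<inter> row_flag 6 (M 1) 4)"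
  proof (rule indep_seq_le_dim[OF _ _ XW fin])
    fix i :: nat assume i: "i < 2"
    show "g (i + 1) \<in> X \<inter> row_flag 6 (M 1) 4"
      using less2[OF i] gX[of 1] gX[of 2] m14 by (auto simp: numeral_2_eq_2)
  qed
  have d3: "1 \<le> cdim (X \<inter> row_flag 6 (M j) 3)" if j: "j \<in> {2, 3, 4}" for j
  proof -
    obtain h0 h1 h2 where h: "h0 \<noteq> 0 \<or> h1 \<noteq> 0 \<or> h2 \<noteq> 0"
      and e: "h0 * (\<gamma> j 0 0 * u1 - \<gamma> j 0 1 * u0) + h1 * (\<gamma> j 1 0 * u1 - \<gamma> j 1 1 * u0)
          + h2 * (\<gamma> j 2 0 * u1 - \<gamma> j 2 1 * u0) = 0"
        "h0 * (\<gamma> j 0 2 * v1 - \<gamma> j 0 3 * v0) + h1 * (\<gamma> j 1 2 * v1 - \<gamma> j 1 3 * v0)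
          + h2 * (\<gamma> j 2 2 * v1 - \<gamma> j 2 3 * v0) = 0"
        "h0 * (\<gamma> j 0 4 * w1 - \<gamma> j 0 5 * w0) + h1 * (\<gamma> j 1 4 * w1 - \<gamma> j 1 5 * w0)
          + h2 * (\<gamma> j 2 4 * w1 - \<gamma> j 2 5 * w0) = 0"
      using tri[OF j] unfolding tri_def det3_eq_0_iff by blast
    \<comment> \<open>The kernel vector becomes the coefficients of a vector of the third flag
      step.\<close>
    define h where "h = (\<lambda>r::nat. if r = 0 then h0 else if r = 1 then h1 else h2)"
    define x where "x = comb 3 (\<lambda>r. comb 6 E (\<gamma> j r)) h"
    have hs: "h 0 = h0" "h 1 = h1" "h 2 = h2" by (simp_all add: h_def)
    have "x \<in> row_flag 6 (M j) 3" unfolding K3[OF j] x_def by simp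
    moreover have "x \<in> X"
      unfolding X_def x_def comb_comb comb_in_plane_iff[OF E_indep] sum_lessThan_3 hs
    proof (intro conjI)
      show "(h0 * \<gamma> j 0 0 + h1 * \<gamma> j 1 0 + h2 * \<gamma> j 2 0) * u1 = (h0 * \<gamma> j 0 1 + h1 * \<gamma> j 1 1 + h2 * \<gamma> j 2 1) * u0"
        using e(1) by Groebner_Basis.algebra
      show "(h0 * \<gamma> j 0 2 + h1 * \<gamma> j 1 2 + h2 * \<gamma> j 2 2) * v1 = (h0 * \<gamma> j 0 3 + h1 * \<gamma> j 1 3 + h2 * \<gamma> j 2 3) * v0"
        using e(2) by Groebner_Basis.algebra
      show "(h0 * \<gamma> j 0 4 + h1 * \<gamma> j 1 4 + h2 * \<gamma> j 2 4) * w1 = (h0 * \<gamma> j 0 5 + h1 * \<gamma> j 1 5 + h2 * \<gamma> j 2 5) * w0"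
        using e(3) by Groebner_Basis.algebra
    qed
    moreover have "x \<noteq> 0"
    proof
      assume "x = 0"
      note z = indep_seqD[OF K3_indep[OF j] this[unfolded x_def]]
      show False using z[of 0] z[of 1] z[of 2] h hs by simp
    qed
    ultimately show ?thesis using nonzero_imp_dim_ge_1[OF _ _ XW fin] by blast
  qed
  show ?thesis
    unfolding X_def[symmetric] schubert_inter_iff Omega_135_iff Omega_pieri_iff
    using Grass full hyp d02 d04 d12 d14 d3 by simp
qed

text \<open>Vectors u and w come from the two-dimensional flag steps; v comes from two planes of
  \<open>X\<close> that must meet. They are nonzero and lie in complementary summands, so they span
  the three-space \<open>X\<close>.\<close>

lemma schubert_inter_imp_plane:
  assumes "X \<in> schubert_inter 3 3 schubert_data (\<lambda>j. row_flag 6 (M j))"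
  obtains u0 u1 v0 v1 w0 w1 where "u0 \<noteq> 0 \<or> u1 \<noteq> 0" "v0 \<noteq> 0 \<or> v1 \<noteq> 0" "w0 \<noteq> 0 \<or> w1 \<noteq> 0"
    "\<And>j. j \<in> {2, 3, 4} \<Longrightarrow> tri (\<gamma> j) u0 u1 v0 v1 w0 w1 = 0" "X = plane E u0 u1 v0 v1 w0 w1"
proof -
  have Grass: "X \<in> Grass 3 6"
    and d: "2 \<le> cdim (X \<inter> row_flag 6 (M 0) 4)" "1 \<le> cdim (X \<inter> row_flag 6 (M 0) 2)"
      "2 \<le> cdim (X \<inter> row_flag 6 (M 1) 4)" "1 \<le> cdim (X \<inter> row_flag 6 (M 1) 2)"
    and d3: "\<And>j. j \<in> {2, 3, 4} \<Longrightarrow> 1 \<le> cdim (X \<inter> row_flag 6 (M j) 3)"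
    using assms unfolding schubert_inter_iff Omega_135_iff Omega_pieri_iff by auto
  have X: "csubspace X" "cdim X = 3" using Grass by (auto simp: Grass_def)
  obtain u where u: "u \<in> X \<inter> row_flag 6 (M 0) 2" "u \<noteq> 0" by (rule dim_ge_1_obtain[OF d(2)])
  obtain w where w: "w \<in> X \<inter> row_flag 6 (M 1) 2" "w \<noteq> 0" by (rule dim_ge_1_obtain[OF d(4)])
  obtain v where v: "v \<in> X" "v \<in> row_flag 6 (M 0) 4" "v \<in> row_flag 6 (M 1) 4" "v \<noteq> 0"
    by (rule two_planes_meet_in_3space[OF X _ _ d(1,3)]) (simp_all add: row_flag_eq subspace_range_comb)
  obtain a where a: "u = comb 6 E (\<lambda>i. if i < 2 then a i else 0)"
    using u(1) unfolding flag_0_2 comb_subflags(1) by blast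
  obtain b where b: "v = comb 6 E (\<lambda>i. if i < 4 then b i else 0)"
    using v(2) unfolding flag_0_4 comb_subflags(2) by blast
  obtain b' where b': "v = comb 6 E (\<lambda>i. if i < 2 then 0 else b' (i - 2))"
    using v(3) unfolding flag_1_4 comb_subflags(4) by blast
  obtain c where c: "w = comb 6 E (\<lambda>i. if i < 4 then 0 else c (i - 4))"
    using w(1) unfolding flag_1_2 comb_subflags(3) by blast
  \<comment> \<open>The vector v has one expansion from each flag. Uniqueness of coordinates kills
    those with index 0 and 1, and only 2 and 3 survive.\<close>
  note bu = comb_unique[OF E_indep b[symmetric, THEN trans, OF b']]
  have b0: "b 0 = 0" "b 1 = 0" using bu[of 0] bu[of 1] by simp_all
  define g where "g = (\<lambda>r. comb 6 E (gens (a 0) (a 1) (b 2) (b 3) (c 0) (c 1) r))"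
  have ug: "u = g 0" unfolding g_def a by (rule comb6_cong) (simp_all add: gens_def)
  have vg: "v = g 1" unfolding g_def b by (rule comb6_cong) (use b0 in \<open>simp_all add: gens_def\<close>)
  have wg: "w = g 2" unfolding g_def c by (rule comb6_cong) (simp_all add: gens_def)
  have comb0: "comb 6 E (\<lambda>i. 0) = 0" by (auto simp: comb_def)
  have uvw: "a 0 \<noteq> 0 \<or> a 1 \<noteq> 0" "b 2 \<noteq> 0 \<or> b 3 \<noteq> 0" "c 0 \<noteq> 0 \<or> c 1 \<noteq> 0"
  proof -
    show "a 0 \<noteq> 0 \<or> a 1 \<noteq> 0"
    proof (rule ccontr)
      assume "\<not> ?thesis"
      then have "u = comb 6 E (\<lambda>i. 0)" unfolding a by (intro comb6_cong) simp_all
      then show False using u(2) comb0 by simp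
    qed
    show "b 2 \<noteq> 0 \<or> b 3 \<noteq> 0"
    proof (rule ccontr)
      assume "\<not> ?thesis"
      then have "v = comb 6 E (\<lambda>i. 0)" unfolding b using b0 by (intro comb6_cong) simp_all
      then show False using v(4) comb0 by simp
    qed
    show "c 0 \<noteq> 0 \<or> c 1 \<noteq> 0"
    proof (rule ccontr)
      assume "\<not> ?thesis"
      then have "w = comb 6 E (\<lambda>i. 0)" unfolding c by (intro comb6_cong) simp_all
      then show False using w(2) comb0 by simp
    qed
  qed
  have g: "indep_seq 3 g" unfolding g_def by (rule indep_seq_gens[OF E_indep uvw])
  have "\<forall>i<3. g i \<in> X" unfolding all_less_3 using u(1) v(1) w(1) ug vg wg by simp
  then have gX: "g i \<in> X" if "i < 3" for i using that by blast
  obtain W where W: "finite W" "card W = 3" "X \<subseteq> cspan W" by (rule subspace_dim_span[OF X(2)]) simp_all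
  have "X = range (comb 3 g)"
  proof (rule antisym)
    show "X \<subseteq> range (comb 3 g)" 
      by (rule subsetI, rule indep_seq_spans[OF g gX _ W(3,1)]) (simp_all add: W(2))
    show "range (comb 3 g) \<subseteq> X" 
      by (rule image_subsetI, rule comb_in_subspace[OF X(1) gX])
  qed
  then have plane: "X = plane E (a 0) (a 1) (b 2) (b 3) (c 0) (c 1)"
    unfolding g_def plane_eq_range[OF E_indep uvw] .
  have "tri (\<gamma> j) (a 0) (a 1) (b 2) (b 3) (c 0) (c 1) = 0" if j: "j \<in> {2, 3, 4}" for j
  proof -
    obtain x where x: "x \<in> X \<inter> row_flag 6 (M j) 3" "x \<noteq> 0" by (rule dim_ge_1_obtain[OF d3[OF j]])
    then obtain h where h: "x = comb 3 (\<lambda>r. comb 6 E (\<gamma> j r)) h" unfolding K3[OF j] by blast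
    have "comb 6 E (\<lambda>i. \<Sum>r<3. h r * \<gamma> j r i) \<in> plane E (a 0) (a 1) (b 2) (b 3) (c 0) (c 1)"
      using x(1) unfolding plane h comb_comb by blast
    then have e': "(h 0 * \<gamma> j 0 0 + h 1 * \<gamma> j 1 0 + h 2 * \<gamma> j 2 0) * a 1 = (h 0 * \<gamma> j 0 1 + h 1 * \<gamma> j 1 1 + h 2 * \<gamma> j 2 1) * a 0"
      "(h 0 * \<gamma> j 0 2 + h 1 * \<gamma> j 1 2 + h 2 * \<gamma> j 2 2) * b 3 = (h 0 * \<gamma> j 0 3 + h 1 * \<gamma> j 1 3 + h 2 * \<gamma> j 2 3) * b 2"
      "(h 0 * \<gamma> j 0 4 + h 1 * \<gamma> j 1 4 + h 2 * \<gamma> j 2 4) * c 1 = (h 0 * \<gamma> j 0 5 + h 1 * \<gamma> j 1 5 + h 2 * \<gamma> j 2 5) * c 0"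
      unfolding comb_in_plane_iff[OF E_indep] sum_lessThan_3 by blast+
    have e: "h 0 * (\<gamma> j 0 0 * a 1 - \<gamma> j 0 1 * a 0) + h 1 * (\<gamma> j 1 0 * a 1 - \<gamma> j 1 1 * a 0)
          + h 2 * (\<gamma> j 2 0 * a 1 - \<gamma> j 2 1 * a 0) = 0"
        "h 0 * (\<gamma> j 0 2 * b 3 - \<gamma> j 0 3 * b 2) + h 1 * (\<gamma> j 1 2 * b 3 - \<gamma> j 1 3 * b 2)
          + h 2 * (\<gamma> j 2 2 * b 3 - \<gamma> j 2 3 * b 2) = 0"
        "h 0 * (\<gamma> j 0 4 * c 1 - \<gamma> j 0 5 * c 0) + h 1 * (\<gamma> j 1 4 * c 1 - \<gamma> j 1 5 * c 0)
          + h 2 * (\<gamma> j 2 4 * c 1 - \<gamma> j 2 5 * c 0) = 0"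
      subgoal using e'(1) by Groebner_Basis.algebra
      subgoal using e'(2) by Groebner_Basis.algebra
      subgoal using e'(3) by Groebner_Basis.algebra
      done
    have "h 0 \<noteq> 0 \<or> h 1 \<noteq> 0 \<or> h 2 \<noteq> 0"
    proof (rule ccontr)
      assume "\<not> ?thesis"
      then have z: "h 0 = 0" "h 1 = 0" "h 2 = 0" by simp_all
      have "x = 0" unfolding h comb_def[of 3] sum_lessThan_3 z by (simp add: zero_fun_def)
      then show False using x(2) by simp
    qed
    then have "\<exists>h0 h1 h2. (h0 \<noteq> 0 \<or> h1 \<noteq> 0 \<or> h2 \<noteq> 0) \<and>
        h0 * (\<gamma> j 0 0 * a 1 - \<gamma> j 0 1 * a 0) + h1 * (\<gamma> j 1 0 * a 1 - \<gamma> j 1 1 * a 0)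
          + h2 * (\<gamma> j 2 0 * a 1 - \<gamma> j 2 1 * a 0) = 0 \<and>
        h0 * (\<gamma> j 0 2 * b 3 - \<gamma> j 0 3 * b 2) + h1 * (\<gamma> j 1 2 * b 3 - \<gamma> j 1 3 * b 2)
          + h2 * (\<gamma> j 2 2 * b 3 - \<gamma> j 2 3 * b 2) = 0 \<and>
        h0 * (\<gamma> j 0 4 * c 1 - \<gamma> j 0 5 * c 0) + h1 * (\<gamma> j 1 4 * c 1 - \<gamma> j 1 5 * c 0)
          + h2 * (\<gamma> j 2 4 * c 1 - \<gamma> j 2 5 * c 0) = 0"
      using e by (intro exI conjI)
    then show ?thesis unfolding tri_def det3_eq_0_iff .
  qed
  then show ?thesis by (rule that[OF uvw _ plane])
qed

end

subsection \<open>Elimination to a binary sextic\<close>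

text \<open>The value at (1, 0) of the form of degree \<open>n\<close> obtained by homogenizing
  \<open>p\<close>. The value may be zero, so the actual degree may be smaller.\<close>

definition top_coeff :: "nat \<Rightarrow> 'a::comm_ring_1 poly \<Rightarrow> 'a \<Rightarrow> bool" where
  "top_coeff n p c \<longleftrightarrow> degree p \<le> n \<and> coeff p n = c"

lemma top_coeff_mult:
  assumes "top_coeff m p a" "top_coeff n q b"
  shows "top_coeff (m + n) (p * q) (a * b)"
proof -
  have d: "degree p \<le> m" "degree q \<le> n" and c: "coeff p m = a" "coeff q n = b"
    using assms by (auto simp: top_coeff_def)
  have "coeff (p * q) (m + n) = (\<Sum>i\<le>m + n. coeff p i * coeff q (m + n - i))" by (simp add: coeff_mult)
  also have "\<dots> = (\<Sum>i\<in>{m}. coeff p i * coeff q (m + n - i))"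
  proof (rule sum.mono_neutral_right)
    show "\<forall>i\<in>{..m + n} - {m}. coeff p i * coeff q (m + n - i) = 0"
    proof
      fix i assume "i \<in> {..m + n} - {m}"
      then have "degree p < i \<or> degree q < m + n - i" using d by auto
      then show "coeff p i * coeff q (m + n - i) = 0" by (auto simp: coeff_eq_0)
    qed
  qed auto
  finally have "coeff (p * q) (m + n) = a * b" using c by simp
  moreover have "degree (p * q) \<le> m + n" using degree_mult_le[of p q] d by linarith
  ultimately show ?thesis by (simp add: top_coeff_def)
qed

lemma top_coeff_add: "top_coeff n p a \<Longrightarrow> top_coeff n q b \<Longrightarrow> top_coeff n (p + q) (a + b)"
  by (simp add: top_coeff_def degree_add_le)

lemma top_coeff_diff: "top_coeff n p a \<Longrightarrow> top_coeff n q b \<Longrightarrow> top_coeff n (p - q) (a - b)"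
  by (simp add: top_coeff_def degree_diff_le)

lemma top_coeff_uminus: "top_coeff n p a \<Longrightarrow> top_coeff n (- p) (- a)"
  by (simp add: top_coeff_def)

lemma top_coeff_det3:
  assumes a: "top_coeff m a0 x0" "top_coeff m a1 x1" "top_coeff m a2 x2"
    and b: "top_coeff n b0 y0" "top_coeff n b1 y1" "top_coeff n b2 y2"
    and c: "top_coeff k c0 z0" "top_coeff k c1 z1" "top_coeff k c2 z2"
  shows "top_coeff (m + n + k) (det3 a0 b0 c0 a1 b1 c1 a2 b2 c2) (det3 x0 y0 z0 x1 y1 z1 x2 y2 z2)"
proof -
  have "top_coeff (m + (n + k)) (a0 * (b1 * c2 - b2 * c1)) (x0 * (y1 * z2 - y2 * z1))"
    by (intro top_coeff_mult top_coeff_diff assms)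
  moreover have "top_coeff (n + (m + k)) (b0 * (a1 * c2 - a2 * c1)) (y0 * (x1 * z2 - x2 * z1))"
    by (intro top_coeff_mult top_coeff_diff assms)
  moreover have "top_coeff (k + (m + n)) (c0 * (a1 * b2 - a2 * b1)) (z0 * (x1 * y2 - x2 * y1))"
    by (intro top_coeff_mult top_coeff_diff assms)
  ultimately show ?thesis unfolding det3_def
    by (intro top_coeff_add top_coeff_diff) (simp_all add: ac_simps)
qed

text \<open>For fixed u, the coefficients of \<open>tri\<close> as a linear form on the tensor
  product of v and w, read off at the coordinate vectors.\<close>

definition bil :: "(nat \<Rightarrow> nat \<Rightarrow> 'a::comm_ring_1) \<Rightarrow> 'a \<Rightarrow> 'a \<Rightarrow> nat \<Rightarrow> 'a" where
  "bil g u0 u1 i = (if i = 0 then tri g u0 u1 1 0 1 0 else if i = 1 then tri g u0 u1 1 0 0 1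
     else if i = 2 then tri g u0 u1 0 1 1 0 else tri g u0 u1 0 1 0 1)"

lemma tri_bil: "tri g u0 u1 v0 v1 w0 w1 =
    bil g u0 u1 0 * (v0 * w0) + bil g u0 u1 1 * (v0 * w1) + bil g u0 u1 2 * (v1 * w0) + bil g u0 u1 3 * (v1 * w1)"
  by (simp add: bil_def tri_def det3_def algebra_simps)

text \<open>The generalized cross product in dimension four: signed maximal minors of a matrix with
  three rows.\<close>

definition cross4 :: "(nat \<Rightarrow> 'a::comm_ring_1) \<Rightarrow> (nat \<Rightarrow> 'a) \<Rightarrow> (nat \<Rightarrow> 'a) \<Rightarrow> nat \<Rightarrow> 'a" where
  "cross4 a b c i =
    (if i = 0 then det3 (a 1) (a 2) (a 3) (b 1) (b 2) (b 3) (c 1) (c 2) (c 3)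
     else if i = 1 then - det3 (a 0) (a 2) (a 3) (b 0) (b 2) (b 3) (c 0) (c 2) (c 3)
     else if i = 2 then det3 (a 0) (a 1) (a 3) (b 0) (b 1) (b 3) (c 0) (c 1) (c 3)
     else - det3 (a 0) (a 1) (a 2) (b 0) (b 1) (b 2) (c 0) (c 1) (c 2))"

lemma cross4_orth:
  "a 0 * cross4 a b c 0 + a 1 * cross4 a b c 1 + a 2 * cross4 a b c 2 + a 3 * cross4 a b c 3 = 0"
  "b 0 * cross4 a b c 0 + b 1 * cross4 a b c 1 + b 2 * cross4 a b c 2 + b 3 * cross4 a b c 3 = 0"
  "c 0 * cross4 a b c 0 + c 1 * cross4 a b c 1 + c 2 * cross4 a b c 2 + c 3 * cross4 a b c 3 = 0"
  by (simp_all add: cross4_def det3_def algebra_simps)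

text \<open>By Cramer's rule each two by two minor formed by the cross product and \<open>n\<close>
  is, up to sign, a determinant in which one column holds the values of the three forms at
  \<open>n\<close>; those values vanish.\<close>

lemma cross4_proportional:
  fixes a b c n :: "nat \<Rightarrow> complex"
  assumes "a 0 * n 0 + a 1 * n 1 + a 2 * n 2 + a 3 * n 3 = 0"
    "b 0 * n 0 + b 1 * n 1 + b 2 * n 2 + b 3 * n 3 = 0"
    "c 0 * n 0 + c 1 * n 1 + c 2 * n 2 + c 3 * n 3 = 0"
    and ij: "i < 4" "j < 4"
  shows "cross4 a b c i * n j = cross4 a b c j * n i"
proof -
  let ?ea = "a 0 * n 0 + a 1 * n 1 + a 2 * n 2 + a 3 * n 3"
  let ?eb = "b 0 * n 0 + b 1 * n 1 + b 2 * n 2 + b 3 * n 3"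
  let ?ec = "c 0 * n 0 + c 1 * n 1 + c 2 * n 2 + c 3 * n 3"
  have
    "cross4 a b c 0 * n 1 - cross4 a b c 1 * n 0 = det3 ?ea (a 2) (a 3) ?eb (b 2) (b 3) ?ec (c 2) (c 3)"
    "cross4 a b c 0 * n 2 - cross4 a b c 2 * n 0 = det3 (a 1) ?ea (a 3) (b 1) ?eb (b 3) (c 1) ?ec (c 3)"
    "cross4 a b c 0 * n 3 - cross4 a b c 3 * n 0 = det3 (a 1) (a 2) ?ea (b 1) (b 2) ?eb (c 1) (c 2) ?ec"
    "cross4 a b c 1 * n 2 - cross4 a b c 2 * n 1 = - det3 (a 0) ?ea (a 3) (b 0) ?eb (b 3) (c 0) ?ec (c 3)"
    "cross4 a b c 1 * n 3 - cross4 a b c 3 * n 1 = - det3 (a 0) (a 2) ?ea (b 0) (b 2) ?eb (c 0) (c 2) ?ec"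
    "cross4 a b c 2 * n 3 - cross4 a b c 3 * n 2 = det3 (a 0) (a 1) ?ea (b 0) (b 1) ?eb (c 0) (c 1) ?ec"
    by (simp_all add: cross4_def det3_def algebra_simps)
  moreover have "det3 0 x y 0 x' y' 0 x'' y'' = 0" "det3 x 0 y x' 0 y' x'' 0 y'' = 0" "det3 x y 0 x' y' 0 x'' y'' 0 = 0"
    for x y x' y' x'' y'' :: complex by (simp_all add: det3_def)
  ultimately have "cross4 a b c 0 * n 1 = cross4 a b c 1 * n 0" "cross4 a b c 0 * n 2 = cross4 a b c 2 * n 0"
    "cross4 a b c 0 * n 3 = cross4 a b c 3 * n 0" "cross4 a b c 1 * n 2 = cross4 a b c 2 * n 1"
    "cross4 a b c 1 * n 3 = cross4 a b c 3 * n 1" "cross4 a b c 2 * n 3 = cross4 a b c 3 * n 2"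
    unfolding assms(1-3) by simp_all
  moreover have "i = 0 \<or> i = 1 \<or> i = 2 \<or> i = 3" "j = 0 \<or> j = 1 \<or> j = 2 \<or> j = 3" using ij by linarith+
  ultimately show ?thesis by (elim disjE) (simp_all only:)
qed

lemma ex_less_4: "(\<exists>i<4::nat. P i) \<longleftrightarrow> P 0 \<or> P 1 \<or> P 2 \<or> P 3"
  using all_less_4[of "\<lambda>i. \<not> P i"] by blast

text \<open>Eliminating \<open>v\<close> and \<open>w\<close>: for fixed \<open>u\<close> the three equations are linear in
  \<open>v \<otimes> w\<close>, with solution \<open>kern\<close>, which must have rank one.\<close>

definition kern :: "(nat \<Rightarrow> nat \<Rightarrow> nat \<Rightarrow> 'a::comm_ring_1) \<Rightarrow> 'a \<Rightarrow> 'a \<Rightarrow> nat \<Rightarrow> 'a" where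
  "kern \<gamma> u0 u1 = cross4 (bil (\<gamma> 2) u0 u1) (bil (\<gamma> 3) u0 u1) (bil (\<gamma> 4) u0 u1)"

text \<open>Read as a two by two matrix, \<open>kern\<close> must be a pure tensor, so its
  determinant must vanish. The entries are cubic in u, whence degree six.\<close>

definition sextic :: "(nat \<Rightarrow> nat \<Rightarrow> nat \<Rightarrow> 'a::comm_ring_1) \<Rightarrow> 'a \<Rightarrow> 'a \<Rightarrow> 'a" where
  "sextic \<gamma> u0 u1 = kern \<gamma> u0 u1 0 * kern \<gamma> u0 u1 3 - kern \<gamma> u0 u1 1 * kern \<gamma> u0 u1 2"

text \<open>Constants are embedded in the polynomial ring, so that the definitions above can be
  evaluated at u = (X, 1) to dehomogenize the sextic.\<close>

definition const_coords :: "(nat \<Rightarrow> nat \<Rightarrow> nat \<Rightarrow> 'a::comm_ring_1) \<Rightarrow> nat \<Rightarrow> nat \<Rightarrow> nat \<Rightarrow> 'a poly" where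
  "const_coords \<gamma> j r i = [:\<gamma> j r i:]"

definition sextic_poly :: "(nat \<Rightarrow> nat \<Rightarrow> nat \<Rightarrow> 'a::comm_ring_1) \<Rightarrow> 'a poly" where
  "sextic_poly \<gamma> = sextic (const_coords \<gamma>) [:0, 1:] 1"

lemma poly_det3: "poly (det3 a0 b0 c0 a1 b1 c1 a2 b2 c2) x =
    det3 (poly a0 x) (poly b0 x) (poly c0 x) (poly a1 x) (poly b1 x) (poly c1 x) (poly a2 x) (poly b2 x) (poly c2 x)"
  by (simp add: det3_def)

lemma poly_tri: "poly (tri (const_coords \<gamma> j) u0 u1 v0 v1 w0 w1) x =
    tri (\<gamma> j) (poly u0 x) (poly u1 x) (poly v0 x) (poly v1 x) (poly w0 x) (poly w1 x)"
  by (simp add: tri_def poly_det3 const_coords_def)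

lemma poly_bil: "poly (bil (const_coords \<gamma> j) u0 u1 i) x = bil (\<gamma> j) (poly u0 x) (poly u1 x) i"
  by (simp add: bil_def poly_tri)

lemma poly_kern: "poly (kern (const_coords \<gamma>) u0 u1 i) x = kern \<gamma> (poly u0 x) (poly u1 x) i"
  by (simp add: kern_def cross4_def poly_det3 poly_bil)

lemma poly_sextic: "poly (sextic_poly \<gamma>) x = sextic \<gamma> x 1"
  by (simp add: sextic_poly_def sextic_def poly_kern)

lemma top_coeff_if:
  "(P \<Longrightarrow> top_coeff n p a) \<Longrightarrow> (\<not> P \<Longrightarrow> top_coeff n q b) \<Longrightarrow> top_coeff n (if P then p else q) (if P then a else b)"
  by simp

text \<open>The leading coefficient is the value at the point at infinity of the u-line. Only the
  u-column of \<open>tri\<close> depends on X, linearly; the minors in \<open>cross4\<close> triple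
  this degree and \<open>sextic\<close> doubles it.\<close>

lemma top_coeff_sextic: "top_coeff 6 (sextic_poly \<gamma>) (sextic \<gamma> 1 0)"
proof -
  have c0: "top_coeff 0 [:a:] a" for a :: 'a by (simp add: top_coeff_def)
  have x1: "top_coeff 1 [:0, 1:] (1 :: 'a)" "top_coeff 1 (1 :: 'a poly) 0" by (simp_all add: top_coeff_def)
  have c: "top_coeff 0 (const_coords \<gamma> j r a * p - const_coords \<gamma> j r b * q) (\<gamma> j r a * x - \<gamma> j r b * y)"
    if "p = [:x:]" "q = [:y:]" for j r a b p q x y
    using top_coeff_diff[OF top_coeff_mult[OF c0 c0] top_coeff_mult[OF c0 c0], of "\<gamma> j r a" x "\<gamma> j r b" y]
    by (simp only: that const_coords_def add_0)
  have l: "top_coeff 1 (const_coords \<gamma> j r a * 1 - const_coords \<gamma> j r b * [:0, 1:]) (\<gamma> j r a * 0 - \<gamma> j r b * 1)" for j r a b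
    using top_coeff_diff[OF top_coeff_mult[OF c0 x1(2)] top_coeff_mult[OF c0 x1(1)], of "\<gamma> j r a" "\<gamma> j r b"]
    by (simp only: const_coords_def add_0)
  have t: "top_coeff 1 (tri (const_coords \<gamma> j) [:0, 1:] 1 p0 p1 q0 q1) (tri (\<gamma> j) 1 0 x0 x1 y0 y1)"
    if "p0 = [:x0:]" "p1 = [:x1:]" "q0 = [:y0:]" "q1 = [:y1:]" for j p0 p1 q0 q1 x0 x1 y0 y1
  proof -
    have "top_coeff (1 + 0 + 0) (tri (const_coords \<gamma> j) [:0, 1:] 1 p0 p1 q0 q1) (tri (\<gamma> j) 1 0 x0 x1 y0 y1)"
      unfolding tri_def by (intro top_coeff_det3 l c that)
    then show ?thesis by (simp only: add_0_right)
  qed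
  have z: "(0 :: 'a poly) = [:0:]" by simp
  have b: "top_coeff 1 (bil (const_coords \<gamma> j) [:0, 1:] 1 i) (bil (\<gamma> j) 1 0 i)" for i j
    unfolding bil_def by (intro top_coeff_if t one_pCons z)
  have k: "top_coeff (1 + 1 + 1) (kern (const_coords \<gamma>) [:0, 1:] 1 i) (kern \<gamma> 1 0 i)" for i
    unfolding kern_def cross4_def by (intro top_coeff_if top_coeff_det3 top_coeff_uminus b)
  have "top_coeff ((1 + 1 + 1) + (1 + 1 + 1)) (sextic_poly \<gamma>) (sextic \<gamma> 1 0)"
    unfolding sextic_poly_def sextic_def by (intro top_coeff_diff top_coeff_mult k)
  then show ?thesis by (simp add: numeral_eq_Suc)
qed

section \<open>Planes and roots of the sextic\<close>

definition outer :: "'a::comm_ring_1 \<Rightarrow> 'a \<Rightarrow> 'a \<Rightarrow> 'a \<Rightarrow> nat \<Rightarrow> 'a" where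
  "outer v0 v1 w0 w1 i =
     (if i = 0 then v0 * w0 else if i = 1 then v0 * w1 else if i = 2 then v1 * w0 else v1 * w1)"

text \<open>The tensor of v and w is a nonzero common zero of the three linear forms, so
  \<open>kern\<close> is a multiple of it and has rank at most one.\<close>

lemma sextic_vanishes:
  fixes \<gamma> :: "nat \<Rightarrow> nat \<Rightarrow> nat \<Rightarrow> complex"
  assumes t: "\<forall>j\<in>{2, 3, 4}. tri (\<gamma> j) u0 u1 v0 v1 w0 w1 = 0"
    and vw: "v0 \<noteq> 0 \<or> v1 \<noteq> 0" "w0 \<noteq> 0 \<or> w1 \<noteq> 0"
  defines "n \<equiv> outer v0 v1 w0 w1"
  shows "sextic \<gamma> u0 u1 = 0" "i < 4 \<Longrightarrow> j < 4 \<Longrightarrow> kern \<gamma> u0 u1 i * n j = kern \<gamma> u0 u1 j * n i"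
proof -
  have b: "bil (\<gamma> j) u0 u1 0 * n 0 + bil (\<gamma> j) u0 u1 1 * n 1 + bil (\<gamma> j) u0 u1 2 * n 2 + bil (\<gamma> j) u0 u1 3 * n 3 = 0"
    if "j \<in> {2, 3, 4}" for j
    using bspec[OF t that] unfolding tri_bil n_def outer_def by simp
  show pr: "kern \<gamma> u0 u1 i * n j = kern \<gamma> u0 u1 j * n i" if "i < 4" "j < 4" for i j
    unfolding kern_def by (rule cross4_proportional[OF b b b that]) auto
  have "n 0 \<noteq> 0 \<or> n 1 \<noteq> 0 \<or> n 2 \<noteq> 0 \<or> n 3 \<noteq> 0" using vw by (auto simp: n_def outer_def)
  then obtain q where q: "q < 4" "n q \<noteq> 0" using ex_less_4[of "\<lambda>i. n i \<noteq> 0"] by blast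
  \<comment> \<open>Multiplying by the square of a nonzero entry of \<open>n\<close> lets the
    proportionality replace the entries of \<open>kern\<close> by those of \<open>n\<close>.\<close>
  have "n q * n q * sextic \<gamma> u0 u1 = (kern \<gamma> u0 u1 0 * n q) * (kern \<gamma> u0 u1 3 * n q)
      - (kern \<gamma> u0 u1 1 * n q) * (kern \<gamma> u0 u1 2 * n q)"
    by (simp add: sextic_def algebra_simps)
  also have "\<dots> = (kern \<gamma> u0 u1 q * n 0) * (kern \<gamma> u0 u1 q * n 3) - (kern \<gamma> u0 u1 q * n 1) * (kern \<gamma> u0 u1 q * n 2)"
    using pr[of 0 q] pr[of 1 q] pr[of 2 q] pr[of 3 q] q(1) by simp
  also have "\<dots> = kern \<gamma> u0 u1 q * kern \<gamma> u0 u1 q * (n 0 * n 3 - n 1 * n 2)" by (simp add: algebra_simps)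
  also have "n 0 * n 3 - n 1 * n 2 = 0" by (simp add: n_def outer_def)
  finally show "sextic \<gamma> u0 u1 = 0" using q by simp
qed

lemma rank_one_obtain:
  fixes k :: "nat \<Rightarrow> complex"
  assumes "k 0 * k 3 - k 1 * k 2 = 0" "\<exists>i<4. k i \<noteq> 0"
  obtains v0 v1 w0 w1 where "v0 \<noteq> 0 \<or> v1 \<noteq> 0" "w0 \<noteq> 0 \<or> w1 \<noteq> 0"
    "k 0 = v0 * w0" "k 1 = v0 * w1" "k 2 = v1 * w0" "k 3 = v1 * w1"
proof (cases "k 0 \<noteq> 0 \<or> k 1 \<noteq> 0")
  case True
  have "k 2 * k 1 = k 3 * k 0" using assms(1) by (simp add: mult.commute)
  then obtain c where "k 2 = c * k 0" "k 3 = c * k 1" unfolding proportional_iff[OF True] by blast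
  then show ?thesis using that[of 1 c "k 0" "k 1"] True by simp
next
  case False
  obtain i where "i < 4" "k i \<noteq> 0" using assms(2) by blast
  moreover from this have "i = 0 \<or> i = 1 \<or> i = 2 \<or> i = 3" by linarith
  ultimately have "k 2 \<noteq> 0 \<or> k 3 \<noteq> 0" using False by auto
  then show ?thesis using that[of 0 1 "k 2" "k 3"] False by simp
qed

text \<open>The sextic is quadratic in the entries of \<open>kern\<close>, so a common zero of these
  entries is a multiple root. Used in the contrapositive: at a simple root \<open>kern\<close> does
  not vanish.\<close>

lemma pderiv_sextic_zero:
  fixes \<gamma> :: "nat \<Rightarrow> nat \<Rightarrow> nat \<Rightarrow> complex"
  assumes "\<And>i. i < 4 \<Longrightarrow> kern \<gamma> x 1 i = 0"
  shows "poly (pderiv (sextic_poly \<gamma>)) x = 0"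
  using assms[of 0] assms[of 1] assms[of 2] assms[of 3]
  by (simp add: sextic_poly_def sextic_def pderiv_diff pderiv_mult poly_kern)

text \<open>Counting through a bijection known only as a relation, because v and w attached to a
  root are determined up to scalars only.\<close>

lemma card_eq_by_relation:
  assumes "\<And>X. X \<in> A \<Longrightarrow> \<exists>x\<in>R. Q x X" "\<And>x. x \<in> R \<Longrightarrow> \<exists>X\<in>A. Q x X"
    and "\<And>x X X'. X \<in> A \<Longrightarrow> X' \<in> A \<Longrightarrow> Q x X \<Longrightarrow> Q x X' \<Longrightarrow> X = X'"
    and "\<And>x x' X. Q x X \<Longrightarrow> Q x' X \<Longrightarrow> x = x'"
    and "finite R"
  shows "finite A \<and> card A = card R"
proof -
  have "\<forall>x\<in>R. \<exists>X. X \<in> A \<and> Q x X" using assms(2) by blast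
  then obtain f where f: "\<And>x. x \<in> R \<Longrightarrow> f x \<in> A \<and> Q x (f x)" by metis
  have "A = f ` R"
  proof
    show "A \<subseteq> f ` R"
    proof
      fix X assume X: "X \<in> A"
      then obtain x where x: "x \<in> R" "Q x X" using assms(1) by blast
      then have "X = f x" using assms(3)[OF X] f[OF x(1)] by blast
      then show "X \<in> f ` R" using x by blast
    qed
  qed (use f in auto)
  moreover have "inj_on f R" by (rule inj_onI) (use f assms(4) in metis)
  ultimately show ?thesis using assms(5) by (simp add: card_image)
qed

context adapted_basis
begin

text \<open>Planes correspond to roots by the ratio u0 / u1. A nonzero leading coefficient keeps u1
  from vanishing, and at a simple root the nonzero \<open>kern\<close> determines v and w up to
  scalars.\<close>

lemma card_schubert_inter:
  assumes top: "coeff (sextic_poly \<gamma>) 6 \<noteq> 0" and sqf: "rsquarefree (sextic_poly \<gamma>)"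
  defines "S \<equiv> schubert_inter 3 3 schubert_data (\<lambda>j. row_flag 6 (M j))"
  shows "finite S \<and> card S = 6"
proof -
  let ?p = "sextic_poly \<gamma>"
  define R where "R = {x. poly ?p x = 0}"
  have p0: "?p \<noteq> 0" using top by auto
  have "degree ?p = 6"
    using top top_coeff_sextic[of \<gamma>] le_degree[OF top] by (simp add: top_coeff_def)
  then have R: "finite R" "card R = 6"
    using sqf rsquarefree_card_degree[OF p0] poly_roots_finite[OF p0] by (simp_all add: R_def)
  define Q where "Q = (\<lambda>x X. \<exists>v0 v1 w0 w1. (v0 \<noteq> 0 \<or> v1 \<noteq> 0) \<and> (w0 \<noteq> 0 \<or> w1 \<noteq> 0) \<and>
      (\<forall>j\<in>{2, 3, 4}. tri (\<gamma> j) x 1 v0 v1 w0 w1 = 0) \<and> X = plane E x 1 v0 v1 w0 w1)"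
  have kern_nz: "\<exists>i<4. kern \<gamma> x 1 i \<noteq> 0" if "poly ?p x = 0" for x
  proof (rule ccontr)
    assume "\<not> ?thesis"
    then have "poly (pderiv ?p) x = 0" by (intro pderiv_sextic_zero) blast
    then show False using sqf that unfolding rsquarefree_roots by blast
  qed
  have "finite S \<and> card S = card R"
  proof (rule card_eq_by_relation[where Q = Q])
    fix X assume "X \<in> S"
    then obtain u0 u1 v0 v1 w0 w1 where uvw: "u0 \<noteq> 0 \<or> u1 \<noteq> 0" "v0 \<noteq> 0 \<or> v1 \<noteq> 0" "w0 \<noteq> 0 \<or> w1 \<noteq> 0"
      and t: "\<And>j. j \<in> {2, 3, 4} \<Longrightarrow> tri (\<gamma> j) u0 u1 v0 v1 w0 w1 = 0" and X: "X = plane E u0 u1 v0 v1 w0 w1"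
      unfolding S_def by (rule schubert_inter_imp_plane) blast
    have scale: "tri (\<gamma> j) (c * x) (c * y) v0 v1 w0 w1 = c * tri (\<gamma> j) x y v0 v1 w0 w1" for j c x y
      by (simp add: tri_def det3_def algebra_simps)
    have u1: "u1 \<noteq> 0"
    proof
      assume z: "u1 = 0"
      have "\<forall>j\<in>{2, 3, 4}. tri (\<gamma> j) 1 0 v0 v1 w0 w1 = 0"
      proof
        fix j :: nat assume "j \<in> {2, 3, 4}"
        from t[OF this] show "tri (\<gamma> j) 1 0 v0 v1 w0 w1 = 0"
          using scale[of j u0 1 0] uvw(1) z by simp
      qed
      then have "sextic \<gamma> 1 0 = 0" by (rule sextic_vanishes(1)[OF _ uvw(2,3)])
      then show False using top top_coeff_sextic[of \<gamma>] by (simp add: top_coeff_def)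
    qed
    have t1: "\<forall>j\<in>{2, 3, 4}. tri (\<gamma> j) (u0 / u1) 1 v0 v1 w0 w1 = 0"
    proof
      fix j :: nat assume "j \<in> {2, 3, 4}"
      from t[OF this] show "tri (\<gamma> j) (u0 / u1) 1 v0 v1 w0 w1 = 0"
        using scale[of j u1 "u0 / u1" 1] u1 by simp
    qed
    then have "sextic \<gamma> (u0 / u1) 1 = 0" by (rule sextic_vanishes(1)[OF _ uvw(2,3)])
    then have "u0 / u1 \<in> R" by (simp add: R_def poly_sextic)
    moreover have "X = plane E (u0 / u1) 1 v0 v1 w0 w1" unfolding X
      by (rule plane_cong_proportional) (use uvw u1 in auto)
    then have "Q (u0 / u1) X" unfolding Q_def using uvw t1 by blast
    ultimately show "\<exists>x\<in>R. Q x X" by blast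
  next
    fix x assume "x \<in> R"
    then have x: "poly ?p x = 0" by (simp add: R_def)
    have "kern \<gamma> x 1 0 * kern \<gamma> x 1 3 - kern \<gamma> x 1 1 * kern \<gamma> x 1 2 = 0"
      using x unfolding poly_sextic sextic_def .
    then obtain v0 v1 w0 w1 where vw: "v0 \<noteq> 0 \<or> v1 \<noteq> 0" "w0 \<noteq> 0 \<or> w1 \<noteq> 0"
      and k: "kern \<gamma> x 1 0 = v0 * w0" "kern \<gamma> x 1 1 = v0 * w1" "kern \<gamma> x 1 2 = v1 * w0" "kern \<gamma> x 1 3 = v1 * w1"
      by (rule rank_one_obtain[OF _ kern_nz[OF x]])
    have t: "\<forall>j\<in>{2, 3, 4}. tri (\<gamma> j) x 1 v0 v1 w0 w1 = 0"
      unfolding tri_bil k[symmetric] kern_def using cross4_orth by blast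
    have "plane E x 1 v0 v1 w0 w1 \<in> S" unfolding S_def
      by (rule plane_in_schubert_inter) (use vw t in auto)
    then show "\<exists>X\<in>S. Q x X" unfolding Q_def using vw t by blast
  next
    fix x X X' assume "X \<in> S" "X' \<in> S" "Q x X" "Q x X'"
    obtain v0 v1 w0 w1 where vw: "v0 \<noteq> 0 \<or> v1 \<noteq> 0" "w0 \<noteq> 0 \<or> w1 \<noteq> 0"
      and t: "\<forall>j\<in>{2, 3, 4}. tri (\<gamma> j) x 1 v0 v1 w0 w1 = 0" and X: "X = plane E x 1 v0 v1 w0 w1"
      using \<open>Q x X\<close> unfolding Q_def by blast
    obtain v0' v1' w0' w1' where vw': "v0' \<noteq> 0 \<or> v1' \<noteq> 0" "w0' \<noteq> 0 \<or> w1' \<noteq> 0"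
      and t': "\<forall>j\<in>{2, 3, 4}. tri (\<gamma> j) x 1 v0' v1' w0' w1' = 0" and X': "X' = plane E x 1 v0' v1' w0' w1'"
      using \<open>Q x X'\<close> unfolding Q_def by blast
    have "poly ?p x = 0" unfolding poly_sextic by (rule sextic_vanishes(1)[OF t vw])
    then obtain q where q: "q < 4" "kern \<gamma> x 1 q \<noteq> 0" using kern_nz by blast
    define n where "n = outer v0 v1 w0 w1"
    define n' where "n' = outer v0' v1' w0' w1'"
    \<comment> \<open>Both tensors are parallel to the same nonzero vector \<open>kern\<close>,
      hence to each other.\<close>
    have nn': "n i * n' j = n j * n' i" if "i < 4" "j < 4" for i j
    proof -
      note s = sextic_vanishes(2)[of \<gamma> x 1 v0 v1 w0 w1, OF t vw, folded n_def]
        sextic_vanishes(2)[of \<gamma> x 1 v0' v1' w0' w1', OF t' vw', folded n'_def]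
      let ?k = "kern \<gamma> x 1"
      have "?k q * ?k q * (n i * n' j) = (?k q * n i) * (?k q * n' j)" by (simp add: mult_ac)
      also have "\<dots> = (?k i * n q) * (?k j * n' q)" using s(1)[OF q(1) that(1)] s(2)[OF q(1) that(2)] by simp
      also have "\<dots> = (?k j * n q) * (?k i * n' q)" by (simp add: mult_ac)
      also have "\<dots> = (?k q * n j) * (?k q * n' i)" using s(1)[OF q(1) that(2)] s(2)[OF q(1) that(1)] by simp
      also have "\<dots> = ?k q * ?k q * (n j * n' i)" by (simp add: mult_ac)
      finally show ?thesis using q(2) by simp
    qed
    have "n 0 \<noteq> 0 \<or> n 1 \<noteq> 0 \<or> n 2 \<noteq> 0 \<or> n 3 \<noteq> 0" using vw by (auto simp: n_def outer_def)
    then obtain m where m: "m < 4" "n m \<noteq> 0" using ex_less_4[of "\<lambda>i. n i \<noteq> 0"] by blast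
    define d where "d = n' m / n m"
    have "n' i = d * n i" if "i < 4" for i using nn'[OF m(1) that] m(2) by (simp add: d_def field_simps)
    from this[of 0] this[of 1] this[of 2] this[of 3]
    have e: "v0' * w0' = d * (v0 * w0)" "v0' * w1' = d * (v0 * w1)" "v1' * w0' = d * (v1 * w0)" "v1' * w1' = d * (v1 * w1)"
      by (simp_all add: n_def n'_def outer_def)
    \<comment> \<open>From proportional tensors to proportional factors: cross-multiplied entries,
      from which a nonzero entry of the other factor is cancelled below.\<close>
    have c: "v0 * (v1' * w0') = v1 * (v0' * w0')" "v0 * (v1' * w1') = v1 * (v0' * w1')"
      "w0 * (v0' * w1') = w1 * (v0' * w0')" "w0 * (v1' * w1') = w1 * (v1' * w0')"
      unfolding e by (simp_all add: mult_ac)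
    have "(v0 * v1') * w0' = (v1 * v0') * w0'" "(v0 * v1') * w1' = (v1 * v0') * w1'"
      by (simp_all only: mult.assoc c)
    moreover have "v0' * (w0 * w1') = v0' * (w1 * w0')" "v1' * (w0 * w1') = v1' * (w1 * w0')"
      by (simp_all only: mult.left_commute[of v0'] mult.left_commute[of v1'] c)
    ultimately have "v0 * v1' = v1 * v0' \<and> w0 * w1' = w1 * w0'"
      using vw' by (metis mult_cancel_left mult_cancel_right)
    then show "X = X'" unfolding X X' by (intro plane_cong_proportional vw vw') auto
  next
    fix x x' X assume "Q x X" "Q x' X"
    then obtain v0 v1 w0 w1 v0' v1' w0' w1' where "plane E x 1 v0 v1 w0 w1 = plane E x' 1 v0' v1' w0' w1'"
      unfolding Q_def by metis
    from plane_eqD(1)[OF E_indep this] show "x = x'" by simp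
  qed (rule R(1))
  then show ?thesis using R(2) by simp
qed

end

subsection \<open>Flags in general position\<close>

text \<open>Over the complex numbers a nonconstant gcd has a root, which is a common root of
  \<open>p\<close> and its derivative.\<close>

lemma rsquarefree_iff_resultant:
  fixes p :: "complex poly"
  assumes "degree p > 0"
  shows "rsquarefree p \<longleftrightarrow> resultant p (pderiv p) \<noteq> 0"
proof -
  have "(\<exists>a. poly p a = 0 \<and> poly (pderiv p) a = 0) \<longleftrightarrow> degree (gcd p (pderiv p)) \<noteq> 0"
  proof
    assume "\<exists>a. poly p a = 0 \<and> poly (pderiv p) a = 0"
    then obtain a where "[:- a, 1:] dvd p" "[:- a, 1:] dvd pderiv p" by (auto simp: poly_eq_0_iff_dvd)
    then have "[:- a, 1:] dvd gcd p (pderiv p)" by simp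
    moreover have "gcd p (pderiv p) \<noteq> 0" using assms by auto
    ultimately have "degree [:- a, 1:] \<le> degree (gcd p (pderiv p))" by (rule dvd_imp_degree_le)
    then show "degree (gcd p (pderiv p)) \<noteq> 0" by simp
  next
    assume "degree (gcd p (pderiv p)) \<noteq> 0"
    then obtain a where "poly (gcd p (pderiv p)) a = 0"
      using fundamental_theorem_of_algebra[of "gcd p (pderiv p)"] by (auto simp: constant_degree)
    then have "[:- a, 1:] dvd gcd p (pderiv p)" by (simp add: poly_eq_0_iff_dvd)
    then have "[:- a, 1:] dvd p" "[:- a, 1:] dvd pderiv p" by (auto intro: dvd_trans)
    then show "\<exists>a. poly p a = 0 \<and> poly (pderiv p) a = 0" by (auto simp: poly_eq_0_iff_dvd)
  qed
  then show ?thesis unfolding rsquarefree_roots resultant_0_gcd by blast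
qed

text \<open>The Sylvester format 6, 5 is fixed regardless of the degree of \<open>p\<close>, so that
  this is one polynomial in the coefficients.\<close>

definition discr6 :: "complex poly \<Rightarrow> complex" where
  "discr6 p = det (sylvester_mat_sub 6 5 p (pderiv p))"

lemma discr6_iff:
  assumes "degree p = 6"
  shows "discr6 p \<noteq> 0 \<longleftrightarrow> rsquarefree p"
proof -
  have "degree (pderiv p) = 5" using assms by (simp add: degree_pderiv)
  then have "resultant p (pderiv p) = discr6 p"
    using assms by (simp add: resultant_def sylvester_mat_def discr6_def)
  then show ?thesis using rsquarefree_iff_resultant[of p] assms by simp
qed

definition polyfun_poly :: "'v set \<Rightarrow> (('v \<Rightarrow> 'a::comm_ring_1) \<Rightarrow> 'a poly) \<Rightarrow> bool" where
  "polyfun_poly V f \<longleftrightarrow> (\<forall>n. polyfun V (\<lambda>x. coeff (f x) n))"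

lemma polyfun_poly_const: "polyfun_poly V (\<lambda>x. p)"
  by (simp add: polyfun_poly_def pf_const)

lemma polyfun_poly_coeff: "polyfun V f \<Longrightarrow> polyfun_poly V (\<lambda>x. [:f x:])"
  unfolding polyfun_poly_def
proof
  fix n assume "polyfun V f"
  then show "polyfun V (\<lambda>x. coeff [:f x:] n)" by (cases n) (simp_all add: pf_const)
qed

lemma polyfun_poly_mult: "polyfun_poly V f \<Longrightarrow> polyfun_poly V g \<Longrightarrow> polyfun_poly V (\<lambda>x. f x * g x)"
  unfolding polyfun_poly_def coeff_mult by (intro allI polyfun_sum pf_mult) auto

lemma polyfun_poly_add: "polyfun_poly V f \<Longrightarrow> polyfun_poly V g \<Longrightarrow> polyfun_poly V (\<lambda>x. f x + g x)"
  unfolding polyfun_poly_def coeff_add by (intro allI pf_add) auto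

lemma polyfun_poly_diff: "polyfun_poly V f \<Longrightarrow> polyfun_poly V g \<Longrightarrow> polyfun_poly V (\<lambda>x. f x - g x)"
  unfolding polyfun_poly_def coeff_diff by (intro allI polyfun_diff) auto

lemma polyfun_poly_uminus: "polyfun_poly V f \<Longrightarrow> polyfun_poly V (\<lambda>x. - f x)"
  unfolding polyfun_poly_def coeff_minus by (intro allI polyfun_uminus) auto

lemma polyfun_poly_if:
  "polyfun_poly V f \<Longrightarrow> polyfun_poly V g \<Longrightarrow> polyfun_poly V (\<lambda>x. if P then f x else g x)"
  by (cases P) simp_all

lemma polyfun_if: "polyfun V f \<Longrightarrow> polyfun V g \<Longrightarrow> polyfun V (\<lambda>x. if P then f x else g x)"
  by (cases P) simp_all

lemma polyfun_poly_det3: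
  assumes "polyfun_poly V a0" "polyfun_poly V b0" "polyfun_poly V c0" "polyfun_poly V a1" "polyfun_poly V b1"
    "polyfun_poly V c1" "polyfun_poly V a2" "polyfun_poly V b2" "polyfun_poly V c2"
  shows "polyfun_poly V (\<lambda>x. det3 (a0 x) (b0 x) (c0 x) (a1 x) (b1 x) (c1 x) (a2 x) (b2 x) (c2 x))"
  unfolding det3_def by (intro polyfun_poly_mult polyfun_poly_add polyfun_poly_diff assms)

lemma polyfun_poly_sextic:
  assumes \<gamma>: "\<And>j r i. j \<in> {2, 3, 4} \<Longrightarrow> r < 3 \<Longrightarrow> i < 6 \<Longrightarrow> polyfun V (\<lambda>x. \<gamma> x j r i)"
  shows "polyfun_poly V (\<lambda>x. sextic_poly (\<gamma> x))"
proof -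
  have c: "polyfun_poly V (\<lambda>x. const_coords (\<gamma> x) j r i)" if "j \<in> {2, 3, 4}" "r < 3" "i < 6" for j r i
    unfolding const_coords_def by (intro polyfun_poly_coeff \<gamma> that)
  have t: "polyfun_poly V (\<lambda>x. tri (const_coords (\<gamma> x) j) u0 u1 v0 v1 w0 w1)" if "j \<in> {2, 3, 4}" for j u0 u1 v0 v1 w0 w1
    unfolding tri_def
    by (intro polyfun_poly_det3 polyfun_poly_mult polyfun_poly_diff polyfun_poly_const c that) simp_all
  have b: "polyfun_poly V (\<lambda>x. bil (const_coords (\<gamma> x) j) u0 u1 i)" if "j \<in> {2, 3, 4}" for j u0 u1 i
    unfolding bil_def by (intro polyfun_poly_if t that)
  have k: "polyfun_poly V (\<lambda>x. kern (const_coords (\<gamma> x)) u0 u1 i)" for u0 u1 i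
    unfolding kern_def cross4_def by (intro polyfun_poly_if polyfun_poly_det3 polyfun_poly_uminus b) simp_all
  show ?thesis unfolding sextic_poly_def sextic_def by (intro polyfun_poly_diff polyfun_poly_mult k)
qed

lemma polyfun_discr6:
  assumes "polyfun_poly V p"
  shows "polyfun V (\<lambda>x. discr6 (p x))"
proof -
  have p: "polyfun V (\<lambda>x. coeff (p x) n)" for n using assms by (simp add: polyfun_poly_def)
  show ?thesis unfolding discr6_def sylvester_mat_sub_def coeff_pderiv
  proof (rule polyfun_det)
    fix i j
    show "polyfun V (\<lambda>x. if i < 5 then if i \<le> j \<and> j - i \<le> 6 then coeff (p x) (6 + i - j) else 0
       else if i - 5 \<le> j \<and> j \<le> i then of_nat (Suc (i - j)) * coeff (p x) (Suc (i - j)) else 0)"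
      by (intro polyfun_if p pf_const pf_mult)
  qed
qed

section \<open>An adapted basis with polynomial entries\<close>

type_synonym flags = "nat \<times> nat \<times> nat \<Rightarrow> complex"

text \<open>The fourth step of the first flag with the second step of the second flag: complementary
  subspaces for flags in general position.\<close>

definition pivot :: "flags \<Rightarrow> nat \<Rightarrow> nat \<Rightarrow> complex" where
  "pivot g i l = (if i < 4 then g (0, i, l) else g (1, i - 4, l))"

text \<open>The coordinates of row \<open>m\<close> of the second flag with respect to
  \<open>pivot\<close>, multiplied by the determinant to avoid division.\<close>

definition mid_coords :: "flags \<Rightarrow> nat \<Rightarrow> nat \<Rightarrow> complex" where
  "mid_coords g m i = (\<Sum>j<6. g (1, m, j) * adj6 (pivot g) j i)"

text \<open>By Cramer's rule the vectors number 2 and 3 lie in the fourth steps of both flags.\<close>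

definition flag_basis :: "flags \<Rightarrow> nat \<Rightarrow> nat \<Rightarrow> complex" where
  "flag_basis g i l = (if i < 2 then g (0, i, l) else if i < 4 then \<Sum>k<4. mid_coords g i k * g (0, k, l)
     else g (1, i - 4, l))"

text \<open>Coordinates in the adapted basis up to the factor \<open>det6 (flag_basis g)\<close>,
  which does not change the span of the rows when it is nonzero.\<close>

definition flag_coords :: "flags \<Rightarrow> nat \<Rightarrow> nat \<Rightarrow> nat \<Rightarrow> complex" where
  "flag_coords g j r i = (\<Sum>l<6. g (j, r, l) * adj6 (flag_basis g) l i)"

lemma comb_cong_fun: "(\<And>i. i < n \<Longrightarrow> f i = f' i) \<Longrightarrow> comb n f k = comb n f' k"
  by (simp add: comb_def)

text \<open>Cramer's expansion of row \<open>m\<close>, split between the two flags. The left side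
  lies in the fourth step of the first flag, the right side involves rows 0, 1, \<open>m\<close> of
  the second; for \<open>m\<close> equal to 2 or 3 both memberships follow.\<close>

lemma mid_eq:
  assumes "l < 6"
  shows "(\<Sum>k<4. mid_coords g m k * g (0, k, l)) =
    det6 (pivot g) * g (1, m, l) - mid_coords g m 4 * g (1, 0, l) - mid_coords g m 5 * g (1, 1, l)"
proof -
  have "(\<Sum>k<4. mid_coords g m k * g (0, k, l)) + mid_coords g m 4 * g (1, 0, l) + mid_coords g m 5 * g (1, 1, l)
      = (\<Sum>i<6. mid_coords g m i * pivot g i l)"
    by (simp add: sum_lessThan_6 sum_lessThan_4 pivot_def)
  also have "\<dots> = det6 (pivot g) * g (1, m, l)"
    unfolding mid_coords_def by (rule adj6_coords[OF assms])
  finally have e: "(\<Sum>k<4. mid_coords g m k * g (0, k, l)) + mid_coords g m 4 * g (1, 0, l) + mid_coords g m 5 * g (1, 1, l)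
      = det6 (pivot g) * g (1, m, l)" .
  show ?thesis unfolding e[symmetric] by simp
qed

lemma adapted_basis_flags:
  fixes g :: flags
  assumes b: "det6 (flag_basis g) \<noteq> 0" and M: "\<And>j. j < 5 \<Longrightarrow> det6 (\<lambda>r c. g (j, r, c)) \<noteq> 0"
  shows "adapted_basis (row_vec 6 (flag_basis g)) (\<lambda>j r c. g (j, r, c)) (flag_coords g)"
proof -
  let ?E = "row_vec 6 (flag_basis g)"
  let ?R = "\<lambda>j. row_vec 6 (\<lambda>r c. g (j, r, c))"
  have rv: "row_vec 6 A i l = A i l" if "l < 6" for A i l using that by (simp add: row_vec_def)
  have R: "indep_seq 6 (?R j)" if "j < 5" for j
    by (rule det6_nonzero_indep[OF M[OF that]]) (rule rv)
  show ?thesis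
  proof
    show "indep_seq 6 ?E" by (rule det6_nonzero_indep[OF b]) (rule rv)
    show "?E i \<in> Cn 6" for i by (rule row_vec_in_Cn)
    show "indep_seq 6 (?R j)" if "j < 5" for j by (rule R[OF that])
    have mem: "?R j i \<in> row_flag 6 (\<lambda>r c. g (j, r, c)) n" if "i < n" for i j n
      using rangeI[of "comb n (?R j)" "\<lambda>k. if k = i then 1 else 0"] unfolding row_flag_eq comb_single[OF that] .
    have E0: "?E i = ?R 0 i" if "i < 2" for i using that by (auto simp: row_vec_def flag_basis_def)
    have E1: "?E (i + 4) = ?R 1 i" for i by (auto simp: row_vec_def flag_basis_def)
    have Em: "?E i = comb 4 (?R 0) (mid_coords g i)" if "i = 2 \<or> i = 3" for i
      using that by (auto simp: row_vec_def flag_basis_def comb_def)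
    \<comment> \<open>The same vector as in \<open>Em\<close>, now in terms of the rows of the
      second flag.\<close>
    have Em': "?E i = comb 4 (?R 1) (\<lambda>k. (if k = i then det6 (pivot g) else 0)
        - (if k = 0 then mid_coords g i 4 else 0) - (if k = 1 then mid_coords g i 5 else 0))" if "i = 2 \<or> i = 3" for i
    proof
      fix l
      show "?E i l = comb 4 (?R 1) (\<lambda>k. (if k = i then det6 (pivot g) else 0)
        - (if k = 0 then mid_coords g i 4 else 0) - (if k = 1 then mid_coords g i 5 else 0)) l"
      proof (cases "l < 6")
        case True
        then have "?E i l = det6 (pivot g) * g (1, i, l) - mid_coords g i 4 * g (1, 0, l) - mid_coords g i 5 * g (1, 1, l)"
          using that mid_eq[OF True, of g i] by (auto simp: row_vec_def flag_basis_def)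
        moreover have "?R 1 k l = g (1, k, l)" for k using True by (simp add: row_vec_def)
        ultimately show ?thesis unfolding comb_def sum_lessThan_4 using that
          by (elim disjE) simp_all
      qed (simp add: row_vec_def comb_def)
    qed
    show "?E i \<in> row_flag 6 (\<lambda>r c. g (0, r, c)) 2" if "i < 2" for i
      unfolding E0[OF that] by (rule mem[OF that])
    show "?E i \<in> row_flag 6 (\<lambda>r c. g (0, r, c)) 4" if "i < 4" for i
    proof (cases "i < 2")
      case True
      show ?thesis unfolding E0[OF True] by (rule mem) (use that in simp)
    next
      case False
      then have "i = 2 \<or> i = 3" using that by linarith
      then show ?thesis unfolding row_flag_eq Em[OF \<open>i = 2 \<or> i = 3\<close>] by simp
    qed
    show "?E (i + 4) \<in> row_flag 6 (\<lambda>r c. g (1, r, c)) 2" if "i < 2" for i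
      unfolding E1 by (rule mem[OF that])
    show "?E (i + 2) \<in> row_flag 6 (\<lambda>r c. g (1, r, c)) 4" if "i < 4" for i
    proof (cases "i < 2")
      case True
      then have i: "i + 2 = 2 \<or> i + 2 = 3" by linarith
      show ?thesis unfolding row_flag_eq Em'[OF i] by (rule rangeI)
    next
      case False
      then have "i + 2 = (i - 2) + 4" by linarith
      then have "?E (i + 2) = ?R 1 (i - 2)" using E1[of "i - 2"] by simp
      then show ?thesis using mem[of "i - 2" 4 1] that by simp
    qed
    show "row_flag 6 (\<lambda>r c. g (j, r, c)) 3 = range (comb 3 (\<lambda>r. comb 6 ?E (flag_coords g j r)))"
      if "j \<in> {2, 3, 4}" for j
    proof -
      have j: "j < 5" using that by auto
      have R3: "indep_seq 3 (?R j)" by (rule indep_seq_mono[OF R[OF j]]) simp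
      define D where "D = det6 (flag_basis g)"
      \<comment> \<open>The coordinates built with the adjugate reproduce the row \<open>r\<close>
        scaled by \<open>D\<close>.\<close>
      have e: "comb 6 ?E (flag_coords g j r) = comb 3 (?R j) (\<lambda>k. if k = r then D else 0)" if "r < 3" for r
      proof
        fix l
        show "comb 6 ?E (flag_coords g j r) l = comb 3 (?R j) (\<lambda>k. if k = r then D else 0) l"
        proof (cases "l < 6")
          case True
          have "comb 6 ?E (flag_coords g j r) l = (\<Sum>i<6. flag_coords g j r i * flag_basis g i l)"
            using True by (simp add: comb_def row_vec_def)
          also have "\<dots> = D * g (j, r, l)"
            unfolding flag_coords_def D_def by (rule adj6_coords[OF True])
          also have "\<dots> = (\<Sum>k<3. if k = r then D * g (j, k, l) else 0)" using that by simp
          also have "\<dots> = comb 3 (?R j) (\<lambda>k. if k = r then D else 0) l"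
            unfolding comb_def by (rule sum.cong) (use True in \<open>auto simp: row_vec_def\<close>)
          finally show ?thesis .
        qed (simp add: comb_def row_vec_def)
      qed
      show ?thesis unfolding row_flag_eq
      proof (rule range_comb_eq)
        show "comb 6 ?E (flag_coords g j r) \<in> range (comb 3 (?R j))" if "r < 3" for r
          unfolding e[OF that] by (rule rangeI)
        show "indep_seq 3 (\<lambda>r. comb 6 ?E (flag_coords g j r))"
          unfolding indep_seq_def
        proof (intro allI impI)
          fix h i assume z: "comb 3 (\<lambda>r. comb 6 ?E (flag_coords g j r)) h = 0" and i: "i < (3::nat)"
          have "comb 3 (\<lambda>r. comb 6 ?E (flag_coords g j r)) h =
              comb 3 (\<lambda>r. comb 3 (?R j) (\<lambda>k. if k = r then D else 0)) h"
            by (rule comb_cong_fun) (rule e)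
          then have "comb 3 (?R j) (\<lambda>k. \<Sum>r<3. h r * (if k = r then D else 0)) = 0"
            using z by (simp only: comb_comb)
          from indep_seqD[OF R3 this i] have "(\<Sum>r<3. h r * (if i = r then D else 0)) = 0" .
          moreover have "(\<Sum>r<3. h r * (if i = r then D else 0)) = (\<Sum>r<3. if i = r then h r * D else 0)"
            by (rule sum.cong) auto
          ultimately have "h i * D = 0" using i by simp
          then show "h i = 0" using b by (simp add: D_def)
        qed
      qed
    qed
  qed
qed

text \<open>Its factors ensure in turn that the adapted basis is a basis, that no solution has u1 =
  0, and that the six roots are simple.\<close>

definition genericity :: "flags \<Rightarrow> complex" where
  "genericity g = det6 (flag_basis g) *
     (coeff (sextic_poly (flag_coords g)) 6 * discr6 (sextic_poly (flag_coords g)))"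

definition flag_vars :: "(nat \<times> nat \<times> nat) set" where
  "flag_vars = {(j, r, c). j < 5 \<and> r < 6 \<and> c < 6}"

lemma polyfun_flag_var: "j < 5 \<Longrightarrow> r < 6 \<Longrightarrow> c < 6 \<Longrightarrow> polyfun flag_vars (\<lambda>g. g (j, r, c))"
  by (rule pf_var) (simp add: flag_vars_def)

lemma polyfun_pivot:
  assumes "i < 6" "l < 6"
  shows "polyfun flag_vars (\<lambda>g. pivot g i l)"
  unfolding pivot_def by (intro polyfun_if polyfun_flag_var) (use assms in auto)

lemma polyfun_mid_coords:
  assumes "m < 6" "i < 6"
  shows "polyfun flag_vars (\<lambda>g. mid_coords g m i)"
  unfolding mid_coords_def
  by (intro polyfun_sum pf_mult polyfun_flag_var polyfun_adj6 polyfun_pivot) (use assms in auto)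

lemma polyfun_flag_basis:
  assumes "i < 6" "l < 6"
  shows "polyfun flag_vars (\<lambda>g. flag_basis g i l)"
  unfolding flag_basis_def
  by (intro polyfun_if polyfun_sum pf_mult polyfun_flag_var polyfun_mid_coords) (use assms in auto)

lemma polyfun_flag_coords:
  assumes "j < 5" "r < 6" "i < 6"
  shows "polyfun flag_vars (\<lambda>g. flag_coords g j r i)"
  unfolding flag_coords_def
  by (intro polyfun_sum pf_mult polyfun_flag_var polyfun_adj6 polyfun_flag_basis) (use assms in auto)

lemma polyfun_genericity: "polyfun flag_vars genericity"
proof -
  have p: "polyfun_poly flag_vars (\<lambda>g. sextic_poly (flag_coords g))"
    by (rule polyfun_poly_sextic) (auto intro: polyfun_flag_coords)
  have c: "polyfun flag_vars (\<lambda>g. coeff (sextic_poly (flag_coords g)) 6)"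
    using p by (simp add: polyfun_poly_def)
  have d: "polyfun flag_vars (\<lambda>g. det6 (flag_basis g))"
    by (rule polyfun_det6) (rule polyfun_flag_basis)
  have "polyfun flag_vars (\<lambda>g. det6 (flag_basis g) *
     (coeff (sextic_poly (flag_coords g)) 6 * discr6 (sextic_poly (flag_coords g))))"
    by (intro pf_mult d c polyfun_discr6 p)
  then show ?thesis unfolding genericity_def[abs_def] .
qed

lemma degree_sextic_poly:
  assumes "coeff (sextic_poly \<gamma>) 6 \<noteq> (0 :: 'a::comm_ring_1)"
  shows "degree (sextic_poly \<gamma>) = 6"
  using top_coeff_sextic[of \<gamma>] le_degree[OF assms] by (simp add: top_coeff_def)

text \<open>Each of the three conditions of the example is the product of a linear and a bilinear form,
  so that the sextic splits into linear factors.\<close>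

definition ex_coords :: "nat \<Rightarrow> nat \<Rightarrow> nat \<Rightarrow> complex" where
  "ex_coords j r i =
     (if j = 2 then
        (if r = 0 then (if i = 4 then 3 else if i = 5 then 1 else 0)
         else if r = 1 then (if i = 0 \<or> i = 2 then 1 else 0) else (if i = 1 \<or> i = 3 then 1 else 0))
      else if j = 3 then
        (if r = 0 then (if i = 4 then - 1 else if i = 5 then 1 else 0)
         else if r = 1 then (if i = 0 \<or> i = 3 then 1 else 0) else (if i = 1 then 1 else if i = 2 then 4 else 0))
      else
        (if r = 0 then (if i = 2 \<or> i = 3 then 1 else 0)
         else if r = 1 then (if i = 0 \<or> i = 4 then 1 else 0) else (if i = 1 \<or> i = 5 then 1 else 0)))"

text \<open>Later rows of the flags other than the first repeat earlier ones, so these are not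
  complete flags. The point only has to make \<open>genericity\<close> nonzero; invertibility of the
  matrices is a second nonzero polynomial, to be combined with it.\<close>

definition ex_flags :: flags where
  "ex_flags = (\<lambda>(j, r, c). if j = 0 then (if r = c then 1 else 0)
     else if j = 1 then (if c = (if r = 0 then 4 else if r = 1 then 5 else r) then 1 else 0)
     else ex_coords j r c)"

lemma tri_ex_coords:
  "tri (ex_coords 2) u0 u1 v0 v1 w0 w1 = (3 * w1 - w0) * (u0 * v1 - u1 * v0)"
  "tri (ex_coords 3) u0 u1 v0 v1 w0 w1 = (w0 + w1) * (u0 * v0 - 4 * u1 * v1)"
  "tri (ex_coords 4) u0 u1 v0 v1 w0 w1 = (v0 - v1) * (u0 * w1 - u1 * w0)"
  by (simp_all add: tri_def det3_def ex_coords_def algebra_simps)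

text \<open>A root comes from choosing which factor vanishes in each condition. For instance w0 = 3
  w1, u0 v0 = 4 u1 v1, v0 = v1 give the ratio 4; the compatible choices yield 4, 3, 1, -1 and the
  pair 2, -2.\<close>

lemma sextic_ex_coords:
  "\<exists>c. c \<noteq> 0 \<and> (\<forall>u0 u1. sextic ex_coords u0 u1 =
     c * ((u0 - 4 * u1) * (u0 - 3 * u1) * (u0 - u1) * (u0 + u1) * (u0 - 2 * u1) * (u0 + 2 * u1)))"
  unfolding sextic_def kern_def cross4_def bil_def tri_ex_coords det3_def
  \<comment> \<open>The constant is the value of the sextic at (1, 0).\<close>
  by (rule exI[of _ "- 4"]) (simp add: algebra_simps)

lemma rsquarefree_sextic_ex:
  "coeff (sextic_poly ex_coords) 6 \<noteq> 0 \<and> rsquarefree (sextic_poly ex_coords)"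
proof -
  let ?p = "sextic_poly ex_coords"
  obtain c where c: "c \<noteq> 0" and s: "\<And>u0 u1. sextic ex_coords u0 u1 =
     c * ((u0 - 4 * u1) * (u0 - 3 * u1) * (u0 - u1) * (u0 + u1) * (u0 - 2 * u1) * (u0 + 2 * u1))"
    using sextic_ex_coords by blast
  have top: "coeff ?p 6 \<noteq> 0" using top_coeff_sextic[of ex_coords] c by (simp add: top_coeff_def s)
  have "{x. poly ?p x = 0} = {4, 3, 1, - 1, 2, - 2}"
    unfolding poly_sextic s using c by (auto simp: add_eq_0_iff2)
  then have "card {x. poly ?p x = 0} = 6" by simp
  moreover have "?p \<noteq> 0" using top by auto
  ultimately show ?thesis
    using top rsquarefree_card_degree[of ?p] degree_sextic_poly[OF top] by simp
qed

lemma sextic_poly_cong: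
  assumes "\<And>j r i. j \<in> {2, 3, 4} \<Longrightarrow> r < 3 \<Longrightarrow> i < 6 \<Longrightarrow> \<gamma> j r i = \<gamma>' j r i"
  shows "sextic_poly \<gamma> = sextic_poly \<gamma>'"
proof -
  have c: "const_coords \<gamma> j r i = const_coords \<gamma>' j r i" if "j \<in> {2, 3, 4}" "r < 3" "i < 6" for j r i
    unfolding const_coords_def assms[OF that] ..
  have t: "tri (const_coords \<gamma> j) = tri (const_coords \<gamma>' j)" if "j \<in> {2, 3, 4}" for j
    unfolding tri_def[abs_def] by (simp add: c[OF that])
  have b: "bil (const_coords \<gamma> j) = bil (const_coords \<gamma>' j)" if "j \<in> {2, 3, 4}" for j
    unfolding bil_def[abs_def] t[OF that] ..
  show ?thesis unfolding sextic_poly_def sextic_def kern_def by (simp add: b)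
qed

lemma mat6_cong:
  assumes "\<And>i j. i < 6 \<Longrightarrow> j < 6 \<Longrightarrow> R i j = R' i j"
  shows "mat6 R = mat6 R'"
  unfolding mat6_def by (rule cong_mat) (simp_all add: assms)

text \<open>The rows are arranged so that \<open>pivot\<close> and \<open>flag_basis\<close> are
  both the identity matrix; hence \<open>flag_coords\<close> returns \<open>ex_coords\<close>
  unchanged.\<close>

lemma genericity_ex_flags: "genericity ex_flags \<noteq> 0"
proof -
  let ?I = "\<lambda>i j :: nat. if i = j then 1 else 0 :: complex"
  have ex0: "ex_flags (0, r, c) = ?I r c" for r c by (simp add: ex_flags_def)
  have "pivot ex_flags i l = ?I i l" if "i < 6" "l < 6" for i l
  proof -
    have "i < 4 \<or> i = 4 \<or> i = 5" using that by linarith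
    then show ?thesis by (auto simp: pivot_def ex_flags_def)
  qed
  then have adj: "adj6 (pivot ex_flags) i j = ?I i j" if "i < 6" "j < 6" for i j
    using mat6_cong[of "pivot ex_flags" ?I] adj6_id[OF that] by (simp add: adj6_def)
  have mid: "mid_coords ex_flags m i = ?I m i" if "m = 2 \<or> m = 3" "i < 6" for m i
  proof -
    have "mid_coords ex_flags m i = (\<Sum>j<6. if j = i then ex_flags (1, m, j) else 0)"
      unfolding mid_coords_def by (rule sum.cong) (use that in \<open>auto simp: adj\<close>)
    then show ?thesis using that by (auto simp: ex_flags_def)
  qed
  have basis: "flag_basis ex_flags i l = ?I i l" if "i < 6" "l < 6" for i l
  proof -
    have "i < 2 \<or> i = 2 \<or> i = 3 \<or> i = 4 \<or> i = 5" using that by linarith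
    then show ?thesis
      by (elim disjE) (auto simp: flag_basis_def ex0 sum_lessThan_4 mid, auto simp: ex_flags_def)
  qed
  then have m: "mat6 (flag_basis ex_flags) = mat6 ?I" by (rule mat6_cong)
  then have adj': "adj6 (flag_basis ex_flags) i j = ?I i j" if "i < 6" "j < 6" for i j
    using adj6_id[OF that] by (simp add: adj6_def)
  have det: "det6 (flag_basis ex_flags) = 1" using m det6_id by (simp add: det6_def)
  have "flag_coords ex_flags j r i = ex_coords j r i" if "j \<in> {2, 3, 4}" "r < 3" "i < 6" for j r i
  proof -
    have "flag_coords ex_flags j r i = (\<Sum>l<6. if l = i then ex_flags (j, r, l) else 0)"
      unfolding flag_coords_def by (rule sum.cong) (use that in \<open>auto simp: adj'\<close>)
    then show ?thesis using that by (auto simp: ex_flags_def)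
  qed
  then have p: "sextic_poly (flag_coords ex_flags) = sextic_poly ex_coords" by (rule sextic_poly_cong)
  show ?thesis unfolding genericity_def p det
    using rsquarefree_sextic_ex discr6_iff[OF degree_sextic_poly] by simp
qed

section \<open>The generic number of points\<close>

lemma invertible_mat_iff: "indep_seq 6 (row_vec 6 A) \<Longrightarrow> Defs.invertible_mat 6 A"
  using dim_range_comb[of 6 "row_vec 6 A"] by (simp add: Defs.invertible_mat_def row_flag_eq[unfolded row_flag_def])

lemma generic_count_iff: "generic_count 3 3 schubert_data d \<longleftrightarrow>
    (\<exists>F. polyfun flag_vars F \<and> F \<noteq> (\<lambda>_. 0) \<and>
      (\<forall>g :: flags. (\<forall>j<5. Defs.invertible_mat 6 (\<lambda>r c. g (j, r, c))) \<and> F g \<noteq> 0 \<longrightarrow>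
        finite (schubert_inter 3 3 schubert_data (\<lambda>j. row_flag 6 (\<lambda>r c. g (j, r, c)))) \<and>
        card (schubert_inter 3 3 schubert_data (\<lambda>j. row_flag 6 (\<lambda>r c. g (j, r, c)))) = d))"
proof -
  have l: "length schubert_data = 5" "3 + 3 = (6 :: nat)" by simp_all
  show ?thesis unfolding generic_count_def l Let_def flag_vars_def ..
qed

lemma exists_all_det6_nonzero: "\<exists>g :: flags. (\<Prod>j<5. det6 (\<lambda>r c. g (j, r, c))) \<noteq> 0"
  by (rule exI[of _ "\<lambda>(j, r, c). if r = c then 1 else 0"]) (simp add: det6_id)

lemma polyfun_all_det6: "polyfun flag_vars (\<lambda>g. \<Prod>j<5. det6 (\<lambda>r c. g (j, r, c)))"
  by (intro polyfun_prod polyfun_det6 polyfun_flag_var) auto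

text \<open>The product of determinants expresses independence of all rows as a polynomial
  condition. It is nonzero at one point and \<open>genericity\<close> at another, and the line
  argument gives a common one.\<close>

lemma generic_count_schubert_data: "generic_count 3 3 schubert_data 6"
proof -
  define F where "F = (\<lambda>g :: flags. (\<Prod>j<5. det6 (\<lambda>r c. g (j, r, c))) * genericity g)"
  obtain g0 :: flags where "(\<Prod>j<5. det6 (\<lambda>r c. g0 (j, r, c))) \<noteq> 0"
    using exists_all_det6_nonzero by blast
  then obtain g1 where g1: "F g1 \<noteq> 0"
    using polyfun_common_nonzero[OF polyfun_all_det6 polyfun_genericity _ genericity_ex_flags] unfolding F_def by blast
  have "polyfun flag_vars F" unfolding F_def by (rule pf_mult[OF polyfun_all_det6 polyfun_genericity])
  moreover have "F \<noteq> (\<lambda>_. 0)" using g1 by auto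
  moreover have "finite S \<and> card S = 6"
    if g: "F g \<noteq> 0" and S: "S = schubert_inter 3 3 schubert_data (\<lambda>j. row_flag 6 (\<lambda>r c. g (j, r, c)))" for g S
  proof -
    have M: "det6 (\<lambda>r c. g (j, r, c)) \<noteq> 0" if "j < 5" for j
      using g that by (auto simp: F_def)
    have G: "det6 (flag_basis g) \<noteq> 0" "coeff (sextic_poly (flag_coords g)) 6 \<noteq> 0"
      "discr6 (sextic_poly (flag_coords g)) \<noteq> 0" using g by (auto simp: F_def genericity_def)
    interpret adapted_basis "row_vec 6 (flag_basis g)" "\<lambda>j r c. g (j, r, c)" "flag_coords g"
      by (rule adapted_basis_flags[OF G(1) M])
    show ?thesis unfolding S
      by (rule card_schubert_inter) (use G discr6_iff[OF degree_sextic_poly[OF G(2)]] in auto)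
  qed
  ultimately show ?thesis unfolding generic_count_iff by blast
qed

text \<open>Justifies the definite description in \<open>dnum\<close>: the exceptional polynomials
  of two counts and the determinants are simultaneously nonzero at some tuple of flags, where both
  counts apply.\<close>

lemma generic_count_unique:
  assumes "generic_count 3 3 schubert_data d"
  shows "d = 6"
proof -
  obtain F where F: "polyfun flag_vars F" "F \<noteq> (\<lambda>_. 0)"
    and Fc: "\<And>g. \<forall>j<5. Defs.invertible_mat 6 (\<lambda>r c. g (j, r, c)) \<Longrightarrow> F g \<noteq> 0 \<Longrightarrow>
      card (schubert_inter 3 3 schubert_data (\<lambda>j. row_flag 6 (\<lambda>r c. g (j, r, c)))) = d"
    using assms unfolding generic_count_iff by blast
  obtain G where G: "polyfun flag_vars G" "G \<noteq> (\<lambda>_. 0)"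
    and Gc: "\<And>g. \<forall>j<5. Defs.invertible_mat 6 (\<lambda>r c. g (j, r, c)) \<Longrightarrow> G g \<noteq> 0 \<Longrightarrow>
      card (schubert_inter 3 3 schubert_data (\<lambda>j. row_flag 6 (\<lambda>r c. g (j, r, c)))) = 6"
    using generic_count_schubert_data unfolding generic_count_iff by blast
  obtain g0 :: flags where g0: "(\<Prod>j<5. det6 (\<lambda>r c. g0 (j, r, c))) \<noteq> 0"
    using exists_all_det6_nonzero by blast
  obtain g1 g2 where "F g1 \<noteq> 0" "G g2 \<noteq> 0" using F(2) G(2) by (auto simp: fun_eq_iff)
  then obtain g3 where "F g3 * G g3 \<noteq> 0" using polyfun_common_nonzero[OF F(1) G(1)] by blast
  then obtain g where g: "F g * G g * (\<Prod>j<5. det6 (\<lambda>r c. g (j, r, c))) \<noteq> 0"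
    using polyfun_common_nonzero[OF pf_mult[OF F(1) G(1)] polyfun_all_det6 _ g0] by blast
  have "Defs.invertible_mat 6 (\<lambda>r c. g (j, r, c))" if "j < 5" for j
  proof -
    have "det6 (\<lambda>r c. g (j, r, c)) \<noteq> 0" using g that by auto
    then show ?thesis by (intro invertible_mat_iff det6_nonzero_indep) (simp_all add: row_vec_def)
  qed
  then show ?thesis using Fc[of g] Gc[of g] g by auto
qed

lemma dnum_schubert_data: "dnum 3 3 schubert_data = 6"
  unfolding dnum_def by (rule the_equality) (rule generic_count_schubert_data, rule generic_count_unique)

subsection \<open>The polynomial system of the osculating flags\<close>

lemma real_quadratic_two_roots:
  fixes a b c :: real
  assumes "a > 0" "b\<^sup>2 - 4 * a * c > 0"
  obtains x1 x2 where "x1 < x2" "b = - a * (x1 + x2)" "c = a * (x1 * x2)"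
proof
  let ?r = "sqrt (b\<^sup>2 - 4 * a * c)"
  have r: "?r > 0" "?r\<^sup>2 = b\<^sup>2 - 4 * a * c" using assms(2) by simp_all
  show "(- b - ?r) / (2 * a) < (- b + ?r) / (2 * a)"
    using assms(1) r(1) by (intro divide_strict_right_mono) auto
  show "b = - a * ((- b - ?r) / (2 * a) + (- b + ?r) / (2 * a))"
    using assms(1) by (simp add: field_simps)
  have "(- b - ?r) / (2 * a) * ((- b + ?r) / (2 * a)) = (b\<^sup>2 - ?r\<^sup>2) / (4 * a\<^sup>2)"
    by (simp add: field_simps power2_eq_square)
  also have "\<dots> = c / a" unfolding r(2) using assms(1) by (simp add: field_simps power2_eq_square)
  finally show "c = a * ((- b - ?r) / (2 * a) * ((- b + ?r) / (2 * a)))"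
    using assms(1) by simp
qed

text \<open>With 3x + 15z taken from the first equation, the second gives 3xz = 3 y^2 - 4 e1 y + 4
  e2; multiplied by y and compared with xyz = e3, this is the cubic.\<close>

definition osc_cubic :: "'a::comm_ring_1 \<Rightarrow> 'a \<Rightarrow> 'a \<Rightarrow> 'a \<Rightarrow> 'a" where
  "osc_cubic e1 e2 e3 y = 3 * y ^ 3 - 4 * e1 * y\<^sup>2 + 4 * e2 * y - 3 * e3"

text \<open>The cubic is four times the product of the y - r_j, minus y^3, plus r1 r2 r3. Its values
  at r1, r3 and 0 therefore have evident signs, and the number of negative r_j decides which two of
  these points serve.\<close>

lemma osc_cubic_sign_change:
  fixes r1 r2 r3 :: real
  assumes "r1 < r2" "r2 < r3" "r1 \<noteq> 0" "r2 \<noteq> 0" "r3 \<noteq> 0"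
  defines "q \<equiv> osc_cubic (r1 + r2 + r3) (r1 * r2 + r1 * r3 + r2 * r3) (r1 * r2 * r3)"
  obtains s t where "s < t" "q s > 0" "q t < 0"
proof -
  have q1: "q r1 = r1 * (r2 * r3 - r1 * r1)" and q3: "q r3 = r3 * (r1 * r2 - r3 * r3)"
    and q0: "q 0 = - 3 * (r1 * (r2 * r3))"
    by (simp_all add: q_def osc_cubic_def algebra_simps power2_eq_square power3_eq_cube)
  consider "0 < r1" | "r1 < 0" "0 < r2" | "r2 < 0" "0 < r3" | "r3 < 0" using assms by linarith
  then show ?thesis
  proof cases
    case 1
    then have "r1 * r1 < r2 * r3" "r1 * r2 < r3 * r3"
      using assms by (auto intro!: mult_strict_mono)
    then have "q r1 > 0" "q r3 < 0" using 1 assms unfolding q1 q3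
      by (auto intro!: mult_pos_neg)
    then show ?thesis using that[of r1 r3] assms by linarith
  next
    case 2
    then have "r2 * r3 > 0" "r1 * r2 < 0" using assms by (auto intro!: mult_neg_pos)
    then have "r1 * (r2 * r3) < 0" "r1 * r2 - r3 * r3 < 0"
      using 2 by (auto intro!: mult_neg_pos simp: not_sum_squares_lt_zero add_nonneg_pos diff_less_0_iff_less)
         (smt (verit) zero_le_square)
    then have "q 0 > 0" "q r3 < 0" using 2 assms unfolding q0 q3 by (auto intro!: mult_pos_neg)
    then show ?thesis using that[of 0 r3] 2 assms by linarith
  next
    case 3
    then have "r2 * r3 < 0" "r1 * (r2 * r3) > 0"
      using assms by (auto intro!: mult_neg_pos mult_neg_neg)
    moreover have "r2 * r3 - r1 * r1 < 0" using calculation by (smt (verit) zero_le_square)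
    ultimately have "q r1 > 0" "q 0 < 0" using 3 assms unfolding q0 q1 by (auto intro!: mult_neg_neg)
    then show ?thesis using that[of r1 0] 3 assms by linarith
  next
    case 4
    have "(- r2) * (- r3) < (- r1) * (- r1)" "(- r3) * (- r3) < (- r1) * (- r2)"
      using 4 assms by (intro mult_strict_mono; simp)+
    then have "q r1 > 0" "q r3 < 0" using 4 assms unfolding q1 q3
      by (auto intro!: mult_neg_neg mult_neg_pos)
    then show ?thesis using that[of r1 r3] assms by linarith
  qed
qed

text \<open>Only the middle root is taken from the intermediate value theorem. The remaining
  quadratic factor is negative at s and at t, so its two roots enclose both points.\<close>

lemma osc_cubic_three_roots:
  fixes e1 e2 e3 s t :: real
  assumes "s < t" "osc_cubic e1 e2 e3 s > 0" "osc_cubic e1 e2 e3 t < 0"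
  obtains y1 y2 y3 where "y1 < y2" "y2 < y3"
    "4 * e1 = 3 * (y1 + y2 + y3)" "4 * e2 = 3 * (y1 * y2 + y1 * y3 + y2 * y3)" "e3 = y1 * y2 * y3"
proof -
  have cont: "continuous_on {s..t} (osc_cubic e1 e2 e3)"
    unfolding osc_cubic_def by (intro continuous_intros)
  from IVT2'[OF _ _ _ cont, of 0] assms obtain y where
    y: "s \<le> y" "y \<le> t" "osc_cubic e1 e2 e3 y = 0" by force
  have y': "s < y" "y < t" using y assms by (metis less_le less_irrefl)+
  define b where "b = 3 * y - 4 * e1"
  define c where "c = 3 * y\<^sup>2 - 4 * e1 * y + 4 * e2"
  have e3: "3 * e3 = c * y" using y(3)
    by (simp add: osc_cubic_def c_def algebra_simps power2_eq_square power3_eq_cube)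
  have Q: "osc_cubic e1 e2 e3 w = (w - y) * (3 * w\<^sup>2 + b * w + c)" for w
    unfolding osc_cubic_def e3
    by (simp add: b_def c_def algebra_simps power2_eq_square power3_eq_cube)
  have Qs: "3 * s\<^sup>2 + b * s + c < 0" and Qt: "3 * t\<^sup>2 + b * t + c < 0"
    using assms(2,3) y' unfolding Q by (auto simp: zero_less_mult_iff mult_less_0_iff)
  \<comment> \<open>Completing the square at s: a quadratic with positive leading coefficient and a
    negative value has positive discriminant.\<close>
  have "b\<^sup>2 - 4 * 3 * c = (6 * s + b)\<^sup>2 - 12 * (3 * s\<^sup>2 + b * s + c)"
    by (simp add: algebra_simps power2_eq_square)
  also have "\<dots> > 0" using Qs by (smt (verit) zero_le_power2)
  finally obtain x1 x2 where x: "x1 < x2" "b = - 3 * (x1 + x2)" "c = 3 * (x1 * x2)"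
    using real_quadratic_two_roots[of 3 b c] by auto
  have F: "3 * w\<^sup>2 + b * w + c = 3 * ((w - x1) * (w - x2))" for w
    unfolding x by (simp add: algebra_simps power2_eq_square)
  have "x1 < s" using Qs x(1) unfolding F by (auto simp: mult_less_0_iff)
  moreover have "t < x2" using Qt x(1) unfolding F by (auto simp: mult_less_0_iff)
  moreover have "4 * e1 = 3 * (x1 + y + x2)" using x(2) by (simp add: b_def)
  moreover have "4 * e2 = 3 * (x1 * y + x1 * x2 + y * x2)"
  proof -
    have "4 * e2 = c - 3 * y\<^sup>2 + 4 * e1 * y" by (simp add: c_def)
    also have "\<dots> = 3 * (x1 * y + x1 * x2 + y * x2)"
      unfolding x(3) \<open>4 * e1 = _\<close> by (simp add: algebra_simps power2_eq_square)
    finally show ?thesis .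
  qed
  moreover have "e3 = x1 * y * x2" using e3 x(3) by simp
  ultimately show ?thesis using that[of x1 y x2] y' by auto
qed

text \<open>The expression is the discriminant of \<open>osc_quad\<close> divided by -16, so its
  sign makes x and z real and the two solutions for each y distinct.\<close>

lemma osc_quadratic_disc:
  fixes r1 r2 r3 y :: real
  assumes r: "r1 \<noteq> r2" "r1 \<noteq> 0" "r2 \<noteq> 0" "r3 \<noteq> 0"
  defines "e1 \<equiv> r1 + r2 + r3" and "e2 \<equiv> r1 * r2 + r1 * r3 + r2 * r3"
  assumes q: "osc_cubic e1 e2 (r1 * r2 * r3) y = 0"
  shows "9 * y\<^sup>2 - 9 * e1 * y - 4 * e1\<^sup>2 + 15 * e2 < 0"
proof -
  \<comment> \<open>The cubic equation is linear in \<open>r3\<close>; eliminating \<open>r3\<close> leaves a polynomial in \<open>y\<close>, \<open>r1\<close>, \<open>r2\<close>.\<close>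
  define a where "a = r1 + r2"
  define b where "b = r1 * r2"
  define d where "d = 4 * y\<^sup>2 - 4 * a * y + 3 * b"
  define t where "t = 4 * a * y - 3 * (b + y\<^sup>2)"
  define D where "D = 9 * y\<^sup>2 - 9 * e1 * y - 4 * e1\<^sup>2 + 15 * e2"
  have b0: "b \<noteq> 0" using r by (simp add: b_def)
  have ab: "a\<^sup>2 - 4 * b > 0"
  proof -
    have "a\<^sup>2 - 4 * b = (r1 - r2)\<^sup>2" by (simp add: a_def b_def power2_eq_square algebra_simps)
    then show ?thesis using r by simp
  qed
  have e: "e1 = a + r3" "e2 = b + a * r3" "r1 * r2 * r3 = b * r3"
    by (simp_all add: e1_def e2_def a_def b_def algebra_simps)
  have n: "r3 * d = 3 * y ^ 3 - 4 * a * y\<^sup>2 + 4 * b * y"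
    using q unfolding osc_cubic_def e d_def
    by (simp add: algebra_simps power2_eq_square power3_eq_cube)
  have y0: "y \<noteq> 0"
  proof
    assume "y = 0"
    then have "b * r3 = 0" using q unfolding osc_cubic_def e by simp
    then show False using b0 r by simp
  qed
  \<comment> \<open>If the coefficient of r3 vanished, so would the other side; then b = y^2 and a =
    7/4 y, contradicting a^2 > 4b.\<close>
  have d0: "d \<noteq> 0"
  proof
    assume d: "d = 0"
    have "y * (b - y\<^sup>2) = r3 * d - y * d"
      unfolding n by (simp add: d_def algebra_simps power2_eq_square power3_eq_cube)
    then have by2: "b = y\<^sup>2" using d y0 by simp
    have "y * (7 * y - 4 * a) = d" by (simp add: d_def by2 algebra_simps power2_eq_square)
    then have a: "a = 7 / 4 * y" using d y0 by simp
    then have "a\<^sup>2 - 4 * b = - (15 / 16 * y\<^sup>2)"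
      unfolding a by2 by (simp add: power2_eq_square)
    moreover have "15 / 16 * y\<^sup>2 \<ge> 0" by simp
    ultimately show False using ab by linarith
  qed
  \<comment> \<open>Every r3 is paired with a factor d, so that the linear equation for r3 d can be
    substituted without dividing.\<close>
  have "D * d\<^sup>2 = (9 * y\<^sup>2 + 15 * b) * d\<^sup>2 - 9 * y * d * (a * d + r3 * d) - 4 * (a * d + r3 * d)\<^sup>2
      + 15 * a * d * (r3 * d)"
    unfolding D_def e by (simp add: algebra_simps power2_eq_square)
  then have "- (4 * (D * d\<^sup>2)) = (2 * b * y + a * t)\<^sup>2 + 15 * t\<^sup>2 * (a\<^sup>2 - 4 * b)"
    unfolding n unfolding d_def t_def
    by (simp add: algebra_simps power2_eq_square power3_eq_cube)
  \<comment> \<open>The two terms cannot vanish together: at t = 0 the first square is that of 2by,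
    which is nonzero.\<close>
  moreover have "(2 * b * y + a * t)\<^sup>2 + 15 * t\<^sup>2 * (a\<^sup>2 - 4 * b) > 0"
  proof (cases "t = 0")
    case True then show ?thesis using b0 y0 by simp
  next
    case False
    then have "15 * t\<^sup>2 * (a\<^sup>2 - 4 * b) > 0" using ab by simp
    then show ?thesis by (smt (verit) zero_le_power2)
  qed
  ultimately have "D * d\<^sup>2 < 0" by linarith
  then show ?thesis unfolding D_def[symmetric] by (auto simp: mult_less_0_iff)
qed

text \<open>The quadratic whose roots are x and 5z.\<close>

definition osc_quad :: "'a::comm_ring_1 \<Rightarrow> 'a \<Rightarrow> 'a \<Rightarrow> 'a \<Rightarrow> 'a" where
  "osc_quad e1 e2 y x = 3 * x\<^sup>2 - (8 * e1 - 6 * y) * x + 5 * (3 * y\<^sup>2 - 4 * e1 * y + 4 * e2)"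

text \<open>The unknowns are the ratios u1 / u0, v1 / v0 and w1 / w0.\<close>

definition osc_system :: "complex \<Rightarrow> complex \<Rightarrow> complex \<Rightarrow> (complex \<times> complex \<times> complex) set" where
  "osc_system e1 e2 e3 = {(x, y, z). 3 * x + 6 * y + 15 * z = 8 * e1 \<and>
     3 * (x * y) + 6 * (x * z) + 15 * (y * z) = 8 * e2 \<and> x * y * z = e3}"

text \<open>A triangular form of the system: a cubic for y, then a quadratic for x, then z
  linearly.\<close>

lemma osc_system_iff:
  assumes "e3 \<noteq> 0"
  shows "(x, y, z) \<in> osc_system e1 e2 e3 \<longleftrightarrow> osc_cubic e1 e2 e3 y = 0 \<and>
    15 * z = 8 * e1 - 6 * y - 3 * x \<and> osc_quad e1 e2 y x = 0" (is "?L \<longleftrightarrow> ?R")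
proof
  assume ?L
  then have E: "3 * x + 6 * y + 15 * z = 8 * e1" "3 * (x * y) + 6 * (x * z) + 15 * (y * z) = 8 * e2"
    "x * y * z = e3" by (auto simp: osc_system_def)
  have "2 * osc_cubic e1 e2 e3 y = 0"
    unfolding osc_cubic_def E(3)[symmetric] using E(1,2) by Groebner_Basis.algebra
  moreover have "15 * z = 8 * e1 - 6 * y - 3 * x" using E(1) by Groebner_Basis.algebra
  moreover have "osc_quad e1 e2 y x = 0"
    unfolding osc_quad_def using E(1,2) by Groebner_Basis.algebra
  ultimately show ?R by simp
next
  assume R: ?R
  have y0: "y \<noteq> 0" using R assms by (auto simp: osc_cubic_def)
  have z: "15 * z = 8 * e1 - 6 * y - 3 * x" using R by blast
  have q: "3 * x\<^sup>2 - (8 * e1 - 6 * y) * x + 5 * (3 * y\<^sup>2 - 4 * e1 * y + 4 * e2) = 0"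
    using R by (simp only: osc_quad_def)
  have c: "3 * y ^ 3 - 4 * e1 * y\<^sup>2 + 4 * e2 * y - 3 * e3 = 0" using R by (simp add: osc_cubic_def)
  \<comment> \<open>An explicit combination of the three equations; the factor 15 clears the
    denominator of z.\<close>
  have "15 * (x * y * z - e3) = x * y * (15 * z - (8 * e1 - 6 * y - 3 * x))
      - y * (3 * x\<^sup>2 - (8 * e1 - 6 * y) * x + 5 * (3 * y\<^sup>2 - 4 * e1 * y + 4 * e2))
      + 5 * (3 * y ^ 3 - 4 * e1 * y\<^sup>2 + 4 * e2 * y - 3 * e3)"
    by (simp add: algebra_simps power2_eq_square power3_eq_cube)
  also have "\<dots> = 0" unfolding z q c by simp
  finally have "15 * (x * y * z - e3) = 0" .
  then have E3: "x * y * z = e3" by simp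
  have "5 * (3 * (x * y) + 6 * (x * z) + 15 * (y * z) - 8 * e2)
      = (2 * x + 5 * y) * (15 * z - (8 * e1 - 6 * y - 3 * x))
      - 2 * (3 * x\<^sup>2 - (8 * e1 - 6 * y) * x + 5 * (3 * y\<^sup>2 - 4 * e1 * y + 4 * e2))"
    by (simp add: algebra_simps power2_eq_square)
  also have "\<dots> = 0" unfolding z q by simp
  finally have "5 * (3 * (x * y) + 6 * (x * z) + 15 * (y * z) - 8 * e2) = 0" .
  then have E2: "3 * (x * y) + 6 * (x * z) + 15 * (y * z) = 8 * e2"
    by (simp only: mult_eq_0_iff) simp
  have "3 * x + 6 * y + 15 * z = 8 * e1" using z by Groebner_Basis.algebra
  with E2 E3 show ?L by (simp add: osc_system_def)
qed

text \<open>Three real values of y, each with two real values of x, and z determined by them. Both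
  polynomials are split over the reals and the factorizations are carried to the complex numbers, so
  there are no further solutions.\<close>

lemma osc_system_real_points:
  fixes r1 r2 r3 :: real
  assumes "r1 < r2" "r2 < r3" "r1 \<noteq> 0" "r2 \<noteq> 0" "r3 \<noteq> 0"
  defines "T \<equiv> osc_system (of_real (r1 + r2 + r3)) (of_real (r1 * r2 + r1 * r3 + r2 * r3)) (of_real (r1 * r2 * r3))"
  shows "finite T" "card T = 6" "\<And>x y z. (x, y, z) \<in> T \<Longrightarrow> x \<in> \<real> \<and> y \<in> \<real> \<and> z \<in> \<real>"
proof -
  define e1 where "e1 = r1 + r2 + r3"
  define e2 where "e2 = r1 * r2 + r1 * r3 + r2 * r3"
  define e3 where "e3 = r1 * r2 * r3"
  have e3: "e3 \<noteq> 0" using assms by (simp add: e3_def)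
  from osc_cubic_sign_change[OF assms(1-5)] obtain s t where
    "s < t" "osc_cubic e1 e2 e3 s > 0" "osc_cubic e1 e2 e3 t < 0" unfolding e1_def e2_def e3_def .
  from osc_cubic_three_roots[OF this] obtain y1 y2 y3 where y: "y1 < y2" "y2 < y3" and v: "4 * e1 = 3 * (y1 + y2 + y3)"
      "4 * e2 = 3 * (y1 * y2 + y1 * y3 + y2 * y3)" "e3 = y1 * y2 * y3" .
  have vc: "4 * complex_of_real e1 = 3 * (of_real y1 + of_real y2 + of_real y3)"
      "4 * complex_of_real e2 = 3 * (of_real y1 * of_real y2 + of_real y1 * of_real y3 + of_real y2 * of_real y3)"
      "complex_of_real e3 = of_real y1 * of_real y2 * of_real y3"
    using arg_cong[OF v(1), of complex_of_real] arg_cong[OF v(2), of complex_of_real]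
      arg_cong[OF v(3), of complex_of_real] by simp_all
  have "osc_cubic (complex_of_real e1) (of_real e2) (of_real e3) w
      = 3 * ((w - of_real y1) * (w - of_real y2) * (w - of_real y3))" for w
    unfolding osc_cubic_def vc by (simp add: algebra_simps power2_eq_square power3_eq_cube)
  then have roots: "osc_cubic (complex_of_real e1) (of_real e2) (of_real e3) w = 0 \<longleftrightarrow>
      w = of_real y1 \<or> w = of_real y2 \<or> w = of_real y3" for w by simp
  have "\<exists>x x'. x < x' \<and> (\<forall>w. osc_quad (complex_of_real e1) (of_real e2) (of_real u) w = 0 \<longleftrightarrow> w = of_real x \<or> w = of_real x')"
    if "u \<in> {y1, y2, y3}" for u
  proof -
    define b where "b = - (8 * e1 - 6 * u)"
    define c where "c = 5 * (3 * u\<^sup>2 - 4 * e1 * u + 4 * e2)"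
    have "complex_of_real (osc_cubic e1 e2 e3 u) = 0"
      using roots[of "of_real u"] that by (auto simp: osc_cubic_def)
    then have "osc_cubic e1 e2 e3 u = 0" by simp
    then have "9 * u\<^sup>2 - 9 * e1 * u - 4 * e1\<^sup>2 + 15 * e2 < 0"
      using osc_quadratic_disc[of r1 r2 r3 u] assms unfolding e1_def e2_def e3_def by simp
    moreover have "b\<^sup>2 - 4 * 3 * c = - 16 * (9 * u\<^sup>2 - 9 * e1 * u - 4 * e1\<^sup>2 + 15 * e2)"
      by (simp add: b_def c_def algebra_simps power2_eq_square)
    ultimately obtain x x' where x: "x < x'" "b = - 3 * (x + x')" "c = 3 * (x * x')"
      using real_quadratic_two_roots[of 3 b c] by auto
    have "osc_quad (complex_of_real e1) (of_real e2) (of_real u) w = 3 * ((w - of_real x) * (w - of_real x'))" for w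
    proof -
      have "osc_quad (complex_of_real e1) (of_real e2) (of_real u) w
        = 3 * w\<^sup>2 + of_real b * w + of_real c" by (simp add: osc_quad_def b_def c_def algebra_simps)
      also have "\<dots> = 3 * ((w - of_real x) * (w - of_real x'))"
        unfolding x by (simp add: algebra_simps power2_eq_square)
      finally show ?thesis .
    qed
    then show ?thesis using x(1) by auto
  qed
  then obtain X X' where X: "\<And>u. u \<in> {y1, y2, y3} \<Longrightarrow> X u < X' u"
    and Xr: "\<And>u w. u \<in> {y1, y2, y3} \<Longrightarrow> osc_quad (complex_of_real e1) (of_real e2) (of_real u) w = 0 \<longleftrightarrow>
      w = of_real (X u) \<or> w = of_real (X' u)" by metis
  define P where "P = (\<lambda>u x :: real. (complex_of_real x, complex_of_real u,
      complex_of_real ((8 * e1 - 6 * u - 3 * x) / 15)))"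
  have T: "T = {P y1 (X y1), P y1 (X' y1), P y2 (X y2), P y2 (X' y2), P y3 (X y3), P y3 (X' y3)}"
  proof -
    have "(x, w, z) \<in> T \<longleftrightarrow> (x, w, z) \<in>
      {P y1 (X y1), P y1 (X' y1), P y2 (X y2), P y2 (X' y2), P y3 (X y3), P y3 (X' y3)}" for x w z
    proof -
      have "(x, w, z) \<in> T \<longleftrightarrow> osc_cubic (of_real e1) (of_real e2) (of_real e3) w = 0 \<and>
          15 * z = 8 * of_real e1 - 6 * w - 3 * x \<and> osc_quad (of_real e1) (of_real e2) w x = 0"
        unfolding T_def e1_def[symmetric] e2_def[symmetric] e3_def[symmetric]
        by (rule osc_system_iff) (simp add: e3)
      moreover have "15 * z = 8 * of_real e1 - 6 * of_real u - 3 * of_real v \<longleftrightarrow>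
          z = of_real ((8 * e1 - 6 * u - 3 * v) / 15)" for u v by (auto simp: field_simps)
      ultimately show ?thesis
        unfolding roots P_def using Xr[of y1 x] Xr[of y2 x] Xr[of y3 x]
        by (simp only: insert_iff empty_iff prod.inject simp_thms) metis
    qed
    then show ?thesis by auto
  qed
  show "finite T" unfolding T by simp
  show "card T = 6" unfolding T using y X[of y1] X[of y2] X[of y3] by (simp add: P_def)
  show "x \<in> \<real> \<and> w \<in> \<real> \<and> z \<in> \<real>" if "(x, w, z) \<in> T" for x w z
    using that unfolding T P_def by (elim insertE emptyE) (simp_all only: prod.inject Reals_of_real simp_thms)
qed

subsection \<open>Osculating flags\<close>

definition esym :: "nat \<Rightarrow> real \<Rightarrow> real \<Rightarrow> real \<Rightarrow> real \<Rightarrow> real \<Rightarrow> real" where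
  "esym r a b c d e =
     (if r = 0 then 1 else if r = 1 then a + b + c + d + e
      else if r = 2 then a * b + a * c + a * d + a * e + b * c + b * d + b * e + c * d + c * e + d * e
      else if r = 3 then a * b * c + a * b * d + a * b * e + a * c * d + a * c * e + a * d * e
        + b * c * d + b * c * e + b * d * e + c * d * e
      else if r = 4 then a * b * c * d + a * b * c * e + a * b * d * e + a * c * d * e + b * c * d * e
      else a * b * c * d * e)"

text \<open>The polarization of the moment curve \<open>(1, t, \<dots>, t ^ 5)\<close>, a symmetric
  multiaffine function of its arguments; the osculating spaces at \<open>s\<close> are spanned by
  its values with enough arguments equal to \<open>s\<close>.\<close>

definition blossom :: "real \<Rightarrow> real \<Rightarrow> real \<Rightarrow> real \<Rightarrow> real \<Rightarrow> nat \<Rightarrow> complex" where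
  "blossom a b c d e = (\<lambda>l. if l < 6 then of_real (esym l a b c d e / real (5 choose l)) else 0)"

lemma binomial_small:
  "5 choose 2 = 10" "5 choose 3 = 10" "5 choose 4 = 5"
  "4 choose 2 = 6" "4 choose 3 = 4" "3 choose 2 = 3"
  by (simp_all add: numeral_eq_Suc)

text \<open>The polarized binomial theorem: with all five arguments equal to t it is the expansion
  of t^l in powers of t - s.\<close>

lemma esym_shift:
  assumes "l < 6"
  shows "esym l a b c d e / real (5 choose l) =
    (\<Sum>r<6. esym r (a - s) (b - s) (c - s) (d - s) (e - s) / real (5 choose r) * (real (l choose r) * s ^ (l - r)))"
proof -
  obtain a' b' c' d' e' where x: "a = a' + s" "b = b' + s" "c = c' + s" "d = d' + s" "e = e' + s"
    by (metis diff_add_cancel)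
  have "l = 0 \<or> l = 1 \<or> l = 2 \<or> l = 3 \<or> l = 4 \<or> l = 5" using assms by linarith
  then show ?thesis unfolding x sum_lessThan_6
    by (elim disjE; simp only:; simp add: esym_def binomial_small;
        simp add: field_simps power2_eq_square power3_eq_cube power4_eq_xxxx eval_nat_numeral)
qed

lemma blossom_expand:
  "blossom a b c d e = comb 6 (row_vec 6 (osc_mat s))
     (\<lambda>r. of_real (esym r (a - s) (b - s) (c - s) (d - s) (e - s) / real (5 choose r)))"
proof
  fix l
  show "blossom a b c d e l = comb 6 (row_vec 6 (osc_mat s))
     (\<lambda>r. of_real (esym r (a - s) (b - s) (c - s) (d - s) (e - s) / real (5 choose r))) l"
  proof (cases "l < 6")
    case True
    then show ?thesis
      by (simp add: blossom_def comb_def row_vec_def osc_mat_def esym_shift[OF True, of a b c d e s])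
  next
    case False
    then show ?thesis by (simp add: blossom_def comb_def row_vec_def)
  qed
qed

lemma comb_truncate:
  assumes "m \<le> n" "\<And>i. m \<le> i \<Longrightarrow> i < n \<Longrightarrow> k i = 0"
  shows "comb n f k = comb m f k"
proof
  fix l
  have "(\<Sum>i<n. k i * f i l) = (\<Sum>i<m. k i * f i l)"
    by (rule sum.mono_neutral_right) (use assms in auto)
  then show "comb n f k l = comb m f k l" by (simp add: comb_def)
qed

text \<open>In the expansion at s, coefficient r is an elementary symmetric function of the
  differences from s. With m arguments other than s it vanishes for r > m, leaving the first m + 1
  rows.\<close>

lemma blossom_in_osc_flag:
  shows "blossom s s s s a \<in> row_flag 6 (osc_mat s) 2"
    and "blossom s s s a b \<in> row_flag 6 (osc_mat s) 3"
    and "blossom s s a b c \<in> row_flag 6 (osc_mat s) 4"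
proof -
  have "blossom s s s s a = comb 2 (row_vec 6 (osc_mat s))
     (\<lambda>r. of_real (esym r (s - s) (s - s) (s - s) (s - s) (a - s) / real (5 choose r)))"
    unfolding blossom_expand[of _ _ _ _ _ s] by (rule comb_truncate) (auto simp: esym_def)
  then show "blossom s s s s a \<in> row_flag 6 (osc_mat s) 2" unfolding row_flag_eq by simp
  have "blossom s s s a b = comb 3 (row_vec 6 (osc_mat s))
     (\<lambda>r. of_real (esym r (s - s) (s - s) (s - s) (a - s) (b - s) / real (5 choose r)))"
    unfolding blossom_expand[of _ _ _ _ _ s] by (rule comb_truncate) (auto simp: esym_def)
  then show "blossom s s s a b \<in> row_flag 6 (osc_mat s) 3" unfolding row_flag_eq by simp
  have "blossom s s a b c = comb 4 (row_vec 6 (osc_mat s))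
     (\<lambda>r. of_real (esym r (s - s) (s - s) (a - s) (b - s) (c - s) / real (5 choose r)))"
    unfolding blossom_expand[of _ _ _ _ _ s] by (rule comb_truncate) (auto simp: esym_def)
  then show "blossom s s a b c \<in> row_flag 6 (osc_mat s) 4" unfolding row_flag_eq by simp
qed

lemma osc_rows_indep: "indep_seq 6 (row_vec 6 (osc_mat s))"
  unfolding indep_seq_def
proof (intro allI impI)
  fix k i assume z: "comb 6 (row_vec 6 (osc_mat s)) k = 0" and i: "i < (6::nat)"
  have e: "(\<Sum>r<6. k r * osc_mat s r l) = 0" if "l < 6" for l
    using fun_cong[OF z, of l] that by (simp add: comb_def row_vec_def)
  have "k 0 = 0" using e[of 0] by (simp add: sum_lessThan_6 osc_mat_def binomial_eq_0)
  moreover from this have "k 1 = 0" using e[of 1] by (simp add: sum_lessThan_6 osc_mat_def binomial_eq_0)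
  moreover from calculation have "k 2 = 0" using e[of 2] by (simp add: sum_lessThan_6 osc_mat_def binomial_eq_0)
  moreover from calculation have "k 3 = 0" using e[of 3] by (simp add: sum_lessThan_6 osc_mat_def binomial_eq_0)
  moreover from calculation have "k 4 = 0" using e[of 4] by (simp add: sum_lessThan_6 osc_mat_def binomial_eq_0)
  moreover from calculation have "k 5 = 0" using e[of 5] by (simp add: sum_lessThan_6 osc_mat_def binomial_eq_0)
  ultimately have "\<forall>i<6. k i = 0" unfolding all_less_6 by blast
  then show "k i = 0" using i by blast
qed

text \<open>Vector i has 5 - i arguments p and i arguments q, so it lies in step i + 1 of the flag
  at p and in step 6 - i of the flag at q: a Bernstein-type basis adapted to both flags.\<close>

definition osc_basis :: "real \<Rightarrow> real \<Rightarrow> nat \<Rightarrow> nat \<Rightarrow> complex" where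
  "osc_basis p q i = blossom (if i < 5 then p else q) (if i < 4 then p else q) (if i < 3 then p else q)
     (if i < 2 then p else q) (if i < 1 then p else q)"

lemma osc_basis_simps:
  "osc_basis p q 0 = blossom p p p p p" "osc_basis p q 1 = blossom p p p p q"
  "osc_basis p q 2 = blossom p p p q q" "osc_basis p q 3 = blossom p p q q q"
  "osc_basis p q 4 = blossom p q q q q" "osc_basis p q 5 = blossom q q q q q"
  by (simp_all add: osc_basis_def)

lemma blossom_rev: "blossom a b c d e = blossom e d c b a"
  by (simp add: blossom_def esym_def fun_eq_iff algebra_simps)

text \<open>In the osculating rows at p the matrix is triangular, with nonzero multiples of powers
  of q - p on the diagonal; the coefficients vanish from the last one down.\<close>

lemma osc_basis_indep:
  assumes "p \<noteq> q"
  shows "indep_seq 6 (osc_basis p q)"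
  unfolding indep_seq_def
proof (intro allI impI)
  fix k i assume z: "comb 6 (osc_basis p q) k = 0" and i: "i < (6::nat)"
  define D where "D = complex_of_real (q - p)"
  have D: "D \<noteq> 0" using assms by (simp add: D_def)
  define T where "T = (\<lambda>(i::nat) r. complex_of_real (esym r ((if i < 5 then p else q) - p) ((if i < 4 then p else q) - p)
     ((if i < 3 then p else q) - p) ((if i < 2 then p else q) - p) ((if i < 1 then p else q) - p) / real (5 choose r)))"
  have "osc_basis p q = (\<lambda>i. comb 6 (row_vec 6 (osc_mat p)) (T i))"
    unfolding osc_basis_def T_def by (subst blossom_expand[of _ _ _ _ _ p]) simp
  then have "comb 6 (row_vec 6 (osc_mat p)) (\<lambda>r. \<Sum>i<6. k i * T i r) = 0"
    using z by (simp add: comb_comb)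
  note e = indep_seqD[OF osc_rows_indep this, unfolded sum_lessThan_6]
  have "k 5 = 0" using e[of 5] assms by (simp add: T_def esym_def)
  moreover from this have "k 4 = 0" using e[of 4] assms by (simp add: T_def esym_def)
  moreover from calculation have "k 3 = 0" using e[of 3] assms by (simp add: T_def esym_def)
  moreover from calculation have "k 2 = 0" using e[of 2] assms by (simp add: T_def esym_def)
  moreover from calculation have "k 1 = 0" using e[of 1] assms by (simp add: T_def esym_def)
  moreover from calculation have "k 0 = 0" using e[of 0] assms by (simp add: T_def esym_def)
  ultimately have "\<forall>i<6. k i = 0" unfolding all_less_6 by blast
  then show "k i = 0" using i by blast
qed

text \<open>Cubic Bernstein coefficients, shifted by r: three arguments s = a p + b q are expanded,
  and r of the two remaining arguments equal q.\<close>

definition osc_coords :: "real \<Rightarrow> real \<Rightarrow> nat \<Rightarrow> nat \<Rightarrow> complex" where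
  "osc_coords a b r i = (if r \<le> i \<and> i \<le> r + 3 then of_real (real (3 choose (i - r)) * a ^ (3 - (i - r)) * b ^ (i - r)) else 0)"

text \<open>Affinity in each argument gives eight terms, and symmetry collects them with binomial
  multiplicities.\<close>

lemma blossom_affine:
  assumes s: "s = (1 - b) * p + b * q"
  shows "blossom s s s x y = (\<lambda>l. of_real ((1 - b) ^ 3) * blossom p p p x y l + of_real (3 * (1 - b)\<^sup>2 * b) * blossom p p q x y l
     + of_real (3 * (1 - b) * b\<^sup>2) * blossom p q q x y l + of_real (b ^ 3) * blossom q q q x y l)"
proof -
  have A: "esym l ((1 - b) * p + b * q) c d e f = (1 - b) * esym l p c d e f + b * esym l q c d e f"
    and S: "esym l c d e f g = esym l d c e f g" "esym l c d e f g = esym l c e d f g" for l c d e f g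
    by (auto simp: esym_def algebra_simps)
  have A2: "esym l c ((1 - b) * p + b * q) d e f = (1 - b) * esym l c p d e f + b * esym l c q d e f"
    and A3: "esym l c d ((1 - b) * p + b * q) e f = (1 - b) * esym l c d p e f + b * esym l c d q e f" for l c d e f
    by (auto simp: esym_def algebra_simps)
  have P: "esym l q p p x y = esym l p p q x y" "esym l p q p x y = esym l p p q x y"
    "esym l q q p x y = esym l p q q x y" "esym l q p q x y = esym l p q q x y" for l
    using S by metis+
  have "esym l s s s x y = (1 - b) ^ 3 * esym l p p p x y + 3 * (1 - b)\<^sup>2 * b * esym l p p q x y
     + 3 * (1 - b) * b\<^sup>2 * esym l p q q x y + b ^ 3 * esym l q q q x y" for l
    unfolding s A unfolding A2 unfolding A3 P by (simp only: power2_eq_square power3_eq_cube) (simp only: algebra_simps)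
  then show ?thesis by (simp add: blossom_def fun_eq_iff add_divide_distrib)
qed

lemma blossom_osc_coords:
  assumes "s = (1 - b) * p + b * q"
  shows "blossom s s s p p = comb 6 (osc_basis p q) (osc_coords (1 - b) b 0)"
    and "blossom s s s p q = comb 6 (osc_basis p q) (osc_coords (1 - b) b 1)"
    and "blossom s s s q q = comb 6 (osc_basis p q) (osc_coords (1 - b) b 2)"
proof -
  have P: "blossom p p q p p = blossom p p p p q" "blossom p q q p p = blossom p p p q q"
    "blossom q q q p p = blossom p p q q q" "blossom p p q p q = blossom p p p q q"
    "blossom p q q p q = blossom p p q q q" "blossom q q q p q = blossom p q q q q"
    by (simp_all add: blossom_def esym_def fun_eq_iff algebra_simps)
  show "blossom s s s p p = comb 6 (osc_basis p q) (osc_coords (1 - b) b 0)"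
    "blossom s s s p q = comb 6 (osc_basis p q) (osc_coords (1 - b) b 1)"
    "blossom s s s q q = comb 6 (osc_basis p q) (osc_coords (1 - b) b 2)"
    unfolding blossom_affine[OF assms] comb_def sum_lessThan_6 osc_basis_simps P
    by (simp_all add: osc_coords_def binomial_small)
qed

text \<open>The coefficients are the minors of the band matrix of \<open>osc_coords\<close> using
  one column from each pair; for example 8 = 3 * 3 - 1. The common factor is nonzero when s differs
  from p and q.\<close>

lemma tri_osc_coords:
  fixes a b :: real
  defines "A \<equiv> complex_of_real a" and "B \<equiv> complex_of_real b"
  shows "tri (osc_coords a b) u0 u1 v0 v1 w0 w1 = A ^ 3 * B ^ 3 *
    (A ^ 3 * (8 * (u1 * v1 * w1)) - A\<^sup>2 * B * (3 * (u1 * v1 * w0) + 6 * (u1 * v0 * w1) + 15 * (u0 * v1 * w1))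
     + A * B\<^sup>2 * (3 * (u1 * v0 * w0) + 6 * (u0 * v1 * w0) + 15 * (u0 * v0 * w1)) - B ^ 3 * (8 * (u0 * v0 * w0)))"
  unfolding tri_def det3_def
  by (simp add: osc_coords_def binomial_small A_def[symmetric] B_def[symmetric])
     (simp add: algebra_simps power2_eq_square power3_eq_cube)

text \<open>Subtracting d times the product of the factors leaves a quadratic with three distinct
  zeros, and divided differences show that it is zero. The leading coefficient d may vanish, so it
  cannot be normalized to 1.\<close>

lemma cubic_vanishes_iff:
  fixes r1 r2 r3 a b c d :: "'a::field"
  assumes "r1 \<noteq> r2" "r1 \<noteq> r3" "r2 \<noteq> r3"
  shows "(\<forall>r\<in>{r1, r2, r3}. a - r * b + r\<^sup>2 * c - r ^ 3 * d = 0) \<longleftrightarrow>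
    c = (r1 + r2 + r3) * d \<and> b = (r1 * r2 + r1 * r3 + r2 * r3) * d \<and> a = r1 * r2 * r3 * d" (is "?L \<longleftrightarrow> ?R")
proof
  assume ?R
  then show ?L by (simp add: algebra_simps power2_eq_square power3_eq_cube)
next
  assume ?L
  define A where "A = a - r1 * r2 * r3 * d"
  define B where "B = b - (r1 * r2 + r1 * r3 + r2 * r3) * d"
  define C where "C = c - (r1 + r2 + r3) * d"
  have e: "A - r * B + r\<^sup>2 * C = 0" if "r \<in> {r1, r2, r3}" for r
  proof -
    have "A - r * B + r\<^sup>2 * C = (a - r * b + r\<^sup>2 * c - r ^ 3 * d) + d * ((r - r1) * (r - r2) * (r - r3))"
      by (simp add: A_def B_def C_def algebra_simps power2_eq_square power3_eq_cube)
    then show ?thesis using \<open>?L\<close> that by auto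
  qed
  have "(r1 - r2) * ((r1 + r2) * C - B) = (A - r1 * B + r1\<^sup>2 * C) - (A - r2 * B + r2\<^sup>2 * C)"
    "(r1 - r3) * ((r1 + r3) * C - B) = (A - r1 * B + r1\<^sup>2 * C) - (A - r3 * B + r3\<^sup>2 * C)"
    by (simp_all add: algebra_simps power2_eq_square)
  then have "(r1 + r2) * C - B = 0" "(r1 + r3) * C - B = 0"
    using e assms by simp_all
  moreover have "(r2 - r3) * C = ((r1 + r2) * C - B) - ((r1 + r3) * C - B)" by (simp add: algebra_simps)
  ultimately have "C = 0" using assms by simp
  then have "B = 0" using \<open>(r1 + r2) * C - B = 0\<close> by simp
  moreover have "A = 0" using e[of r1] \<open>C = 0\<close> \<open>B = 0\<close> by simp
  ultimately show ?R using \<open>C = 0\<close> by (simp add: A_def B_def C_def)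
qed

lemma osc_system_real_points':
  fixes r1 r2 r3 :: real
  assumes "r1 \<noteq> r2" "r1 \<noteq> r3" "r2 \<noteq> r3" "r1 \<noteq> 0" "r2 \<noteq> 0" "r3 \<noteq> 0"
  defines "T \<equiv> osc_system (of_real (r1 + r2 + r3)) (of_real (r1 * r2 + r1 * r3 + r2 * r3)) (of_real (r1 * r2 * r3))"
  shows "finite T \<and> card T = 6 \<and> (\<forall>(x, y, z)\<in>T. x \<in> \<real> \<and> y \<in> \<real> \<and> z \<in> \<real>)"
proof -
  \<comment> \<open>Stated in terms of e1, e2, e3, the claim is insensitive to the order of the r_j,
    and the sorted case suffices.\<close>
  define P where "P = (\<lambda>e1 e2 e3. let T = osc_system (of_real e1) (of_real e2) (of_real e3) in
      finite T \<and> card T = 6 \<and> (\<forall>(x, y, z)\<in>T. x \<in> \<real> \<and> y \<in> \<real> \<and> z \<in> \<real>))"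
  have sorted: "P (a + b + c) (a * b + a * c + b * c) (a * b * c)"
    if "a < b" "b < c" "a \<noteq> 0" "b \<noteq> 0" "c \<noteq> 0" for a b c
    unfolding P_def Let_def using osc_system_real_points[OF that] by blast
  consider "r1 < r2" "r2 < r3" | "r1 < r3" "r3 < r2" | "r2 < r1" "r1 < r3" | "r2 < r3" "r3 < r1"
    | "r3 < r1" "r1 < r2" | "r3 < r2" "r2 < r1" using assms by linarith
  then have "P (r1 + r2 + r3) (r1 * r2 + r1 * r3 + r2 * r3) (r1 * r2 * r3)"
  proof cases
    case 1 show ?thesis using sorted[OF 1] assms by simp
  next
    case 2 show ?thesis using sorted[OF 2] assms by (simp add: ac_simps)
  next
    case 3 show ?thesis using sorted[OF 3] assms by (simp add: ac_simps)
  next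
    case 4 show ?thesis using sorted[OF 4] assms by (simp add: ac_simps)
  next
    case 5 show ?thesis using sorted[OF 5] assms by (simp add: ac_simps)
  next
    case 6 show ?thesis using sorted[OF 6] assms by (simp add: ac_simps)
  qed
  then show ?thesis unfolding P_def T_def Let_def .
qed

text \<open>Excludes solutions at infinity. If u0 = 0, say, then u1 is nonzero and v0 or w0 must
  vanish; the last two equations then force v or w to be zero. The other cases are alike, because 3,
  6, 15 are all nonzero.\<close>

lemma trilinear_no_degenerate:
  fixes u0 u1 v0 v1 w0 w1 :: complex
  assumes "u0 \<noteq> 0 \<or> u1 \<noteq> 0" "v0 \<noteq> 0 \<or> v1 \<noteq> 0" "w0 \<noteq> 0 \<or> w1 \<noteq> 0"
    and "u0 * v0 * w0 = 0" "3 * (u1 * v0 * w0) + 6 * (u0 * v1 * w0) + 15 * (u0 * v0 * w1) = 0"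
    and "3 * (u1 * v1 * w0) + 6 * (u1 * v0 * w1) + 15 * (u0 * v1 * w1) = 0" "u1 * v1 * w1 = 0"
  shows False
  using assms by (cases "u0 = 0"; cases "v0 = 0"; cases "w0 = 0") auto

lemma osc_flags_intersection:
  fixes s :: "nat \<Rightarrow> real"
  assumes inj: "inj_on s {..<5}"
  defines "S \<equiv> schubert_inter 3 3 schubert_data (\<lambda>j. osc_flag 6 (s j))"
  shows "finite S \<and> card S = 6 \<and> (\<forall>X\<in>S. real_point X)"
proof -
  have dist: "s i \<noteq> s j" if "i < 5" "j < 5" "i \<noteq> j" for i j using inj that by (auto simp: inj_on_def)
  define p where "p = s 0"
  define q where "q = s 1"
  have pq: "p \<noteq> q" unfolding p_def q_def by (rule dist) auto
  \<comment> \<open>The affine coordinate of s_j on the line, 0 at p and 1 at q; then b / a is the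
    ratio r_j.\<close>
  define b where "b = (\<lambda>j. (s j - p) / (q - p))"
  define a where "a = (\<lambda>j. 1 - b j)"
  define E where "E = osc_basis p q"
  define G where "G = (\<lambda>j. osc_coords (a j) (b j))"
  have sj: "s j = (1 - b j) * p + b j * q" for j
  proof -
    have "b j * (q - p) = s j - p" using pq by (simp add: b_def)
    then show ?thesis by (simp add: algebra_simps)
  qed
  have a_eq: "a j = (q - s j) / (q - p)" for j using pq by (simp add: a_def b_def field_simps)
  have a0: "a j \<noteq> 0" and b0: "b j \<noteq> 0" if "j \<in> {2, 3, 4}" for j
    using pq dist[of 1 j] dist[of 0 j] that by (auto simp: a_eq b_def p_def q_def)
  interpret adapted_basis E "\<lambda>j. osc_mat (s j)" G
  proof
    show E: "indep_seq 6 E" unfolding E_def by (rule osc_basis_indep[OF pq])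
    show "E i \<in> Cn 6" for i by (simp add: E_def osc_basis_def blossom_def Cn_def)
    show "indep_seq 6 (row_vec 6 (osc_mat (s j)))" for j by (rule osc_rows_indep)
    show "E i \<in> row_flag 6 (osc_mat (s 0)) 2" if "i < 2" for i
    proof -
      have "i = 0 \<or> i = 1" using that by linarith
      then show ?thesis unfolding E_def p_def[symmetric]
        using blossom_in_osc_flag(1)[of p] by (elim disjE) (simp_all only: osc_basis_simps)
    qed
    show "E i \<in> row_flag 6 (osc_mat (s 0)) 4" if "i < 4" for i
    proof -
      have "i = 0 \<or> i = 1 \<or> i = 2 \<or> i = 3" using that by linarith
      then show ?thesis unfolding E_def p_def[symmetric]
        using blossom_in_osc_flag(3)[of p] by (elim disjE) (simp_all only: osc_basis_simps)
    qed
    have qrev: "blossom x q q q q \<in> row_flag 6 (osc_mat q) 2" "blossom x y z q q \<in> row_flag 6 (osc_mat q) 4" for x y z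
      by (subst blossom_rev, rule blossom_in_osc_flag)+
    show "E (i + 4) \<in> row_flag 6 (osc_mat (s 1)) 2" if "i < 2" for i
    proof -
      have "i + 4 = 4 \<or> i + 4 = 5" using that by linarith
      then show ?thesis unfolding E_def q_def[symmetric]
        by (elim disjE) (simp_all only: osc_basis_simps qrev)
    qed
    show "E (i + 2) \<in> row_flag 6 (osc_mat (s 1)) 4" if "i < 4" for i
    proof -
      have "i + 2 = 2 \<or> i + 2 = 3 \<or> i + 2 = 4 \<or> i + 2 = 5" using that by linarith
      then show ?thesis unfolding E_def q_def[symmetric]
        by (elim disjE) (simp_all only: osc_basis_simps qrev)
    qed
    show "row_flag 6 (osc_mat (s j)) 3 = range (comb 3 (\<lambda>r. comb 6 E (G j r)))" if j: "j \<in> {2, 3, 4}" for j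
      unfolding row_flag_eq
    proof (rule range_comb_eq)
      show "indep_seq 3 (\<lambda>r. comb 6 E (G j r))" unfolding indep_seq_def comb_comb
      proof (intro allI impI)
        fix h i assume "comb 6 E (\<lambda>i. \<Sum>r<3. h r * G j r i) = 0" and i: "i < (3::nat)"
        note z = indep_seqD[OF E this(1), unfolded sum_lessThan_3]
        have "h 0 = 0" using z[of 0] a0[OF j] by (simp add: G_def osc_coords_def)
        moreover from this have "h 1 = 0" using z[of 1] a0[OF j] by (simp add: G_def osc_coords_def)
        moreover from calculation have "h 2 = 0" using z[of 2] a0[OF j] by (simp add: G_def osc_coords_def)
        ultimately have "\<forall>i<3. h i = 0" unfolding all_less_3 by blast
        then show "h i = 0" using i by blast
      qed
      show "comb 6 E (G j r) \<in> range (comb 3 (row_vec 6 (osc_mat (s j))))" if "r < 3" for r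
      proof -
        have "r = 0 \<or> r = 1 \<or> r = 2" using that by linarith
        then show ?thesis unfolding E_def G_def a_def row_flag_eq[symmetric]
          using blossom_in_osc_flag(2)[of "s j"]
          by (elim disjE) (simp_all only: blossom_osc_coords[OF sj, symmetric])
      qed
    qed
  qed
  define r where "r = (\<lambda>j. b j / a j)"
  have r0: "r j \<noteq> 0" if "j \<in> {2, 3, 4}" for j using a0[OF that] b0[OF that] by (simp add: r_def)
  have rd: "r i \<noteq> r j" if "i \<in> {2, 3, 4}" "j \<in> {2, 3, 4}" "i \<noteq> j" for i j
  proof
    assume "r i = r j"
    then have "b i * a j = b j * a i" using a0[OF that(1)] a0[OF that(2)] by (simp add: r_def field_simps)
    then have "b i = b j" by (simp add: a_def algebra_simps)
    then have "s i = s j" using sj[of i] sj[of j] by simp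
    then show False using dist[of i j] that by auto
  qed
  have tri_iff: "tri (G j) u0 u1 v0 v1 w0 w1 = 0 \<longleftrightarrow>
      8 * (u1 * v1 * w1) - of_real (r j) * (3 * (u1 * v1 * w0) + 6 * (u1 * v0 * w1) + 15 * (u0 * v1 * w1))
      + (of_real (r j))\<^sup>2 * (3 * (u1 * v0 * w0) + 6 * (u0 * v1 * w0) + 15 * (u0 * v0 * w1))
      - (of_real (r j)) ^ 3 * (8 * (u0 * v0 * w0)) = 0" if j: "j \<in> {2, 3, 4}" for j u0 u1 v0 v1 w0 w1
  proof -
    have B: "complex_of_real (b j) = of_real (a j) * of_real (r j)" using a0[OF j] by (simp add: r_def)
    \<comment> \<open>Homogeneity in the pair (a, b) leaves only the ratio, up to a nonzero
      factor.\<close>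
    have f: "A ^ 3 * (A * R) ^ 3 * (A ^ 3 * x - A\<^sup>2 * (A * R) * y + A * (A * R)\<^sup>2 * z - (A * R) ^ 3 * w) =
      A ^ 9 * R ^ 3 * (x - R * y + R\<^sup>2 * z - R ^ 3 * w)" for A R x y z w :: complex
      by (simp add: algebra_simps eval_nat_numeral)
    show ?thesis unfolding G_def tri_osc_coords B f using a0[OF j] r0[OF j] by simp
  qed
  define e1 where "e1 = r 2 + r 3 + r 4"
  define e2 where "e2 = r 2 * r 3 + r 2 * r 4 + r 3 * r 4"
  define e3 where "e3 = r 2 * r 3 * r 4"
  have tris: "(\<forall>j\<in>{2, 3, 4}. tri (G j) u0 u1 v0 v1 w0 w1 = 0) \<longleftrightarrow>
      3 * (u1 * v0 * w0) + 6 * (u0 * v1 * w0) + 15 * (u0 * v0 * w1) = of_real e1 * (8 * (u0 * v0 * w0)) \<and>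
      3 * (u1 * v1 * w0) + 6 * (u1 * v0 * w1) + 15 * (u0 * v1 * w1) = of_real e2 * (8 * (u0 * v0 * w0)) \<and>
      8 * (u1 * v1 * w1) = of_real e3 * (8 * (u0 * v0 * w0))" for u0 u1 v0 v1 w0 w1
  proof -
    have d: "complex_of_real (r 2) \<noteq> of_real (r 3)" "complex_of_real (r 2) \<noteq> of_real (r 4)"
      "complex_of_real (r 3) \<noteq> of_real (r 4)" using rd[of 2 3] rd[of 2 4] rd[of 3 4] by simp_all
    have "tri (G 2) u0 u1 v0 v1 w0 w1 = 0 \<and> tri (G 3) u0 u1 v0 v1 w0 w1 = 0 \<and> tri (G 4) u0 u1 v0 v1 w0 w1 = 0 \<longleftrightarrow>
      (\<forall>j\<in>{2, 3, 4}. tri (G j) u0 u1 v0 v1 w0 w1 = 0)" by blast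
    moreover have "2 \<in> {2, 3, 4::nat}" "3 \<in> {2, 3, 4::nat}" "4 \<in> {2, 3, 4::nat}" by simp_all
    ultimately show ?thesis
      unfolding e1_def e2_def e3_def of_real_add of_real_mult
      using cubic_vanishes_iff[OF d, of "8 * (u1 * v1 * w1)"
        "3 * (u1 * v1 * w0) + 6 * (u1 * v0 * w1) + 15 * (u0 * v1 * w1)"
        "3 * (u1 * v0 * w0) + 6 * (u0 * v1 * w0) + 15 * (u0 * v0 * w1)" "8 * (u0 * v0 * w0)"]
        \<open>2 \<in> {2, 3, 4::nat}\<close>[THEN tri_iff, of u0 u1 v0 v1 w0 w1] \<open>3 \<in> {2, 3, 4::nat}\<close>[THEN tri_iff, of u0 u1 v0 v1 w0 w1]
        \<open>4 \<in> {2, 3, 4::nat}\<close>[THEN tri_iff, of u0 u1 v0 v1 w0 w1]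
      by (simp only: ball_simps simp_thms)
  qed
  define T where "T = osc_system (of_real e1) (of_real e2) (of_real e3)"
  \<comment> \<open>All solutions lie in the chart u0 = v0 = w0 = 1, so affine coordinates
    parametrize the whole intersection.\<close>
  define f where "f = (\<lambda>(x, y, z). plane E 1 x 1 y 1 z)"
  have T: "finite T" "card T = 6" "\<forall>(x, y, z)\<in>T. x \<in> \<real> \<and> y \<in> \<real> \<and> z \<in> \<real>"
    unfolding T_def e1_def e2_def e3_def
    using osc_system_real_points'[of "r 2" "r 3" "r 4"] rd r0 by simp_all
  have inj: "inj_on f T"
  proof (rule inj_onI)
    fix t t' assume eq: "f t = f t'"
    obtain x y z x' y' z' where t: "t = (x, y, z)" "t' = (x', y', z')" by (metis prod_cases3)
    show "t = t'" using plane_eqD[OF E_indep eq[unfolded t f_def prod.case]] t by simp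
  qed
  have S: "S = f ` T"
  proof (intro equalityI subsetI)
    fix X assume "X \<in> S"
    then have "X \<in> schubert_inter 3 3 schubert_data (\<lambda>j. row_flag 6 (osc_mat (s j)))"
      by (simp add: S_def osc_flag_def)
    then obtain u0 u1 v0 v1 w0 w1 where uvw: "u0 \<noteq> 0 \<or> u1 \<noteq> 0" "v0 \<noteq> 0 \<or> v1 \<noteq> 0" "w0 \<noteq> 0 \<or> w1 \<noteq> 0"
      and t: "\<And>j. j \<in> {2, 3, 4} \<Longrightarrow> tri (G j) u0 u1 v0 v1 w0 w1 = 0" and X: "X = plane E u0 u1 v0 v1 w0 w1"
      by (rule schubert_inter_imp_plane) blast
    have c: "3 * (u1 * v0 * w0) + 6 * (u0 * v1 * w0) + 15 * (u0 * v0 * w1) = of_real e1 * (8 * (u0 * v0 * w0))"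
      "3 * (u1 * v1 * w0) + 6 * (u1 * v0 * w1) + 15 * (u0 * v1 * w1) = of_real e2 * (8 * (u0 * v0 * w0))"
      "8 * (u1 * v1 * w1) = of_real e3 * (8 * (u0 * v0 * w0))"
      using tris[of u0 u1 v0 v1 w0 w1] t by blast+
    have "u0 * v0 * w0 \<noteq> 0"
    proof
      assume z: "u0 * v0 * w0 = 0"
      have c3: "u1 * v1 * w1 = 0" using c(3) unfolding z by simp
      show False by (rule trilinear_no_degenerate[OF uvw z c(1,2)[unfolded z mult_zero_right] c3])
    qed
    then have nz: "u0 \<noteq> 0" "v0 \<noteq> 0" "w0 \<noteq> 0" by auto
    define x y z where "x = u1 / u0" and "y = v1 / v0" and "z = w1 / w0"
    then have xyz: "u1 = x * u0" "v1 = y * v0" "w1 = z * w0" using nz by simp_all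
    define K where "K = u0 * v0 * w0"
    have K: "K \<noteq> 0" using nz by (simp add: K_def)
    have "X = f (x, y, z)" unfolding X f_def prod.case
      by (rule plane_cong_proportional) (use nz xyz in auto)
    moreover have "(3 * x + 6 * y + 15 * z) * K = (8 * of_real e1) * K"
      using c(1) unfolding xyz K_def by (simp add: algebra_simps)
    then have "3 * x + 6 * y + 15 * z = 8 * of_real e1" using K mult_cancel_right by blast
    moreover have "(3 * (x * y) + 6 * (x * z) + 15 * (y * z)) * K = (8 * of_real e2) * K"
      using c(2) unfolding xyz K_def by (simp add: algebra_simps)
    then have "3 * (x * y) + 6 * (x * z) + 15 * (y * z) = 8 * of_real e2" using K mult_cancel_right by blast
    moreover have "(8 * (x * y * z)) * K = (8 * of_real e3) * K"
      using c(3) unfolding xyz K_def by (simp add: algebra_simps)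
    then have "8 * (x * y * z) = 8 * of_real e3" using K mult_cancel_right by blast
    then have "x * y * z = of_real e3" by simp
    ultimately have "X = f (x, y, z)" "(x, y, z) \<in> T"
      unfolding T_def osc_system_def mem_Collect_eq prod.case by blast+
    then show "X \<in> f ` T" by blast
  next
    fix X assume "X \<in> f ` T"
    then obtain x y z where X: "X = plane E 1 x 1 y 1 z" and T: "(x, y, z) \<in> T" by (auto simp: f_def)
    have "\<forall>j\<in>{2, 3, 4}. tri (G j) 1 x 1 y 1 z = 0"
      unfolding tris using T by (auto simp: T_def osc_system_def)
    then have "X \<in> schubert_inter 3 3 schubert_data (\<lambda>j. row_flag 6 (osc_mat (s j)))"
      unfolding X by (intro plane_in_schubert_inter) auto
    then show "X \<in> S" by (simp add: S_def osc_flag_def)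
  qed
  have "real_point X" if "X \<in> S" for X
  proof -
    obtain x y z where X: "X = plane E 1 x 1 y 1 z" and xyz: "(x, y, z) \<in> T"
      using \<open>X \<in> S\<close> unfolding S by (auto simp: f_def)
    show ?thesis unfolding X
      by (rule real_point_plane) (use T(3) xyz in \<open>auto simp: E_def osc_basis_def blossom_def\<close>)
  qed
  then show ?thesis using T(1,2) card_image[OF inj] S by simp
qed

theorem mainTheorem11:
  shows "dnum 3 3 [[1,3,5], [1,3,5], pieri 3 1, pieri 3 1, pieri 3 1] = 6
         \<and> SG 3 3 [[1,3,5], [1,3,5], pieri 3 1, pieri 3 1, pieri 3 1]"
proof
  show "dnum 3 3 schubert_data = 6" by (rule dnum_schubert_data)
  show "SG 3 3 schubert_data" unfolding SG_def dnum_schubert_data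
  proof (intro exI[of _ "\<lambda>_. 1"] conjI allI impI)
    show "polyfun {..<length schubert_data} (\<lambda>_. 1 :: real)" by (rule pf_const)
    show "(\<lambda>_ :: nat \<Rightarrow> real. 1 :: real) \<noteq> (\<lambda>_. 0)" by (simp add: fun_eq_iff)
    fix s :: "nat \<Rightarrow> real" assume "inj_on s {..<length schubert_data} \<and> (1 :: real) \<noteq> 0"
    then have "inj_on s {..<5}" by (simp add: numeral_eq_Suc)
    from osc_flags_intersection[OF this]
    show "let S = schubert_inter 3 3 schubert_data (\<lambda>j. osc_flag (3 + 3) (s j))
        in finite S \<and> card S = 6 \<and> (\<forall>X\<in>S. real_point X)" by (simp add: Let_def)
  qed
qed

end
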